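(* Let $p$ be a prime. The map $\mathrm{Val}_p(\mathbb Q^{\rm cyc})\ni v\mapsto s_v\in\Sigma_p$ is a bijection and is equivariant for the action of $G_p=\mathrm{Gal}(\mathbb Q^{{\rm cyc},p}:\mathbb Q)$.
   Context: $\mathbb Q^{\rm cyc}$ is the field generated over $\mathbb Q$ by all (abstract) roots of unity. $\mu^{(p)}\subset\mathbb Q^{\rm cyc}$ is the group of roots of unity of order prime to $p$ and $\mathbb Q^{{\rm cyc},p}\subset\mathbb Q^{\rm cyc}$ the subfield generated by $\mu^{(p)}$. $\mathrm{Val}_p(\mathbb Q^{\rm cyc})$ is the set of extensions of the $p$-adic valuation of $\mathbb Q$ to $\mathbb Q^{\rm cyc}$. $\mathcal M(p)=\{0\}\cup\mu^{(p)}$ is the multiplicative monoid obtained by adjoining a zero to $\mu^{(p)}$. $\Sigma_p$ is the set of bijections $s:\mathcal M(p)\to\mathcal M(p)$ which commute with all their conjugates $R\circ s\circ R^{-1}$ under rotations $R$ (multiplications) by elements of $\mu^{(p)}$, and fulfill $s(0)=1$ and $s^p=s\circ s\circ\cdots\circ s=\mathrm{id}$. For $v\in\mathrm{Val}_p(\mathbb Q^{\rm cyc})$, the residue map of the restriction of $v$ to $\mathbb Q^{{\rm cyc},p}$ restricts to an isomorphism of multiplicative monoids $\epsilon$ from $\mathcal M(p)$ to the residue field (an algebraic closure of $\mathbb F_p$); $s_v\in\Sigma_p$ is the transported addition of $1$: $s_v(x)=\epsilon^{-1}(\epsilon(x)+1)$. $G_p\simeq\prod_{\ell\ne p}\mathbb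 Z_\ell^*$, the group of automorphisms of $\mu^{(p)}$. It is a factor of $\mathrm{Gal}(\mathbb Q^{\rm cyc}:\mathbb Q)=\mathbb Z_p^*\times G_p$ and acts on $\mathrm{Val}_p(\mathbb Q^{\rm cyc})$ by $v\mapsto v\circ g^{-1}$; it acts on $\Sigma_p$ by $s\mapsto g\circ s\circ g^{-1}$ (with $g(0)=0$). *)

theory Defs
  imports
    "HOL-Algebra.Algebra"
    "HOL-Algebra.Algebraic_Closure_Type"
    "HOL-Library.Extended_Real"
begin

hide_const (open) Divisibility.prime

section \<open>Cyclotomic fields\<close>

text \<open>The abstract roots of unity are modelled by the complex ones, so that all fields below are
  subfields of the complex numbers, viewed as rings in the sense of \<^theory>\<open>HOL-Algebra.Ring\<close>.\<close>

abbreviation complex_ring :: "complex ring"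
  where "complex_ring \<equiv> ring_of_type_algebra"

definition roots_of_unity :: "complex set"
  where "roots_of_unity = {z. \<exists>n>0. z ^ n = 1}"

definition mu :: "nat \<Rightarrow> complex set"
  where "mu p = {z. \<exists>n>0. coprime n p \<and> z ^ n = 1}"

definition mu_ppower :: "nat \<Rightarrow> complex set"
  where "mu_ppower p = {z. \<exists>k. z ^ (p ^ k) = 1}"

definition Qcyc :: "complex set"
  where "Qcyc = generate_field complex_ring roots_of_unity"

definition Qcyc_prime_to :: "nat \<Rightarrow> complex set"
  where "Qcyc_prime_to p = generate_field complex_ring (mu p)"

text \<open>Here \<open>K\<close> is a subfield of the complex numbers. As in \<^const>\<open>Bij\<close>, automorphisms are taken to be
  extensional (undefined outside \<open>K\<close>), and the group law is composition.\<close>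

definition Gal :: "complex set \<Rightarrow> (complex \<Rightarrow> complex) monoid"
  where "Gal K = BijGroup K
    \<lparr>carrier := {\<sigma> \<in> Bij K.
        \<sigma> \<in> ring_hom (complex_ring\<lparr>carrier := K\<rparr>) (complex_ring\<lparr>carrier := K\<rparr>) \<and>
        (\<forall>q::rat. \<sigma> (of_rat q) = of_rat q)}\<rparr>"


section \<open>Extensions of the p-adic valuation\<close>

definition padic_valuation :: "nat \<Rightarrow> rat \<Rightarrow> ereal"
  where "padic_valuation p q =
    (if q = 0 then \<infinity>
     else case quotient_of q of (a, b) \<Rightarrow>
       ereal (real (multiplicity (int p) a) - real (multiplicity (int p) b)))"

text \<open>Additively written valuations with values in the reals together with infinity.\<close>

definition is_valuation :: "complex set \<Rightarrow> (complex \<Rightarrow> ereal) \<Rightarrow> bool"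
  where "is_valuation K v \<longleftrightarrow>
    (\<forall>x\<in>K. v x \<noteq> -\<infinity>) \<and>
    (\<forall>x\<in>K. v x = \<infinity> \<longleftrightarrow> x = 0) \<and>
    (\<forall>x\<in>K. \<forall>y\<in>K. v (x * y) = v x + v y) \<and>
    (\<forall>x\<in>K. \<forall>y\<in>K. min (v x) (v y) \<le> v (x + y))"

text \<open>Since an element of \<open>Val p\<close> restricts to the normalized p-adic valuation itself, two distinct
  elements are never equivalent as valuations. Being extensional, they are determined by their
  values on \<^const>\<open>Qcyc\<close>.\<close>

definition Val :: "nat \<Rightarrow> (complex \<Rightarrow> ereal) set"
  where "Val p = {v \<in> extensional Qcyc.
    is_valuation Qcyc v \<and> (\<forall>q::rat. v (of_rat q) = padic_valuation p q)}"


section \<open>The monoid M(p) and the set of bijections\<close>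

definition M :: "nat \<Rightarrow> complex set"
  where "M p = {0} \<union> mu p"

definition rotation :: "nat \<Rightarrow> complex \<Rightarrow> complex \<Rightarrow> complex"
  where "rotation p \<zeta> = (\<lambda>x\<in>M p. \<zeta> * x)"

definition conj_by :: "nat \<Rightarrow> (complex \<Rightarrow> complex) \<Rightarrow> (complex \<Rightarrow> complex) \<Rightarrow> complex \<Rightarrow> complex"
  where "conj_by p r s = r \<otimes>\<^bsub>BijGroup (M p)\<^esub> s \<otimes>\<^bsub>BijGroup (M p)\<^esub> inv\<^bsub>BijGroup (M p)\<^esub> r"

definition Sigma_p :: "nat \<Rightarrow> (complex \<Rightarrow> complex) set"
  where "Sigma_p p = {s \<in> carrier (BijGroup (M p)).
    (\<forall>\<zeta>\<in>mu p. s \<otimes>\<^bsub>BijGroup (M p)\<^esub> conj_by p (rotation p \<zeta>) s =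
              conj_by p (rotation p \<zeta>) s \<otimes>\<^bsub>BijGroup (M p)\<^esub> s) \<and>
    s 0 = 1 \<and>
    s [^]\<^bsub>BijGroup (M p)\<^esub> p = \<one>\<^bsub>BijGroup (M p)\<^esub>}"


section \<open>Transported addition of 1\<close>

definition val_ring :: "nat \<Rightarrow> (complex \<Rightarrow> ereal) \<Rightarrow> complex ring"
  where "val_ring p v = complex_ring\<lparr>carrier := {x \<in> Qcyc_prime_to p. 0 \<le> v x}\<rparr>"

definition val_ideal :: "nat \<Rightarrow> (complex \<Rightarrow> ereal) \<Rightarrow> complex set"
  where "val_ideal p v = {x \<in> Qcyc_prime_to p. 0 < v x}"

definition residue_field :: "nat \<Rightarrow> (complex \<Rightarrow> ereal) \<Rightarrow> complex set ring"
  where "residue_field p v = val_ring p v Quot val_ideal p v"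

definition residue_map :: "nat \<Rightarrow> (complex \<Rightarrow> ereal) \<Rightarrow> complex \<Rightarrow> complex set"
  where "residue_map p v x = val_ideal p v +>\<^bsub>val_ring p v\<^esub> x"

definition s_val :: "nat \<Rightarrow> (complex \<Rightarrow> ereal) \<Rightarrow> complex \<Rightarrow> complex"
  where "s_val p v = (\<lambda>x\<in>M p. the_inv_into (M p) (residue_map p v)
    (residue_map p v x \<oplus>\<^bsub>residue_field p v\<^esub> \<one>\<^bsub>residue_field p v\<^esub>))"


section \<open>The group of automorphisms of the roots of unity of order prime to p\<close>

definition G :: "nat \<Rightarrow> (complex \<Rightarrow> complex) monoid"
  where "G p = AutoGroup \<lparr>carrier = mu p, monoid.mult = (*), one = 1\<rparr>"

text \<open>The embedding of \<open>G p\<close> as a direct factor of \<open>Gal Qcyc\<close>: the complementary factor, the group of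
  p-adic units, acts on the roots of unity of p-power order, so elements of \<open>G p\<close> fix these.\<close>

definition gal_lift :: "nat \<Rightarrow> (complex \<Rightarrow> complex) \<Rightarrow> complex \<Rightarrow> complex"
  where "gal_lift p g = (THE \<sigma>. \<sigma> \<in> carrier (Gal Qcyc) \<and>
    (\<forall>z\<in>mu p. \<sigma> z = g z) \<and> (\<forall>z\<in>mu_ppower p. \<sigma> z = z))"

definition act_Val :: "nat \<Rightarrow> (complex \<Rightarrow> complex) \<Rightarrow> (complex \<Rightarrow> ereal) \<Rightarrow> complex \<Rightarrow> ereal"
  where "act_Val p g = (\<lambda>v\<in>Val p. compose Qcyc v (inv\<^bsub>Gal Qcyc\<^esub> (gal_lift p g)))"

definition extend_zero :: "nat \<Rightarrow> (complex \<Rightarrow> complex) \<Rightarrow> complex \<Rightarrow> complex"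
  where "extend_zero p g = (\<lambda>x\<in>M p. if x = 0 then 0 else g x)"

definition act_Sigma :: "nat \<Rightarrow> (complex \<Rightarrow> complex) \<Rightarrow> (complex \<Rightarrow> complex) \<Rightarrow> complex \<Rightarrow> complex"
  where "act_Sigma p g = (\<lambda>s\<in>Sigma_p p. conj_by p (extend_zero p g) s)"

end

theory Submission
  imports Defs
begin

text \<open>Valuations and elements of \<open>Sigma_p\<close> are both matched with the prime ideals \<open>P\<close> above \<open>p\<close> of the ring
  \<open>Zcyc\<close> generated by all roots of unity. Frobenius congruences show that \<open>M p\<close> represents the residues modulo
  \<open>P\<close> and that, up to units at \<open>P\<close>, every nonzero element of \<open>Zcyc\<close> is a power of \<open>\<pi> = w - 1\<close> for some \<open>w\<close> of order
  \<open>p ^ k\<close>, while \<open>p\<close> is a power of \<open>\<pi>\<close>. Hence \<open>P\<close> carries exactly one extension of the p-adic valuation, and \<open>P\<close>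
  is recovered from the addition of 1 on \<open>M p\<close>. Conversely \<open>s\<close> makes \<open>M p\<close> a field of characteristic \<open>p\<close>, and since
  the relations between roots of unity are generated by the cyclotomic ones, projecting roots of unity to
  their parts of order prime to \<open>p\<close> extends to a ring homomorphism from \<open>Zcyc\<close> to that field, whose kernel
  is \<open>P\<close>. Irreducibility of the cyclotomic polynomials also extends automorphisms of groups of roots of
  unity to the fields generated by them.\<close>

section \<open>Relations between roots of unity\<close>

text \<open>Finitely many roots of unity generate a cyclic group, so a statement about
  \<open>Zcyc\<close> becomes one about an integer polynomial at a single root of unity, and
  polynomial division replaces number-field theory. No ring is localized: equations are multiplied
  by elements of \<open>Zcyc\<close> outside \<open>P\<close>, which play the role of units. The
  ramification at \<open>p\<close> is unbounded, so \<open>P\<close> has no uniformizer in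
  \<open>Zcyc\<close>; valuations are therefore read off at finite levels, as rational exponents of
  \<open>p\<close>. This total ramification also explains why \<open>s_val p v\<close>, which sees
  only \<open>Qcyc_prime_to p\<close>, determines \<open>v\<close> on all of \<open>Qcyc\<close>:
  roots of p-power order are congruent to 1 modulo every \<open>P\<close>, so they add nothing to
  the residue field and leave no choice in extending \<open>v\<close>. In the converse direction the
  multiplication on \<open>M p\<close> is that of the complex numbers and only the addition comes
  from \<open>s\<close>. The delicate point is that sending roots of p-power order to 1 respects
  additive relations: the sum of all p-th roots of unity is 0 and is sent to \<open>p\<close>, so
  characteristic \<open>p\<close> is essential.\<close>

definition ieval :: "int poly \<Rightarrow> 'a::comm_ring_1 \<Rightarrow> 'a"
  where "ieval f x = poly (map_poly of_int f) x"

lemma ieval_0 [simp]: "ieval 0 x = 0"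
  by (simp add: ieval_def)

lemma ieval_pCons [simp]: "ieval (pCons c f) x = of_int c + x * ieval f x"
  by (cases "c = 0 \<and> f = 0") (auto simp: ieval_def map_poly_pCons)

lemma ieval_1 [simp]: "ieval 1 x = 1"
  by (simp add: one_pCons)

lemma ieval_add [simp]: "ieval (f + g) x = ieval f x + ieval g x"
  by (induction f g rule: poly_induct2) (auto simp: algebra_simps)

lemma ieval_smult [simp]: "ieval (smult c f) x = of_int c * ieval f x"
  by (induction f) (auto simp: algebra_simps)

lemma ieval_minus [simp]: "ieval (- f) x = - ieval f x"
  using ieval_smult[of "-1" f x] by simp

lemma ieval_diff [simp]: "ieval (f - g) x = ieval f x - ieval g x"
  using ieval_add[of f "- g" x] by simp

lemma ieval_mult [simp]: "ieval (f * g) x = ieval f x * ieval g x"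
  by (induction f) (auto simp: algebra_simps mult_pCons_left)

lemma ieval_power [simp]: "ieval (f ^ n) x = ieval f x ^ n"
  by (induction n) auto

lemma ieval_monom [simp]: "ieval (monom c n) x = of_int c * x ^ n"
  by (induction n) (auto simp: monom_0 monom_Suc algebra_simps)

lemma ieval_pcompose [simp]: "ieval (pcompose f g) x = ieval f (ieval g x)"
  by (induction f) (auto simp: pcompose_pCons algebra_simps)

lemma ieval_prod [simp]: "ieval (prod h A) x = (\<Prod>i\<in>A. ieval (h i) x)"
  by (induction A rule: infinite_finite_induct) auto

lemma ieval_sum [simp]: "ieval (sum h A) x = (\<Sum>i\<in>A. ieval (h i) x)"
  by (induction A rule: infinite_finite_induct) auto

abbreviation unity_poly :: "nat \<Rightarrow> int poly"
  where "unity_poly n \<equiv> monom 1 n - 1"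

lemma degree_unity_poly: "n > 0 \<Longrightarrow> degree (unity_poly n) = n"
  using degree_add_eq_left[of "- 1 :: int poly" "monom 1 n"] by (simp add: degree_monom_eq)

lemma lead_coeff_unity_poly: "n > 0 \<Longrightarrow> lead_coeff (unity_poly n) = 1"
  by (simp add: degree_unity_poly coeff_1)

section \<open>Minimal polynomials of roots of unity over the integers\<close>

lemma int_poly_pseudo_division:
  fixes f F :: "int poly"
  assumes "F \<noteq> 0"
  obtains k q r where "smult (lead_coeff F ^ k) f = F * q + r"
    "r = 0 \<or> degree r < degree F"
proof -
  obtain q r where "pseudo_divmod f F = (q, r)"
    by force
  then show thesis
    using pseudo_divmod[OF assms] that by blast
qed

text \<open>Take a nonzero polynomial of least degree vanishing at \<open>z\<close> and make it
  primitive. Pseudo-division of \<open>h\<close> by it has remainder zero, and by Gauss's lemma the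
  constant multiplying \<open>h\<close> divides the content of the quotient, so it cancels and
  divisibility holds over the integers.\<close>

lemma minimal_int_poly:
  fixes z :: complex
  assumes "ieval g z = 0" "g \<noteq> 0"
  obtains F where "F \<noteq> 0" "ieval F z = 0" "\<And>h. ieval h z = 0 \<Longrightarrow> F dvd h"
proof -
  define D where "D = (\<lambda>d. \<exists>h. h \<noteq> 0 \<and> ieval h z = 0 \<and> degree h = d)"
  have "D (LEAST d. D d)"
    by (rule LeastI[of _ "degree g"]) (use assms in \<open>auto simp: D_def\<close>)
  then obtain F0 where F0: "F0 \<noteq> 0" "ieval F0 z = 0" "degree F0 = (LEAST d. D d)"
    by (auto simp: D_def)
  have min: "h = 0" if "ieval h z = 0" "degree h < degree F0" for h
    using not_less_Least[of "degree h" D] that F0(3) by (auto simp: D_def)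
  define F where "F = primitive_part F0"
  have F0_eq: "F0 = smult (content F0) F"
    by (simp add: F_def)
  have deg: "degree F = degree F0"
    by (simp add: F_def)
  have F: "F \<noteq> 0" "content F = 1"
    using F0(1) by (auto simp: F_def)
  have "of_int (content F0) * ieval F z = 0"
    using F0(2) F0_eq by (metis ieval_smult)
  then have root: "ieval F z = 0"
    using F0(1) by auto
  have "F dvd h" if h: "ieval h z = 0" for h
  proof -
    obtain k q r where div: "smult (lead_coeff F ^ k) h = F * q + r"
      "r = 0 \<or> degree r < degree F"
      using int_poly_pseudo_division[OF F(1)] .
    define c where "c = lead_coeff F ^ k"
    note c = div[folded c_def]
    have "c \<noteq> 0"
      using F(1) by (simp add: c_def)
    have "ieval r z = ieval (smult c h) z - ieval (F * q) z"
      by (simp add: c(1))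
    then have "ieval r z = 0"
      using h root by simp
    then have "r = 0"
      using min c(2) deg by auto
    then have eq: "smult c h = F * q"
      using c(1) by simp
    have "c dvd content (smult c h)"
      by simp
    also have "content (smult c h) = content q"
      by (simp add: eq content_mult F(2))
    finally have "[:c:] dvd q"
      by (simp add: const_poly_dvd_iff_dvd_content)
    then obtain q' where "q = smult c q'"
      by (elim dvdE) auto
    then have "smult c h = smult c (F * q')"
      using eq by simp
    then have "h = F * q'"
      using \<open>c \<noteq> 0\<close> by (simp add: smult_cancel)
    then show ?thesis
      by simp
  qed
  then show thesis
    using that F(1) root by blast
qed

lemma degree_le_imp_eq_0_of_roots:
  fixes r :: "int poly" and A :: "complex set"
  assumes "finite A" "\<And>z. z \<in> A \<Longrightarrow> ieval r z = 0" "degree r < card A"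
  shows "r = 0"
proof (rule ccontr)
  assume "r \<noteq> 0"
  define R where "R = (map_poly of_int r :: complex poly)"
  have R: "R \<noteq> 0" "degree R = degree r"
    using \<open>r \<noteq> 0\<close> by (auto simp: R_def poly_eq_iff coeff_map_poly intro!: degree_map_poly)
  have "card A \<le> card {z. poly R z = 0}"
    using assms(2) R(1) by (intro card_mono poly_roots_finite) (auto simp: R_def ieval_def)
  also have "\<dots> \<le> degree R"
    using R(1) by (rule card_poly_roots_bound)
  finally show False
    using assms(3) R(2) by simp
qed

text \<open>Since \<open>X ^ n - 1\<close> is monic, pseudo-division is genuine division; the
  remainder has degree below \<open>n\<close> but vanishes at all \<open>n\<close> roots of
  unity.\<close>

lemma unity_poly_dvdI:
  fixes f :: "int poly"
  assumes "n > 0" "\<And>z::complex. z ^ n = 1 \<Longrightarrow> ieval f z = 0"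
  shows "unity_poly n dvd f"
proof -
  have nz: "unity_poly n \<noteq> 0"
    using degree_unity_poly[of n] assms(1) by force
  obtain q r where div: "f = unity_poly n * q + r"
    "r = 0 \<or> degree r < degree (unity_poly n)"
    using int_poly_pseudo_division[OF nz, of f] lead_coeff_unity_poly[OF assms(1)]
    by (metis power_one smult_1_left)
  have "r = 0"
  proof (rule ccontr)
    assume "r \<noteq> 0"
    have "r = 0"
    proof (rule degree_le_imp_eq_0_of_roots)
      show "finite {z::complex. z ^ n = 1}"
        using assms(1) by (intro finite_roots_unity) auto
      show "degree r < card {z::complex. z ^ n = 1}"
        using \<open>r \<noteq> 0\<close> div(2) assms(1) by (simp add: card_roots_unity_eq degree_unity_poly)
      fix z :: complex assume "z \<in> {z. z ^ n = 1}"
      then have "z ^ n = 1"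
        by simp
      have "ieval r z = ieval f z - ieval (unity_poly n * q) z"
        by (subst div(1)) simp
      also have "\<dots> = 0"
        using \<open>z ^ n = 1\<close> assms(2) by simp
      finally show "ieval r z = 0" .
    qed
    then show False
      using \<open>r \<noteq> 0\<close> by simp
  qed
  then show ?thesis
    using div(1) by simp
qed

section \<open>Frobenius congruences and irreducibility of the cyclotomic polynomials\<close>

lemma prime_dvd_add_power_diff:
  fixes a b :: "'a::comm_ring_1"
  assumes "prime p"
  shows "of_nat p dvd (a + b) ^ p - a ^ p - b ^ p"
proof -
  have p: "p > 0"
    using assms prime_gt_0_nat by blast
  have "{..p} = insert 0 (insert p {0<..<p})"
    using p by auto
  then have "(a + b) ^ p = a ^ p + b ^ p + (\<Sum>k\<in>{0<..<p}. of_nat (p choose k) * a ^ k * b ^ (p - k))"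
    using p by (simp add: binomial_ring add_ac)
  moreover have "of_nat p dvd (\<Sum>k\<in>{0<..<p}. of_nat (p choose k) * a ^ k * b ^ (p - k))"
  proof (intro dvd_sum dvd_mult2)
    fix k assume "k \<in> {0<..<p}"
    then have "p dvd p choose k"
      using assms by (intro dvd_choose_prime) auto
    then show "of_nat p dvd (of_nat (p choose k) :: 'a)"
      by (elim dvdE) simp
  qed
  ultimately show ?thesis
    by simp
qed

lemma prime_dvd_int_power_diff:
  assumes "prime p"
  shows "int p dvd c ^ p - c"
proof (induction c rule: int_induct[of _ 0])
  case base
  show ?case
    using assms by (simp add: prime_gt_0_nat zero_power)
next
  case (step1 i)
  have "int p dvd ((i + 1) ^ p - i ^ p - 1 ^ p) + (i ^ p - i)"
    using prime_dvd_add_power_diff[OF assms, of i 1] step1 by (intro dvd_add) auto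
  then show ?case
    by (simp add: algebra_simps)
next
  case (step2 i)
  have "int p dvd (i ^ p - i) - ((i - 1 + 1) ^ p - (i - 1) ^ p - 1 ^ p)"
    using prime_dvd_add_power_diff[OF assms, of "i - 1" "1 :: int"] step2(2) by (rule dvd_diff[rotated]) 
  then show ?case
    by (simp add: algebra_simps)
qed

lemma poly_frobenius:
  fixes f :: "int poly"
  assumes "prime p"
  shows "of_nat p dvd f ^ p - pcompose f (monom 1 p)"
proof (induction f)
  case 0
  then show ?case
    using assms by (simp add: prime_gt_0_nat zero_power)
next
  case (pCons c f)
  have X: "pCons c f = [:c:] + monom 1 1 * f"
    by (simp add: monom_altdef)
  have "of_nat p dvd [:c ^ p - c:]"
    using prime_dvd_int_power_diff[OF assms, of c] by (simp add: of_nat_poly)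
  then have "of_nat p dvd (pCons c f ^ p - [:c:] ^ p - (monom 1 1 * f) ^ p) + [:c ^ p - c:]
      + monom 1 p * (f ^ p - pcompose f (monom 1 p))"
    unfolding X using prime_dvd_add_power_diff[OF assms, of "[:c:]" "monom 1 1 * f"] pCons.IH
    by (intro dvd_add dvd_mult)
  also have "(pCons c f ^ p - [:c:] ^ p - (monom 1 1 * f) ^ p) + [:c ^ p - c:]
      + monom 1 p * (f ^ p - pcompose f (monom 1 p)) = pCons c f ^ p - pcompose (pCons c f) (monom 1 p)"
    by (simp add: pcompose_pCons power_mult_distrib monom_power algebra_simps poly_const_pow flip: diff_pCons)
  finally show ?case .
qed

lemma root_of_unity_minimal_poly:
  fixes z :: complex
  assumes z: "z ^ n = 1" "n > 0"
  obtains F where "F \<noteq> 0" "ieval F z = 0" "\<And>h. ieval h z = 0 \<Longrightarrow> F dvd h"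
proof -
  have "unity_poly n \<noteq> 0" "ieval (unity_poly n) z = 0"
    using degree_unity_poly[OF z(2)] z by force+
  then show thesis
    using minimal_int_poly that by metis
qed

text \<open>The inverse of a prime is not an algebraic integer. The minimal polynomial
  \<open>F\<close> divides a monic polynomial, so its leading coefficient is a unit and
  \<open>g\<close> can be reduced to some \<open>r\<close> of degree below that of \<open>F\<close>.
  Then \<open>c - l * r\<close> vanishes at \<open>z\<close> with too small a degree, hence is zero,
  and its constant coefficient makes \<open>l\<close> divide the unit \<open>c\<close>.\<close>

lemma one_not_prime_multiple:
  fixes z :: complex
  assumes z: "z ^ n = 1" "n > 0" and "prime l" and eq: "1 = of_nat l * ieval g z"
  shows False
proof -
  obtain F where F: "F \<noteq> 0" "ieval F z = 0" "\<And>h. ieval h z = 0 \<Longrightarrow> F dvd h"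
    using root_of_unity_minimal_poly[OF z] by metis
  have "F dvd unity_poly n"
    by (rule F(3)) (use z in simp)
  then have "lead_coeff F dvd lead_coeff (unity_poly n)"
    by (metis dvd_def lead_coeff_mult)
  then have unit: "is_unit (lead_coeff F)"
    using lead_coeff_unity_poly[OF z(2)] by simp
  obtain k q r where div: "smult (lead_coeff F ^ k) g = F * q + r"
    "r = 0 \<or> degree r < degree F"
    using int_poly_pseudo_division[OF F(1)] .
  define c where "c = lead_coeff F ^ k"
  have "is_unit c"
    using unit by (simp add: c_def is_unit_power_iff del: zdvd1_eq)
  note cqr = this div[folded c_def]
  have deg: "degree F > 0"
  proof (rule ccontr)
    assume "\<not> ?thesis"
    then obtain a where "F = [:a:]"
      by (auto elim: degree_eq_zeroE)
    then show False
      using F(1,2) by auto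
  qed
  have "of_int c * (1::complex) = of_nat l * ieval (smult c g) z"
    using eq by simp
  also have "ieval (smult c g) z = ieval r z"
    unfolding cqr(2) using F(2) by simp
  finally have "ieval ([:c:] - smult (int l) r) z = 0"
    by simp
  then have "F dvd [:c:] - smult (int l) r"
    by (rule F(3))
  moreover have "degree ([:c:] - smult (int l) r) < degree F"
    using deg cqr(3) by (intro degree_diff_less) (auto intro: le_less_trans[OF degree_smult_le])
  ultimately have "[:c:] - smult (int l) r = 0"
    by (meson dvd_imp_degree_le leD)
  then have "Polynomial.coeff ([:c:] - smult (int l) r) 0 = 0"
    by simp
  then have "int l dvd c"
    by simp
  then have "is_unit (int l)"
    using cqr(1) dvd_trans by blast
  then show False
    using \<open>prime l\<close> by simp
qed

text \<open>The argument of Gauss: if the minimal polynomial \<open>F\<close> of \<open>z\<close> does not vanish at \<open>z ^ l\<close>, its cofactor in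
  \<open>X ^ n - 1\<close> does, and differentiating shows that \<open>F (z ^ l)\<close>, a multiple of \<open>l\<close>, divides \<open>n\<close>.\<close>

lemma ieval_power_prime_eq_0:
  fixes z :: complex
  assumes z: "z ^ n = 1" "n > 0" and l: "prime l" "\<not> l dvd n" and root: "ieval f z = 0"
  shows "ieval f (z ^ l) = 0"
proof -
  obtain F where F: "F \<noteq> 0" "ieval F z = 0" "\<And>h. ieval h z = 0 \<Longrightarrow> F dvd h"
    using root_of_unity_minimal_poly[OF z] by metis
  have "F dvd unity_poly n"
    by (rule F(3)) (use z in simp)
  then obtain H where H: "unity_poly n = F * H" ..
  obtain h where h: "F ^ l - pcompose F (monom 1 l) = of_nat l * h"
    using poly_frobenius[OF l(1)] by (rule dvdE)
  have "ieval (F ^ l - pcompose F (monom 1 l)) z = ieval (of_nat l * h) z"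
    by (simp only: h)
  then have Fl: "ieval F (z ^ l) = - of_nat l * ieval h z"
    using F(2) l(1) by (simp add: prime_gt_0_nat zero_power of_nat_poly minus_equation_iff[of "ieval F (z ^ l)"])
  have zl: "(z ^ l) ^ n = 1"
    by (metis z(1) power_mult mult.commute power_one)
  have "ieval F (z ^ l) = 0"
  proof (rule ccontr)
    assume ne: "ieval F (z ^ l) \<noteq> 0"
    have "ieval (unity_poly n) (z ^ l) = 0"
      using zl by simp
    then have H0: "ieval H (z ^ l) = 0"
      using ne H by simp
    have "pderiv (unity_poly n) = monom (int n) (n - 1)"
      by (simp add: pderiv_diff pderiv_monom)
    then have "ieval (monom (int n) (n - 1)) (z ^ l) = ieval (pderiv (F * H)) (z ^ l)"
      by (simp only: H)
    also have "\<dots> = ieval F (z ^ l) * ieval (pderiv H) (z ^ l)"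
      using H0 by (simp add: pderiv_mult)
    finally have "of_nat n * (z ^ l) ^ (n - 1) = - of_nat l * ieval h z * ieval (pderiv H) (z ^ l)"
      by (simp add: Fl)
    then have "of_nat n * ((z ^ l) ^ (n - 1) * z ^ l) = - of_nat l * ieval h z * ieval (pderiv H) (z ^ l) * z ^ l"
      by (simp only: mult.assoc[symmetric])
    moreover have "(z ^ l) ^ (n - 1) * z ^ l = (z ^ l) ^ n"
      using z(2) by (metis power_minus_mult)
    ultimately have n: "of_nat n = of_nat l * ieval (- (h * pcompose (pderiv H) (monom 1 l) * monom 1 l)) z"
      using zl by (simp add: algebra_simps)
    \<comment> \<open>The number \<open>n\<close> is now a multiple of \<open>l\<close> in the ring
      generated by \<open>z\<close>; as \<open>l\<close> does not divide \<open>n\<close>, Bezout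
      makes 1 such a multiple too.\<close>
    have "coprime (int n) (int l)"
      using l by (metis coprime_commute coprime_int_iff prime_imp_coprime)
    then obtain a b where "a * int n + b * int l = 1"
      by (metis bezout_int coprime_imp_gcd_eq_1)
    then have "(of_int a * of_nat n + of_int b * of_nat l :: complex) = 1"
      by (metis of_int_1 of_int_add of_int_mult of_int_of_nat_eq)
    then have "1 = of_nat l * ieval (smult a (- (h * pcompose (pderiv H) (monom 1 l) * monom 1 l)) + [:b:]) z"
      unfolding n by (simp add: algebra_simps)
    then show False
      using one_not_prime_multiple[OF z l(1)] by blast
  qed
  moreover obtain g where "f = F * g"
    using F(3)[OF root] ..
  ultimately show ?thesis
    by simp
qed

text \<open>Irreducibility of cyclotomic polynomials in the form used below: relations satisfied by
  \<open>z\<close> pass to its conjugates. The prime factors of \<open>k\<close> are split off one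
  at a time, since each intermediate power of \<open>z\<close> is again an \<open>n\<close>-th root
  of unity.\<close>

theorem ieval_power_coprime_eq_0:
  fixes z :: complex
  assumes "z ^ n = 1" "n > 0" "coprime k n" "ieval f z = 0"
  shows "ieval f (z ^ k) = 0"
  using assms
proof (induction k arbitrary: z rule: less_induct)
  case (less k)
  consider "k = 0" | "k = 1" | "k > 1"
    by linarith
  then show ?case
  proof cases
    case 1
    then show ?thesis
      using less.prems by simp
  next
    case 2
    then show ?thesis
      using less.prems by simp
  next
    case 3
    then obtain l where l: "prime l" "l dvd k"
      using prime_factor_nat[of k] by auto
    then obtain k' where k': "k = l * k'"
      by blast
    have "k' < k"
      using 3 k' l(1) prime_gt_1_nat[of l] by (cases "k' = 0") auto
    have "\<not> l dvd n"
      using l less.prems(3) by (metis coprime_common_divisor_nat not_prime_1 prime_nat_iff coprime_def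
          nat_dvd_1_iff_1)
    then have "ieval f (z ^ l) = 0"
      using ieval_power_prime_eq_0 less.prems l(1) by blast
    moreover have "(z ^ l) ^ n = 1"
      by (metis less.prems(1) power_mult mult.commute power_one)
    moreover have "coprime k' n"
      using less.prems(3) k' by simp
    ultimately show ?thesis
      using less.IH[OF \<open>k' < k\<close>, of "z ^ l"] less.prems(2) by (simp add: k' power_mult)
  qed
qed

text \<open>A replacement for the norm. Among the nonzero multiples of \<open>ieval g z\<close>
  choose one, \<open>ieval r z\<close>, with \<open>r\<close> of least degree; reducing modulo the
  minimal polynomial \<open>F\<close> shows \<open>degree r < degree F\<close>. If \<open>r\<close>
  were not constant, dividing \<open>F\<close> by \<open>r\<close> would leave a remainder vanishing
  at \<open>z\<close> by minimality, so \<open>F\<close> would divide both the remainder and the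
  quotient, which the degrees forbid.\<close>

lemma ieval_divides_int:
  fixes z :: complex
  assumes z: "z ^ n = 1" "n > 0" and "ieval g z \<noteq> 0"
  obtains h m where "m \<noteq> 0" "ieval h z * ieval g z = of_int m"
proof -
  obtain F where F: "F \<noteq> 0" "ieval F z = 0" "\<And>h. ieval h z = 0 \<Longrightarrow> F dvd h"
    using root_of_unity_minimal_poly[OF z] by metis
  define S where "S = (\<lambda>r. ieval r z \<noteq> 0 \<and> (\<exists>h. ieval r z = ieval h z * ieval g z))"
  have "S g"
    using assms(3) by (auto simp: S_def intro: exI[of _ 1])
  then obtain r where r: "S r" "\<And>t. degree t < degree r \<Longrightarrow> \<not> S t"
    using ex_has_least_nat[of S g degree] by (meson leD)
  obtain h where h: "ieval r z = ieval h z * ieval g z" and nz: "ieval r z \<noteq> 0"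
    using r(1) by (auto simp: S_def)
  have "r \<noteq> 0"
    using nz by auto
  have less: "degree r < degree F"
  proof (rule ccontr)
    assume ge: "\<not> ?thesis"
    obtain k q t where div: "smult (lead_coeff F ^ k) r = F * q + t"
      "t = 0 \<or> degree t < degree F"
      using int_poly_pseudo_division[OF F(1)] .
    define c where "c = lead_coeff F ^ k"
    note c = div[folded c_def]
    have "c \<noteq> 0"
      using F(1) by (simp add: c_def)
    have "ieval (smult c r) z = ieval (F * q + t) z"
      by (simp only: c(1))
    then have t: "ieval t z = of_int c * ieval r z"
      using F(2) by simp
    then have "t \<noteq> 0"
      using nz \<open>c \<noteq> 0\<close> by auto
    moreover have "S t"
      unfolding S_def using t nz \<open>c \<noteq> 0\<close> by (auto simp: h intro!: exI[of _ "smult c h"])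
    ultimately show False
      using r(2)[of t] c(2) ge by auto
  qed
  have "degree r = 0"
  proof (rule ccontr)
    assume deg: "degree r \<noteq> 0"
    obtain k q t where div: "smult (lead_coeff r ^ k) F = r * q + t"
      "t = 0 \<or> degree t < degree r"
      using int_poly_pseudo_division[OF \<open>r \<noteq> 0\<close>] .
    define c where "c = lead_coeff r ^ k"
    note c = div[folded c_def]
    have "c \<noteq> 0"
      using \<open>r \<noteq> 0\<close> by (simp add: c_def)
    have "ieval (smult c F) z = ieval (r * q + t) z"
      by (simp only: c(1))
    then have t: "ieval t z = - (ieval r z * ieval q z)"
      using F(2) by (simp add: add_eq_0_iff)
    have "degree t < degree r"
      using c(2) deg by auto
    then have "\<not> S t"
      by (rule r(2))
    moreover have "ieval t z = ieval (- (q * h)) z * ieval g z"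
      by (simp add: t h)
    ultimately have "ieval t z = 0"
      unfolding S_def by blast
    then have "ieval q z = 0"
      using t nz by simp
    then have "F dvd q"
      by (rule F(3))
    have "F dvd t"
      by (rule F(3)) fact
    have "t = 0"
      using \<open>F dvd t\<close> \<open>degree t < degree r\<close> less
      by (meson dvd_imp_degree_le leD less_trans)
    then have eq: "smult c F = r * q"
      using c(1) by simp
    then have "q \<noteq> 0"
      using F(1) \<open>c \<noteq> 0\<close> by auto
    then have "degree F = degree r + degree q"
      using arg_cong[OF eq, of degree] \<open>c \<noteq> 0\<close> \<open>r \<noteq> 0\<close> by (simp add: degree_mult_eq)
    then show False
      using dvd_imp_degree_le[OF \<open>F dvd q\<close> \<open>q \<noteq> 0\<close>] deg by simp
  qed
  then obtain m where "r = [:m:]"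
    by (auto elim: degree_eq_zeroE)
  show thesis
    by (rule that[of m h]) (use h nz \<open>r = [:m:]\<close> in auto)
qed


section \<open>Rings and fields generated by roots of unity\<close>

text \<open>For a monoid \<open>U\<close> of roots of unity this is the whole ring generated by \<open>U\<close>, because any two elements of
  \<open>U\<close> are powers of a third one.\<close>

definition int_span :: "complex set \<Rightarrow> complex set"
  where "int_span U = {ieval f z | f z. z \<in> U}"

section \<open>Orders and common generators of roots of unity\<close>

lemma root_of_unity_order:
  assumes "z \<in> roots_of_unity"
  obtains n where "n > 0" "\<And>k. z ^ k = 1 \<longleftrightarrow> n dvd k"
proof -
  define n where "n = (LEAST n. n > 0 \<and> z ^ n = 1)"
  have n: "n > 0" "z ^ n = 1"
    using assms LeastI_ex[of "\<lambda>n. n > 0 \<and> z ^ n = 1"] by (auto simp: roots_of_unity_def n_def)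
  have "n dvd k" if "z ^ k = 1" for k
  proof -
    have "z ^ k = (z ^ n) ^ (k div n) * z ^ (k mod n)"
      by (metis mult_div_mod_eq power_add power_mult)
    then have "z ^ (k mod n) = 1"
      using that n by simp
    then have "k mod n = 0"
      using not_less_Least[of "k mod n" "\<lambda>n. n > 0 \<and> z ^ n = 1"] n by (auto simp flip: n_def)
    then show ?thesis
      by auto
  qed
  moreover have "z ^ k = 1" if "n dvd k" for k
    using that n by (auto simp: power_mult elim!: dvdE)
  ultimately show thesis
    using that n(1) by blast
qed

lemma power_eq_1_coprime:
  fixes z :: complex
  assumes "z ^ a = 1" "z ^ b = 1" "coprime a b"
  shows "z = 1"
proof (cases "a = 0")
  case True
  then show ?thesis
    using assms by simp
next
  case False
  then have "z \<in> roots_of_unity"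
    using assms(1) by (auto simp: roots_of_unity_def)
  then obtain n where n: "n > 0" "\<And>k. z ^ k = 1 \<longleftrightarrow> n dvd k"
    using root_of_unity_order by blast
  have "n = 1"
    using assms n(2) by (metis coprime_common_divisor_nat)
  then show ?thesis
    using n(2)[of 1] by simp
qed

text \<open>Write \<open>a\<close> and \<open>b\<close> as powers \<open>w ^ s\<close> and
  \<open>w ^ t\<close> of a primitive \<open>N\<close>-th root of unity; \<open>w ^ gcd s t\<close>
  generates both. Giving it as a product of powers of \<open>a\<close> and \<open>b\<close> keeps it
  inside any monoid that contains them.\<close>

lemma common_root_of_unity:
  fixes a b :: complex
  assumes "a ^ N = 1" "b ^ N = 1" "N > 0"
  obtains k l i j where "a = (a ^ k * b ^ l) ^ i" "b = (a ^ k * b ^ l) ^ j"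
proof -
  define w where "w = cis (2 * pi / real N)"
  have w: "w ^ k = cis (2 * pi * real k / real N)" for k
    by (simp add: w_def DeMoivre algebra_simps)
  have wN: "w ^ N = 1"
    using assms(3) by (simp add: w)
  have powers: "\<exists>s. c = w ^ s" if "c ^ N = 1" for c
    using bij_betw_roots_unity[OF assms(3)] that unfolding w[symmetric] bij_betw_def by blast
  obtain s t where s: "a = w ^ s" and t: "b = w ^ t"
    using powers assms by metis
  show thesis
  proof (cases "s = 0")
    case True
    then have "a = 1"
      using s by simp
    show thesis
      by (rule that[of 0 1 0 1]) (simp_all add: \<open>a = 1\<close>)
  next
    case False
    then obtain x y where xy: "s * x = t * y + gcd s t"
      using bezout_nat by blast
    \<comment> \<open>The Bezout coefficient of \<open>t\<close> is \<open>- y\<close>; modulo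
      \<open>N\<close> it equals the natural number \<open>y * (N - 1)\<close>, usable as an
      exponent.\<close>
    define l where "l = y * (N - 1)"
    have "t * y * N = t * y + t * l"
      using assms(3) by (cases N) (auto simp: l_def algebra_simps)
    then have "s * x + t * l = gcd s t + t * y * N"
      using xy by simp
    then have "a ^ x * b ^ l = w ^ (gcd s t + t * y * N)"
      unfolding s t by (simp flip: power_mult power_add)
    also have "\<dots> = w ^ gcd s t"
      using wN by (simp add: power_add power_mult mult.commute[of _ N])
    finally have c: "a ^ x * b ^ l = w ^ gcd s t" .
    show thesis
      by (rule that[of x l "s div gcd s t" "t div gcd s t"], unfold c)
        (simp_all add: s t flip: power_mult)
  qed
qed

lemma root_power_mult:
  fixes x y :: complex
  assumes "x ^ m = 1" "y ^ n = 1"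
  shows "(x * y) ^ (m * n) = 1"
proof -
  have "(x * y) ^ (m * n) = (x ^ m) ^ n * (y ^ n) ^ m"
    by (simp add: power_mult_distrib mult.commute flip: power_mult)
  then show ?thesis
    using assms by simp
qed

text \<open>Used for all roots of unity, for those of order prime to \<open>p\<close>, and for the
  powers of one root. Inverses come for free, because elements of finite order have powers as
  inverses.\<close>

locale torsion_monoid =
  fixes U :: "complex set"
  assumes finite_order: "U \<subseteq> roots_of_unity"
    and one_in: "1 \<in> U"
    and mult_in: "x \<in> U \<Longrightarrow> y \<in> U \<Longrightarrow> x * y \<in> U"
begin

lemma power_in: "x \<in> U \<Longrightarrow> x ^ n \<in> U"
  by (induction n) (auto simp: one_in mult_in)

lemma common_generator:
  assumes "a \<in> U" "b \<in> U"
  obtains c i j where "c \<in> U" "a = c ^ i" "b = c ^ j"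
proof -
  obtain m n where "m > 0" "a ^ m = 1" "n > 0" "b ^ n = 1"
    using finite_order assms unfolding roots_of_unity_def by blast
  then have "a ^ (m * n) = 1" "b ^ (m * n) = 1" "m * n > 0"
    by (simp_all add: power_mult) (metis mult.commute power_mult power_one)
  then obtain k l i j where "a = (a ^ k * b ^ l) ^ i" "b = (a ^ k * b ^ l) ^ j"
    using common_root_of_unity by metis
  moreover have "a ^ k * b ^ l \<in> U"
    using assms by (intro mult_in power_in)
  ultimately show thesis
    using that by blast
qed

lemma int_spanI: "z \<in> U \<Longrightarrow> ieval f z \<in> int_span U"
  by (auto simp: int_span_def)

lemma int_span_common:
  assumes "x \<in> int_span U" "y \<in> int_span U"
  obtains c f g where "c \<in> U" "x = ieval f c" "y = ieval g c"
proof -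
  obtain a b f g where ab: "a \<in> U" "b \<in> U" and xy: "x = ieval f a" "y = ieval g b"
    using assms by (auto simp: int_span_def)
  obtain c i j where "c \<in> U" "a = c ^ i" "b = c ^ j"
    using common_generator ab .
  then show thesis
    using that[of c "pcompose f (monom 1 i)" "pcompose g (monom 1 j)"] xy by simp
qed

lemma int_span_add: "x \<in> int_span U \<Longrightarrow> y \<in> int_span U \<Longrightarrow> x + y \<in> int_span U"
  by (erule (1) int_span_common) (metis ieval_add int_spanI)

lemma int_span_mult: "x \<in> int_span U \<Longrightarrow> y \<in> int_span U \<Longrightarrow> x * y \<in> int_span U"
  by (erule (1) int_span_common) (metis ieval_mult int_spanI)

lemma int_span_diff: "x \<in> int_span U \<Longrightarrow> y \<in> int_span U \<Longrightarrow> x - y \<in> int_span U"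
  by (erule (1) int_span_common) (metis ieval_diff int_spanI)

lemma int_span_of_int: "of_int n \<in> int_span U"
  using int_spanI[OF one_in, of "[:n:]"] by simp

lemma int_span_of_nat: "of_nat n \<in> int_span U"
  using int_span_of_int[of "int n"] by simp

lemma int_span_0: "0 \<in> int_span U"
  using int_span_of_int[of 0] by simp

lemma int_span_1: "1 \<in> int_span U"
  using int_span_of_int[of 1] by simp

lemma int_span_minus: "x \<in> int_span U \<Longrightarrow> - x \<in> int_span U"
  using int_span_diff[OF int_span_0] by simp

lemma int_span_incl: "x \<in> U \<Longrightarrow> x \<in> int_span U"
  using int_spanI[of x "monom 1 1"] by simp

lemma int_span_power: "x \<in> int_span U \<Longrightarrow> x ^ n \<in> int_span U"
  by (induction n) (auto simp: int_span_1 int_span_mult)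

lemmas int_span_closed = int_span_add int_span_mult int_span_diff int_span_of_int int_span_of_nat
  int_span_0 int_span_1 int_span_minus int_span_incl int_span_power

lemma int_span_divides_int:
  assumes "x \<in> int_span U" "x \<noteq> 0"
  obtains y m where "y \<in> int_span U" "m \<noteq> 0" "y * x = of_int m"
proof -
  obtain f z where z: "z \<in> U" "x = ieval f z"
    using assms(1) by (auto simp: int_span_def)
  then obtain n where "n > 0" "z ^ n = 1"
    using finite_order by (auto simp: roots_of_unity_def)
  then obtain h m where "m \<noteq> 0" "ieval h z * ieval f z = of_int m"
    using ieval_divides_int assms(2) z(2) by metis
  then show thesis
    using that z int_spanI by blast
qed

end

section \<open>Fields generated by roots of unity\<close>

lemma complex_ring_simps:
  "carrier complex_ring = UNIV" "x \<otimes>\<^bsub>complex_ring\<^esub> y = x * y" "x \<oplus>\<^bsub>complex_ring\<^esub> y = x + y"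
  "\<one>\<^bsub>complex_ring\<^esub> = 1" "\<zero>\<^bsub>complex_ring\<^esub> = 0"
  by (simp_all add: ring_of_type_algebra_def)

lemma field_complex_ring: "field complex_ring"
  by (rule field_from_type_algebra)

lemma complex_ring_minus: "\<ominus>\<^bsub>complex_ring\<^esub> x = - x"
proof -
  interpret field complex_ring
    by (rule field_complex_ring)
  show ?thesis
    using minus_equality[of "- x" x] by (simp add: complex_ring_simps)
qed

lemma complex_ring_inverse: "x \<noteq> 0 \<Longrightarrow> inv\<^bsub>complex_ring\<^esub> x = inverse x"
proof -
  assume "x \<noteq> 0"
  interpret field complex_ring
    by (rule field_complex_ring)
  show ?thesis
    using comm_inv_char[of x "inverse x"] \<open>x \<noteq> 0\<close> by (simp add: complex_ring_simps)
qed

lemma generated_field_induct [consumes 1, case_names one incl minus inverse add mult]: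
  fixes S
  defines "K \<equiv> generate_field complex_ring S"
  assumes "x \<in> K" "P 1" "\<And>x. x \<in> S \<Longrightarrow> P x" "\<And>x. x \<in> K \<Longrightarrow> P x \<Longrightarrow> P (- x)"
    "\<And>x. x \<in> K \<Longrightarrow> x \<noteq> 0 \<Longrightarrow> P x \<Longrightarrow> P (inverse x)"
    "\<And>x y. x \<in> K \<Longrightarrow> y \<in> K \<Longrightarrow> P x \<Longrightarrow> P y \<Longrightarrow> P (x + y)"
    "\<And>x y. x \<in> K \<Longrightarrow> y \<in> K \<Longrightarrow> P x \<Longrightarrow> P y \<Longrightarrow> P (x * y)"
  shows "P x"
  using assms(2) unfolding K_def
  by induction
    (use assms(3-) in \<open>simp_all add: K_def complex_ring_simps complex_ring_minus complex_ring_inverse\<close>)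

lemma generated_field_closed:
  fixes S
  defines "K \<equiv> generate_field complex_ring S"
  shows "x \<in> S \<Longrightarrow> x \<in> K" "1 \<in> K" "0 \<in> K" "x \<in> K \<Longrightarrow> - x \<in> K" "x \<in> K \<Longrightarrow> y \<in> K \<Longrightarrow> x + y \<in> K"
    "x \<in> K \<Longrightarrow> y \<in> K \<Longrightarrow> x - y \<in> K"
    "x \<in> K \<Longrightarrow> y \<in> K \<Longrightarrow> x * y \<in> K" "x \<in> K \<Longrightarrow> inverse x \<in> K" "x \<in> K \<Longrightarrow> y \<in> K \<Longrightarrow> x / y \<in> K"
    "of_int m \<in> K" "of_rat q \<in> K" "x \<in> K \<Longrightarrow> x ^ n \<in> K"
proof -
  note [simp] = complex_ring_simps complex_ring_minus complex_ring_inverse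
  show incl: "x \<in> K" if "x \<in> S" for x
    unfolding K_def using that by (rule generate_field.incl)
  show one: "1 \<in> K"
    using generate_field.one[of complex_ring S] by (simp add: K_def)
  show minus: "- x \<in> K" if "x \<in> K" for x
    using generate_field.a_inv[of x complex_ring S] that by (simp add: K_def)
  show add: "x + y \<in> K" if "x \<in> K" "y \<in> K" for x y
    using generate_field.eng_add[of x complex_ring S y] that by (simp add: K_def)
  show diff: "x - y \<in> K" if "x \<in> K" "y \<in> K" for x y
    using add[OF that(1) minus[OF that(2)]] by simp
  show zero: "0 \<in> K"
    using diff[OF one one] by simp
  show mult: "x * y \<in> K" if "x \<in> K" "y \<in> K" for x y
    using generate_field.eng_mult[of x complex_ring S y] that by (simp add: K_def)
  show inv: "inverse x \<in> K" if "x \<in> K" for x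
    using generate_field.m_inv[of x complex_ring S] that zero by (cases "x = 0") (auto simp: K_def)
  show div: "x / y \<in> K" if "x \<in> K" "y \<in> K" for x y
    unfolding divide_inverse using that by (intro mult inv)
  show int: "of_int m \<in> K" for m
    by (induction m rule: int_induct[of _ 0]) (auto simp: zero one add diff)
  show "of_rat q \<in> K" for q
    by (cases q) (auto simp: of_rat_rat int div)
  show "x ^ n \<in> K" if "x \<in> K" for x
    by (induction n) (auto simp: one mult that)
qed

context torsion_monoid
begin

lemma int_span_subset_generated_field: "int_span U \<subseteq> generate_field complex_ring U"
proof
  fix x assume "x \<in> int_span U"
  then obtain f z where z: "z \<in> U" "x = ieval f z"
    by (auto simp: int_span_def)
  have "ieval f z \<in> generate_field complex_ring U"
    using z(1) by (induction f) (auto intro: generated_field_closed)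
  then show "x \<in> generate_field complex_ring U"
    using z by simp
qed

text \<open>Every nonzero element of \<open>int_span U\<close> divides a nonzero integer, so
  inverting integers alone already gives a field. This common integer denominator is what later
  reduces valuations and homomorphisms on the field to the ring.\<close>

theorem generated_field_iff:
  "x \<in> generate_field complex_ring U \<longleftrightarrow> (\<exists>m::int. m \<noteq> 0 \<and> of_int m * x \<in> int_span U)"
proof
  assume "x \<in> generate_field complex_ring U"
  then show "\<exists>m::int. m \<noteq> 0 \<and> of_int m * x \<in> int_span U"
  proof (induction rule: generated_field_induct)
    case one
    then show ?case
      by (intro exI[of _ 1]) (auto simp: int_span_closed)
  next
    case (incl x)
    then show ?case
      by (intro exI[of _ 1]) (auto simp: int_span_closed)
  next
    case (minus x)
    then show ?case
      using int_span_minus by fastforce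
  next
    case (inverse x)
    then obtain m :: int where "m \<noteq> 0" "of_int m * x \<in> int_span U"
      by auto
    then obtain y k where y: "y \<in> int_span U" "k \<noteq> 0" "y * (of_int m * x) = of_int k"
      using int_span_divides_int[of "of_int m * x"] \<open>x \<noteq> 0\<close> by auto
    then have "of_int k * inverse x = of_int m * y"
      using \<open>x \<noteq> 0\<close> by (simp add: field_simps)
    then show ?case
      using y by (intro exI[of _ k]) (auto simp: int_span_closed)
  next
    case (add x y)
    then obtain m k :: int where "m \<noteq> 0" "of_int m * x \<in> int_span U" "k \<noteq> 0" "of_int k * y \<in> int_span U"
      by auto
    then have "of_int k * (of_int m * x) + of_int m * (of_int k * y) \<in> int_span U" "m * k \<noteq> 0"
      by (auto simp: int_span_closed)
    then show ?case
      by (intro exI[of _ "m * k"]) (auto simp: algebra_simps)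
  next
    case (mult x y)
    then obtain m k :: int where "m \<noteq> 0" "of_int m * x \<in> int_span U" "k \<noteq> 0" "of_int k * y \<in> int_span U"
      by auto
    then have "(of_int m * x) * (of_int k * y) \<in> int_span U" "m * k \<noteq> 0"
      by (auto simp: int_span_closed)
    then show ?case
      by (intro exI[of _ "m * k"]) (auto simp: algebra_simps)
  qed
next
  assume "\<exists>m::int. m \<noteq> 0 \<and> of_int m * x \<in> int_span U"
  then obtain m :: int where m: "m \<noteq> 0" "of_int m * x \<in> int_span U"
    by auto
  then have "of_int m * x / of_int m \<in> generate_field complex_ring U"
    using int_span_subset_generated_field by (intro generated_field_closed(9,10)) auto
  then show "x \<in> generate_field complex_ring U"
    using m(1) by simp
qed

end

interpretation roots: torsion_monoid roots_of_unity
proof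
  show "1 \<in> roots_of_unity"
    by (auto simp: roots_of_unity_def intro: exI[of _ 1])
  fix x y assume "x \<in> roots_of_unity" "y \<in> roots_of_unity"
  then obtain m n where "m > 0" "x ^ m = 1" "n > 0" "y ^ n = 1"
    by (auto simp: roots_of_unity_def)
  then have "m * n > 0" "(x * y) ^ (m * n) = 1"
    using root_power_mult[of x m y n] by auto
  then show "x * y \<in> roots_of_unity"
    unfolding roots_of_unity_def by blast
qed auto

interpretation mu: torsion_monoid "mu p" for p
proof
  show "mu p \<subseteq> roots_of_unity"
    by (auto simp: roots_of_unity_def mu_def)
  show "1 \<in> mu p"
    by (auto simp: mu_def intro: exI[of _ 1])
  fix x y assume "x \<in> mu p" "y \<in> mu p"
  then obtain m n where "m > 0" "x ^ m = 1" "n > 0" "y ^ n = 1" "coprime m p" "coprime n p"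
    by (auto simp: mu_def)
  then have "m * n > 0" "(x * y) ^ (m * n) = 1" "coprime (m * n) p"
    using root_power_mult[of x m y n] by auto
  then show "x * y \<in> mu p"
    unfolding mu_def by blast
qed

lemma mu_ppower_mult: "x \<in> mu_ppower p \<Longrightarrow> y \<in> mu_ppower p \<Longrightarrow> x * y \<in> mu_ppower p"
proof -
  assume "x \<in> mu_ppower p" "y \<in> mu_ppower p"
  then obtain k l where "x ^ (p ^ k) = 1" "y ^ (p ^ l) = 1"
    by (auto simp: mu_ppower_def)
  then have "(x * y) ^ (p ^ (k + l)) = 1"
    unfolding power_add by (rule root_power_mult)
  then show ?thesis
    unfolding mu_ppower_def by blast
qed

lemma mu_ppower_subset: "p > 0 \<Longrightarrow> mu_ppower p \<subseteq> roots_of_unity"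
  by (auto simp: mu_ppower_def roots_of_unity_def) (use zero_less_power in blast)

lemma roots_of_unity_nonzero: "x \<in> roots_of_unity \<Longrightarrow> x \<noteq> 0"
  by (auto simp: roots_of_unity_def power_0_left)

lemma mu_inverse: "x \<in> mu p \<Longrightarrow> inverse x \<in> mu p"
  unfolding mu_def by (auto simp: power_inverse)

lemma mu_nonzero: "x \<in> mu p \<Longrightarrow> x \<noteq> 0"
  using mu.finite_order roots_of_unity_nonzero by blast

section \<open>Splitting a root of unity into parts of order prime to p and of p-power order\<close>

lemma mu_inter_mu_ppower:
  assumes "x \<in> mu p" "x \<in> mu_ppower p"
  shows "x = 1"
proof -
  obtain n k where "coprime n p" "x ^ n = 1" "x ^ (p ^ k) = 1"
    using assms by (auto simp: mu_def mu_ppower_def)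
  then show ?thesis
    by (intro power_eq_1_coprime[of x n "p ^ k"]) auto
qed

text \<open>Bezout for the coprime factors \<open>p ^ k\<close> and \<open>m\<close> of
  \<open>n\<close>: the exponents are a multiple of \<open>p ^ k\<close> and a multiple of
  \<open>m\<close> with sum 1 modulo \<open>n\<close>. Both parts are powers of \<open>z\<close>
  itself, so they stay in the ring that \<open>z\<close> generates.\<close>

lemma prime_to_decomposition_order:
  assumes "prime p" and n: "n > 0" "z ^ n = (1 :: complex)"
  obtains k m i j where "n = p ^ k * m" "\<not> p dvd m" "z = z ^ i * z ^ j" "(z ^ i) ^ m = 1" "(z ^ j) ^ (p ^ k) = 1"
proof -
  have "\<not> is_unit p" "n \<noteq> 0"
    using assms by auto
  then obtain m where m: "n = p ^ multiplicity p n * m" "\<not> p dvd m"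
    using multiplicity_decompose' by metis
  define k where "k = multiplicity p n"
  have "coprime (p ^ k) m"
    using assms(1) m(2) prime_imp_coprime by auto
  then obtain x y where xy: "p ^ k * x = m * y + 1"
    using bezout_nat[of "p ^ k" m] assms(1) by (auto simp: prime_gt_0_nat)
  \<comment> \<open>A natural number congruent to \<open>- m * y\<close> modulo
    \<open>n\<close>.\<close>
  define j where "j = m * y * (n - 1)"
  have "m * y + j = m * y * n"
    using n(1) by (cases n) (auto simp: j_def)
  then have "p ^ k * x + j = 1 + n * (m * y)"
    using xy by simp
  then have "z ^ (p ^ k * x) * z ^ j = z ^ (1 + n * (m * y))"
    by (simp flip: power_add)
  also have "\<dots> = z"
    using n(2) by (simp add: power_add power_mult)
  finally have zz: "z = z ^ (p ^ k * x) * z ^ j" ..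
  have nk: "n = p ^ k * m"
    using m(1) by (simp only: k_def)
  have 1: "(z ^ (p ^ k * x)) ^ m = (z ^ n) ^ x"
    unfolding nk power_mult[symmetric] by (simp add: mult_ac)
  have 2: "(z ^ j) ^ (p ^ k) = (z ^ n) ^ (y * (n - 1))"
  proof -
    have "j * p ^ k = (p ^ k * m) * (y * (n - 1))"
      by (simp only: j_def mult_ac)
    then show ?thesis
      unfolding power_mult[symmetric] nk[symmetric] by (rule arg_cong)
  qed
  show thesis
    using nk m(2) zz by (rule that) (simp_all only: 1 2 n(2) power_one)
qed

lemma prime_to_decomposition:
  assumes "prime p" "z \<in> roots_of_unity"
  obtains i j where "z = z ^ i * z ^ j" "z ^ i \<in> mu p" "z ^ j \<in> mu_ppower p"
proof -
  obtain n where "n > 0" "z ^ n = 1"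
    using assms(2) by (auto simp: roots_of_unity_def)
  then obtain k m i j where *: "n = p ^ k * m" "\<not> p dvd m" "z = z ^ i * z ^ j" "(z ^ i) ^ m = 1" "(z ^ j) ^ (p ^ k) = 1"
    using prime_to_decomposition_order assms(1) by metis
  moreover have "coprime m p" "m > 0"
    using *(1,2) \<open>n > 0\<close> assms(1) prime_imp_coprime coprime_commute by (blast, auto)
  ultimately show thesis
    using that[of i j] unfolding mu_def mu_ppower_def by blast
qed

definition prime_to_part :: "nat \<Rightarrow> complex \<Rightarrow> complex"
  where "prime_to_part p z = (THE a. a \<in> mu p \<and> (\<exists>b\<in>mu_ppower p. z = a * b))"

lemma prime_to_part_unique:
  assumes "prime p" "a \<in> mu p" "b \<in> mu_ppower p"
  shows "prime_to_part p (a * b) = a"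
  unfolding prime_to_part_def
proof (rule the_equality)
  show "a \<in> mu p \<and> (\<exists>ba\<in>mu_ppower p. a * b = a * ba)"
    using assms by blast
  fix c assume "c \<in> mu p \<and> (\<exists>d\<in>mu_ppower p. a * b = c * d)"
  then obtain d where d: "c \<in> mu p" "d \<in> mu_ppower p" "a * b = c * d"
    by blast
  have nz: "a \<noteq> 0" "b \<noteq> 0" "c \<noteq> 0" "d \<noteq> 0"
    using assms d mu_nonzero mu_ppower_subset[of p] roots_of_unity_nonzero prime_gt_0_nat by blast+
  have "inverse b \<in> mu_ppower p"
    using assms(3) by (auto simp: mu_ppower_def power_inverse)
  then have "a * inverse c \<in> mu p" "d * inverse b \<in> mu_ppower p"
    using assms d by (auto intro: mu.mult_in mu_inverse mu_ppower_mult)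
  moreover have "a * inverse c = d * inverse b"
    using d(3) nz by (simp add: field_simps)
  ultimately have "a * inverse c = 1"
    using mu_inter_mu_ppower by metis
  then show "c = a"
    using nz by (simp add: field_simps)
qed

lemma prime_to_part_powers:
  assumes "prime p" "z \<in> roots_of_unity"
  obtains i j where "prime_to_part p z = z ^ i" "z = prime_to_part p z * z ^ j"
    "prime_to_part p z \<in> mu p" "z ^ j \<in> mu_ppower p"
proof -
  obtain i j where *: "z = z ^ i * z ^ j" "z ^ i \<in> mu p" "z ^ j \<in> mu_ppower p"
    using prime_to_decomposition assms by blast
  then have "prime_to_part p z = z ^ i"
    using prime_to_part_unique[OF assms(1) *(2,3)] by simp
  then show thesis
    using that[of i j] * by simp
qed

lemma prime_to_part_in: "prime p \<Longrightarrow> z \<in> roots_of_unity \<Longrightarrow> prime_to_part p z \<in> mu p"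
  by (erule (1) prime_to_part_powers)

lemma prime_to_part_mult:
  assumes "prime p" "x \<in> roots_of_unity" "y \<in> roots_of_unity"
  shows "prime_to_part p (x * y) = prime_to_part p x * prime_to_part p y"
proof -
  obtain i where i: "x = prime_to_part p x * x ^ i" "prime_to_part p x \<in> mu p" "x ^ i \<in> mu_ppower p"
    using prime_to_part_powers assms by metis
  obtain j where j: "y = prime_to_part p y * y ^ j" "prime_to_part p y \<in> mu p" "y ^ j \<in> mu_ppower p"
    using prime_to_part_powers assms by metis
  have "x * y = (prime_to_part p x * prime_to_part p y) * (x ^ i * y ^ j)"
    using i(1) j(1) by (metis mult.assoc mult.left_commute)
  then show ?thesis
    using prime_to_part_unique[OF assms(1) mu.mult_in[OF i(2) j(2)] mu_ppower_mult[OF i(3) j(3)]] by simp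
qed

lemma prime_to_part_mu: "prime p \<Longrightarrow> z \<in> mu p \<Longrightarrow> prime_to_part p z = z"
  using prime_to_part_unique[of p z 1] by (simp add: mu_ppower_def)

lemma prime_to_part_mu_ppower: "prime p \<Longrightarrow> z \<in> mu_ppower p \<Longrightarrow> prime_to_part p z = 1"
  using prime_to_part_unique[of p 1 z] by (simp add: mu.one_in)

section \<open>Ring homomorphisms on cyclotomic rings\<close>

context cring
begin

definition int_const :: "int \<Rightarrow> 'a"
  where "int_const c = [c] \<cdot> \<one>"

lemma int_const_closed [simp]: "int_const c \<in> carrier R"
  by (simp add: int_const_def)

lemma int_const_0 [simp]: "int_const 0 = \<zero>"
  by (simp add: int_const_def add_pow_def)

lemma int_const_1 [simp]: "int_const 1 = \<one>"
  by (simp add: int_const_def)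

lemma int_const_add: "int_const (c + d) = int_const c \<oplus> int_const d"
  by (simp add: int_const_def add.int_pow_mult)

lemma int_const_mult: "int_const (c * d) = int_const c \<otimes> int_const d"
  by (simp add: int_const_def add_pow_ldistr_int add.int_pow_pow mult.commute)

text \<open>Counterpart of \<open>ieval\<close> for rings given as records. It is needed because the
  target \<open>Sigma_ring\<close> lives on complex numbers but has an addition different from that
  of the type.\<close>

definition eval_int_poly :: "'a \<Rightarrow> int poly \<Rightarrow> 'a"
  where "eval_int_poly x f = fold_coeffs (\<lambda>c y. int_const c \<oplus> x \<otimes> y) f \<zero>"

lemma eval_int_poly_0 [simp]: "eval_int_poly x 0 = \<zero>"
  by (simp add: eval_int_poly_def)

lemma eval_int_poly_pCons [simp]:
  "x \<in> carrier R \<Longrightarrow> eval_int_poly x (pCons c f) = int_const c \<oplus> x \<otimes> eval_int_poly x f"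
  by (cases "c = 0 \<and> f = 0") (auto simp: eval_int_poly_def)

context
  fixes x assumes x [simp]: "x \<in> carrier R"
begin

lemma eval_int_poly_closed [simp]: "eval_int_poly x f \<in> carrier R"
  by (induction f) auto

lemma eval_int_poly_1 [simp]: "eval_int_poly x 1 = \<one>"
  by (simp add: one_pCons)

lemma eval_int_poly_add: "eval_int_poly x (f + g) = eval_int_poly x f \<oplus> eval_int_poly x g"
  by (induction f g rule: poly_induct2) (auto simp: int_const_add r_distr a_ac)

lemma eval_int_poly_smult: "eval_int_poly x (smult c f) = int_const c \<otimes> eval_int_poly x f"
  by (induction f) (auto simp: int_const_mult r_distr m_ac)

lemma eval_int_poly_mult: "eval_int_poly x (f * g) = eval_int_poly x f \<otimes> eval_int_poly x g"
  by (induction f) (auto simp: mult_pCons_left eval_int_poly_add eval_int_poly_smult l_distr m_assoc)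

lemma eval_int_poly_diff: "eval_int_poly x (f - g) = eval_int_poly x f \<ominus> eval_int_poly x g"
proof -
  have "eval_int_poly x (f - g) \<oplus> eval_int_poly x g = eval_int_poly x f"
    by (simp flip: eval_int_poly_add)
  then have "eval_int_poly x f \<ominus> eval_int_poly x g =
      eval_int_poly x (f - g) \<oplus> eval_int_poly x g \<ominus> eval_int_poly x g"
    by simp
  also have "\<dots> = eval_int_poly x (f - g)"
    by (simp add: minus_eq a_assoc r_neg)
  finally show ?thesis ..
qed

lemma eval_int_poly_X_power [simp]: "eval_int_poly x (Polynomial.monom 1 n) = x [^] n"
  by (induction n) (auto simp: monom_0 monom_Suc m_comm)

lemma eval_int_poly_pcompose:
  "eval_int_poly x (pcompose f g) = eval_int_poly (eval_int_poly x g) f"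
  by (induction f) (auto simp: pcompose_pCons eval_int_poly_add eval_int_poly_mult)

text \<open>The polynomial is the cofactor of \<open>X ^ r - 1\<close> in
  \<open>X ^ (r * n) - 1\<close>. For \<open>n = p\<close> its value is zero in characteristic
  \<open>p\<close>.\<close>

lemma eval_int_poly_sum_X_power:
  assumes "x [^] r = \<one>"
  shows "eval_int_poly x (\<Sum>i<n. Polynomial.monom 1 (r * i)) = int_const (int n)"
proof (induction n)
  case (Suc n)
  have "x [^] (r * n) = \<one>"
    using assms by (simp flip: nat_pow_pow)
  then show ?case
    using Suc int_const_add[of "int n" 1] by (simp add: eval_int_poly_add a_comm add.commute[of 1])
qed auto

lemma eval_int_poly_unity: "eval_int_poly x (unity_poly n) = x [^] n \<ominus> \<one>"
  by (simp add: eval_int_poly_diff)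

end

end

lemma (in domain) eval_int_poly_prod_unity_nonzero:
  assumes "x \<in> carrier R" "finite D" "\<And>d. d \<in> D \<Longrightarrow> x [^] d \<noteq> \<one>"
  shows "eval_int_poly x (\<Prod>d\<in>D. unity_poly d) \<noteq> \<zero>"
  using assms(2,3)
proof (induction rule: finite_induct)
  case (insert d D)
  have "x [^] d \<ominus> \<one> \<noteq> \<zero>"
    using insert.prems assms(1) by simp
  then have "eval_int_poly x (unity_poly d) \<noteq> \<zero>"
    using assms(1) by (simp add: eval_int_poly_unity)
  then show ?case
    using insert assms(1) by (simp add: eval_int_poly_mult integral_iff)
qed (use assms(1) in auto)

text \<open>Sending \<open>ieval f z\<close> to the value of \<open>f\<close> at
  \<open>\<chi> z\<close> is well defined: two representations of one element can be rewritten over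
  a common generator, where their difference is a relation that \<open>rel\<close> preserves. Any
  two elements share a generator as well, so sums and products are computed with
  polynomials.\<close>

theorem (in torsion_monoid) int_span_extension:
  assumes "cring R" and \<chi>: "\<And>z. z \<in> U \<Longrightarrow> \<chi> z \<in> carrier R" "\<chi> 1 = \<one>\<^bsub>R\<^esub>"
      "\<And>x y. x \<in> U \<Longrightarrow> y \<in> U \<Longrightarrow> \<chi> (x * y) = \<chi> x \<otimes>\<^bsub>R\<^esub> \<chi> y"
    and rel: "\<And>z f. z \<in> U \<Longrightarrow> ieval f z = 0 \<Longrightarrow> cring.eval_int_poly R (\<chi> z) f = \<zero>\<^bsub>R\<^esub>"
  obtains \<psi> where "\<And>x. x \<in> int_span U \<Longrightarrow> \<psi> x \<in> carrier R"
    "\<And>x y. x \<in> int_span U \<Longrightarrow> y \<in> int_span U \<Longrightarrow> \<psi> (x + y) = \<psi> x \<oplus>\<^bsub>R\<^esub> \<psi> y"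
    "\<And>x y. x \<in> int_span U \<Longrightarrow> y \<in> int_span U \<Longrightarrow> \<psi> (x * y) = \<psi> x \<otimes>\<^bsub>R\<^esub> \<psi> y"
    "\<And>z. z \<in> U \<Longrightarrow> \<psi> z = \<chi> z" "\<And>m. \<psi> (of_int m) = cring.int_const R m"
proof -
  interpret R: cring R
    by (rule assms(1))
  have pow: "\<chi> (z ^ n) = \<chi> z [^]\<^bsub>R\<^esub> n" if "z \<in> U" for z n
    using that by (induction n) (auto simp: \<chi> power_in R.m_comm)
  have key: "R.eval_int_poly (\<chi> a) f = R.eval_int_poly (\<chi> b) g"
    if ab: "a \<in> U" "b \<in> U" and eq: "ieval f a = ieval g b" for a b f g
  proof -
    obtain c i j where c: "c \<in> U" "a = c ^ i" "b = c ^ j"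
      using common_generator ab .
    have "ieval (pcompose f (Polynomial.monom 1 i) - pcompose g (Polynomial.monom 1 j)) c = 0"
      using eq c by simp
    then have "R.eval_int_poly (\<chi> c) (pcompose f (Polynomial.monom 1 i) - pcompose g (Polynomial.monom 1 j)) = \<zero>\<^bsub>R\<^esub>"
      by (intro rel c(1))
    then show ?thesis
      using c \<chi>(1) by (simp add: R.eval_int_poly_diff R.eval_int_poly_pcompose pow)
  qed
  \<comment> \<open>An arbitrary representation is chosen; \<open>key\<close> makes the value
    independent of the choice.\<close>
  define rep where "rep = (\<lambda>x. SOME (z, f). z \<in> U \<and> x = ieval f z)"
  define \<psi> where "\<psi> = (\<lambda>x. case rep x of (z, f) \<Rightarrow> R.eval_int_poly (\<chi> z) f)"
  have \<psi>: "\<psi> (ieval f z) = R.eval_int_poly (\<chi> z) f" if "z \<in> U" for f z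
  proof -
    have "case rep (ieval f z) of (w, g) \<Rightarrow> w \<in> U \<and> ieval f z = ieval g w"
      unfolding rep_def by (rule someI[of _ "(z, f)"]) (use that in simp)
    then show ?thesis
      unfolding \<psi>_def using key that by (cases "rep (ieval f z)") auto
  qed
  show thesis
  proof
    fix x y assume x: "x \<in> int_span U" and y: "y \<in> int_span U"
    obtain c f g where c: "c \<in> U" "x = ieval f c" "y = ieval g c"
      using int_span_common x y .
    show "\<psi> (x + y) = \<psi> x \<oplus>\<^bsub>R\<^esub> \<psi> y"
      using c \<psi>[OF c(1), of "f + g"] \<chi>(1) by (simp add: \<psi> R.eval_int_poly_add)
    show "\<psi> (x * y) = \<psi> x \<otimes>\<^bsub>R\<^esub> \<psi> y"
      using c \<psi>[OF c(1), of "f * g"] \<chi>(1) by (simp add: \<psi> R.eval_int_poly_mult)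
  next
    fix x assume "x \<in> int_span U"
    then show "\<psi> x \<in> carrier R"
      using \<chi>(1) by (auto simp: int_span_def \<psi>)
  next
    fix z assume "z \<in> U"
    then show "\<psi> z = \<chi> z"
      using \<psi>[of z "Polynomial.monom 1 1"] \<chi>(1) by simp
  next
    fix m
    show "\<psi> (of_int m) = R.int_const m"
      using \<psi>[OF one_in, of "[:m:]"] \<chi>(1)[OF one_in] by simp
  qed
qed

text \<open>A count: the first \<open>n\<close> powers of \<open>z\<close> are distinct, and there
  are only \<open>n\<close> solutions of \<open>w ^ n = 1\<close>.\<close>

lemma primitive_root_powers:
  fixes z :: complex
  assumes "n > 0" "\<And>k. z ^ k = 1 \<longleftrightarrow> n dvd k" and w: "w ^ n = 1"
  obtains j where "w = z ^ j"
proof -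
  have "z \<noteq> 0"
    using assms(1) assms(2)[of n] by (auto simp: power_0_left)
  have "inj_on (\<lambda>j. z ^ j) {..<n}"
  proof (rule linorder_inj_onI)
    fix i j assume ij: "i < j" "i \<in> {..<n}" "j \<in> {..<n}"
    show "z ^ i \<noteq> z ^ j"
    proof
      assume "z ^ i = z ^ j"
      then have "z ^ (j - i) = 1"
        using ij \<open>z \<noteq> 0\<close> by (simp add: power_diff)
      then have "n dvd j - i"
        using assms(2) by simp
      then show False
        using ij by (auto dest: dvd_imp_le)
    qed
  qed auto
  then have card: "card ((\<lambda>j. z ^ j) ` {..<n}) = card {w::complex. w ^ n = 1}"
    using assms(1) by (simp add: card_image card_roots_unity_eq)
  have "z ^ n = 1"
    using assms(2) by simp
  then have "(\<lambda>j. z ^ j) ` {..<n} \<subseteq> {w. w ^ n = 1}"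
    by (auto simp: mult.commute[of _ n] power_mult simp flip: power_mult)
      (metis mult.commute power_mult power_one)
  then have "(\<lambda>j. z ^ j) ` {..<n} = {w. w ^ n = 1}"
    using card assms(1) by (intro card_subset_eq finite_roots_unity) auto
  then show thesis
    using w that by blast
qed

text \<open>With \<open>k\<close> the exponent of \<open>p\<close> in the order \<open>n = p ^ k * m\<close> of \<open>z\<close>, the polynomial \<open>f\<close> vanishes at
  all primitive \<open>n\<close>-th roots of unity, so \<open>X ^ n - 1\<close> divides \<open>f\<close> times the product \<open>D\<close> of all
  \<open>X ^ d - 1\<close> with \<open>d\<close> dividing \<open>n\<close> but not divisible by \<open>m\<close>, times \<open>X ^ (n div p) - 1\<close> if \<open>k > 0\<close>. After
  cancelling the last factor, the left-hand side vanishes at \<open>x\<close>, whereas \<open>D\<close> does not.\<close>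

theorem (in domain) eval_int_poly_prime_to_part:
  assumes "prime p" and char: "int_const (int p) = \<zero>"
    and z: "z \<in> roots_of_unity" and f: "ieval f z = 0"
    and x: "x \<in> carrier R" and order: "\<And>j::nat. x [^] j = \<one> \<longleftrightarrow> prime_to_part p z ^ j = 1"
  shows "eval_int_poly x f = \<zero>"
proof -
  obtain n where n: "n > 0" "\<And>j. z ^ j = 1 \<longleftrightarrow> n dvd j"
    using root_of_unity_order[OF z] by metis
  then have zn: "z ^ n = 1"
    by simp
  obtain k m i l where n_eq: "n = p ^ k * m" and m: "\<not> p dvd m"
    and zil: "z = z ^ i * z ^ l" "(z ^ i) ^ m = 1" "(z ^ l) ^ (p ^ k) = 1"
    using prime_to_decomposition_order[OF assms(1) n(1) zn] by metis
  have "coprime m p" "m > 0"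
    using n_eq m n(1) assms(1) prime_imp_coprime coprime_commute by (blast, auto)
  then have "z ^ i \<in> mu p" "z ^ l \<in> mu_ppower p"
    using zil unfolding mu_def mu_ppower_def by blast+
  then have pp: "prime_to_part p z = z ^ i"
    using prime_to_part_unique[OF assms(1)] zil(1) by metis
  have "(z ^ i) ^ j = 1 \<longleftrightarrow> m dvd j" for j
  proof
    assume "m dvd j"
    then show "(z ^ i) ^ j = 1"
      using zil(2) by (metis dvdE power_mult power_one)
  next
    assume "(z ^ i) ^ j = 1"
    then have "z ^ j = (z ^ l) ^ j"
      by (subst zil(1)) (simp add: power_mult_distrib)
    then have "z ^ (j * p ^ k) = 1"
      using zil(3) by (metis mult.commute power_mult power_one)
    then have "p ^ k * m dvd p ^ k * j"
      using n(2) n_eq by (simp add: mult.commute)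
    then show "m dvd j"
      using assms(1) by (simp add: prime_gt_0_nat)
  qed
  then have ord_x: "x [^] j = \<one> \<longleftrightarrow> m dvd j" for j :: nat
    using order pp by simp
  define D where "D = (\<Prod>d\<in>{d. d dvd n \<and> \<not> m dvd d}. unity_poly d)"
  have finD: "finite {d. d dvd n \<and> \<not> m dvd d}"
    using finite_divisors_nat[OF n(1)] by (rule rev_finite_subset) auto
  have D_nz: "eval_int_poly x D \<noteq> \<zero>"
    unfolding D_def by (rule eval_int_poly_prod_unity_nonzero) (use x finD ord_x in auto)
  define E where "E = (if k > 0 then unity_poly (n div p) else 1)"
  have "unity_poly n dvd f * D * E"
  proof (rule unity_poly_dvdI)
    fix w :: complex assume w: "w ^ n = 1"
    obtain j where j: "w = z ^ j"
      using primitive_root_powers[OF n w] .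
    \<comment> \<open>This is the order of \<open>w\<close>. If \<open>m\<close> does not divide
      \<open>d\<close>, the factor \<open>D\<close> vanishes at \<open>w\<close>; if
      \<open>d = n\<close>, then \<open>w\<close> is a conjugate of \<open>z\<close> and
      \<open>f\<close> vanishes; otherwise \<open>d\<close> is \<open>m\<close> times a smaller
      power of \<open>p\<close>, and \<open>E\<close> vanishes.\<close>
    define d where "d = n div gcd j n"
    have nd: "n = d * gcd j n"
      by (simp add: d_def)
    have "w ^ d = z ^ (n * (j div gcd j n))"
      unfolding j d_def power_mult[symmetric] by (metis div_mult_swap gcd_dvd1 gcd_dvd2 mult.commute)
    then have wd: "w ^ d = 1"
      using zn by (simp add: power_mult)
    have "d dvd n"
      using nd by (metis dvd_triv_left)
    show "ieval (f * D * E) w = 0"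
    proof (cases "m dvd d")
      case False
      then have "ieval (unity_poly d) w = 0" "d \<in> {d. d dvd n \<and> \<not> m dvd d}"
        using wd \<open>d dvd n\<close> by auto
      then have "ieval D w = 0"
        unfolding D_def ieval_prod using finD by (intro prod_zero) auto
      then show ?thesis
        by simp
    next
      case True
      show ?thesis
      proof (cases "gcd j n = 1")
        case True
        then have "ieval f w = 0"
          unfolding j using ieval_power_coprime_eq_0[OF zn n(1) _ f]
          by (simp add: coprime_iff_gcd_eq_1)
        then show ?thesis
          by simp
      next
        case ne1: False
        obtain d' where d': "d = m * d'"
          using True ..
        have "d' dvd p ^ k"
          using \<open>d dvd n\<close> d' n_eq \<open>m > 0\<close> by (simp add: mult.commute)
        then obtain e where e: "e \<le> k" "d' = p ^ e"
          using divides_primepow_nat assms(1) by blast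
        have "e \<noteq> k"
          using ne1 nd d' e n_eq n(1) by auto
        then have "e < k"
          using e by simp
        then have "n div p = p ^ (k - 1) * m"
          using n_eq assms(1) by (cases k) (auto simp: prime_gt_0_nat)
        moreover have "d dvd p ^ (k - 1) * m"
          using d' e \<open>e < k\<close> by (simp add: le_imp_power_dvd mult.commute mult_dvd_mono)
        ultimately have "w ^ (n div p) = 1"
          using wd by (metis dvdE power_mult power_one)
        then show ?thesis
          using \<open>e < k\<close> by (simp add: E_def)
      qed
    qed
  qed (rule n(1))
  have "eval_int_poly x (f * D) = \<zero>"
  proof (cases "k > 0")
    case False
    then obtain h where "f * D = unity_poly n * h"
      using \<open>unity_poly n dvd f * D * E\<close> by (auto simp: E_def)
    moreover have "x [^] n = \<one>"
      using ord_x n_eq by simp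
    ultimately show ?thesis
      using x by (simp add: eval_int_poly_mult eval_int_poly_unity minus_eq r_neg)
  next
    case True
    define r where "r = n div p"
    have r: "n = r * p"
      unfolding r_def n_eq using True by (cases k) auto
    then have "r > 0"
      using n(1) by (cases r) auto
    define c where "c = (\<Sum>i<p. Polynomial.monom (1::int) (r * i))"
    have c_power: "c = (\<Sum>i<p. Polynomial.monom 1 r ^ i)"
      by (simp add: c_def monom_power mult.commute)
    have "unity_poly n = unity_poly r * c"
      unfolding c_power using power_diff_1_eq[of "Polynomial.monom (1::int) r" p] by (simp add: monom_power r)
    \<comment> \<open>Since \<open>x [^] r\<close> is one, the factor \<open>X ^ r - 1\<close>
      vanishes at \<open>x\<close>, so it has to be cancelled as a polynomial before evaluating.
      What remains of \<open>X ^ n - 1\<close> is \<open>c\<close>, whose value at \<open>x\<close>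
      is \<open>p\<close>, that is, zero.\<close>
    then have "unity_poly r * c dvd unity_poly r * (f * D)"
      using \<open>unity_poly n dvd f * D * E\<close> True by (simp add: E_def r_def mult_ac)
    moreover have "unity_poly r \<noteq> 0"
      using degree_unity_poly[OF \<open>r > 0\<close>] \<open>r > 0\<close> by force
    ultimately obtain h where "f * D = c * h"
      by auto
    moreover have "x [^] r = \<one>"
    proof -
      have "r = p ^ (k - 1) * m"
        using r n_eq True assms(1) by (cases k) (auto simp: prime_gt_0_nat)
      then show ?thesis
        using ord_x by simp
    qed
    then have "eval_int_poly x c = \<zero>"
      unfolding c_def using eval_int_poly_sum_X_power[OF x] char by simp
    ultimately show ?thesis
      using x by (simp add: eval_int_poly_mult)
  qed
  then show ?thesis
    using D_nz x by (simp add: eval_int_poly_mult integral_iff)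
qed


section \<open>Prime ideals above p\<close>

abbreviation Zcyc :: "complex set"
  where "Zcyc \<equiv> int_span roots_of_unity"

lemma Qcyc_iff: "x \<in> Qcyc \<longleftrightarrow> (\<exists>m::int. m \<noteq> 0 \<and> of_int m * x \<in> Zcyc)"
  unfolding Qcyc_def by (rule roots.generated_field_iff)

lemmas Qcyc_closed = generated_field_closed[where S = roots_of_unity, folded Qcyc_def]

lemma Zcyc_subset_Qcyc: "Zcyc \<subseteq> Qcyc"
  unfolding Qcyc_def by (rule roots.int_span_subset_generated_field)

text \<open>The factor theorem with a polynomial in place of a constant. It yields congruences such
  as \<open>f\<close> at \<open>z\<close> against \<open>f\<close> at \<open>z ^ i\<close> modulo
  \<open>z - z ^ i\<close>, and \<open>h\<close> at \<open>w\<close> against \<open>h\<close> at 1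
  modulo \<open>w - 1\<close>.\<close>

lemma dvd_poly_minus_pcompose:
  fixes f g :: "int poly"
  shows "monom 1 1 - g dvd f - pcompose f g"
proof (induction f)
  case (pCons c f)
  have "pCons c f - pcompose (pCons c f) g = (monom 1 1 - g) * f + g * (f - pcompose f g)"
    by (simp add: pcompose_pCons algebra_simps monom_altdef)
  then show ?case
    using pCons.IH by simp
qed simp

lemma pcompose_X_power: "pcompose (monom 1 n) g = g ^ n"
  for g :: "int poly"
  by (induction n) (auto simp: monom_0 monom_Suc pcompose_pCons)

lemma poly_frobenius_iterated:
  fixes f :: "int poly"
  assumes "prime p"
  shows "of_nat p dvd f ^ (p ^ e) - pcompose f (monom 1 (p ^ e))"
proof (induction e)
  case 0
  have "pcompose f (monom 1 1) = f"
    by (simp add: monom_altdef pcompose_idR)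
  then show ?case
    by simp
next
  case (Suc e)
  define A where "A = f ^ (p ^ e)"
  define B where "B = pcompose f (monom 1 (p ^ e))"
  have "A - B dvd A ^ p - B ^ p"
    by (simp add: power_diff_sumr2)
  then have "of_nat p dvd A ^ p - B ^ p"
    using Suc dvd_trans unfolding A_def B_def by blast
  moreover have "of_nat p dvd B ^ p - pcompose B (monom 1 p)"
    by (rule poly_frobenius[OF assms])
  ultimately have "of_nat p dvd (A ^ p - B ^ p) + (B ^ p - pcompose B (monom 1 p))"
    by (rule dvd_add)
  moreover have "pcompose (monom 1 (p ^ e)) (monom 1 p :: int poly) = monom 1 (p ^ Suc e)"
    by (simp add: pcompose_X_power monom_power)
  then have "pcompose B (monom 1 p) = pcompose f (monom 1 (p ^ Suc e))"
    by (simp add: B_def flip: pcompose_assoc)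
  ultimately show ?case
    by (simp add: A_def power_mult mult.commute flip: power_mult)
qed

text \<open>Pigeonhole on the powers of \<open>p\<close> modulo the order \<open>n\<close> of
  \<open>a\<close>; as \<open>p\<close> is coprime to \<open>n\<close>, equal residues of
  \<open>p ^ i\<close> and \<open>p ^ j\<close> give \<open>p ^ (j - i)\<close> congruent to
  1.\<close>

lemma mu_frobenius_fixed:
  assumes "a \<in> mu p" "prime p"
  obtains e where "e > 0" "a ^ (p ^ e) = a"
proof -
  obtain n where n: "n > 0" "coprime n p" "a ^ n = 1"
    using assms(1) by (auto simp: mu_def)
  have "\<not> inj (\<lambda>i. p ^ i mod n)"
  proof
    assume "inj (\<lambda>i. p ^ i mod n)"
    moreover have "range (\<lambda>i. p ^ i mod n) \<subseteq> {..<n}"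
      using n(1) by auto
    ultimately show False
      using finite_subset finite_imageD by blast
  qed
  then obtain i j where ij: "i < j" "p ^ i mod n = p ^ j mod n"
    unfolding inj_def by (metis linorder_neqE_nat)
  have "n dvd p ^ j - p ^ i"
    using ij by (metis mod_eq_dvd_iff_nat power_increasing less_imp_le prime_ge_1_nat assms(2))
  also have "p ^ j - p ^ i = p ^ i * (p ^ (j - i) - 1)"
    using ij by (simp add: diff_mult_distrib2 flip: power_add)
  finally have "n dvd p ^ (j - i) - 1"
    using n(2) by (simp add: coprime_dvd_mult_right_iff)
  then obtain d where "p ^ (j - i) - 1 = n * d" ..
  moreover have "p ^ (j - i) > 0"
    using assms(2) by (simp add: prime_gt_0_nat)
  ultimately have "p ^ (j - i) = n * d + 1"
    by linarith
  then have "a ^ (p ^ (j - i)) = a"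
    using n(3) by (simp add: power_add power_mult)
  then show thesis
    using that[of "j - i"] ij by simp
qed

text \<open>With \<open>p ^ e\<close> fixing \<open>a\<close>, the iterated Frobenius congruence
  says that \<open>b = ieval f a\<close> satisfies \<open>b ^ (p ^ e) = b\<close> modulo
  \<open>p\<close>, and \<open>q\<close> is \<open>p ^ e - 1\<close>. Thus the residue of
  \<open>b\<close> is zero or a \<open>q\<close>-th root of unity. This expresses that roots of
  order prime to \<open>p\<close> are unramified at \<open>p\<close>.\<close>

lemma ieval_mu_frobenius:
  assumes "prime p" "a \<in> mu p"
  obtains q h where "q > 0" "coprime q p" "ieval f a * (ieval f a ^ q - 1) = of_nat p * ieval h a"
proof -
  obtain e where e: "e > 0" "a ^ (p ^ e) = a"
    using mu_frobenius_fixed assms(2,1) .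
  obtain h where h: "f ^ (p ^ e) - pcompose f (monom 1 (p ^ e)) = of_nat p * h"
    using poly_frobenius_iterated[OF assms(1)] ..
  define q where "q = p ^ e - 1"
  have "p ^ e > 1"
    using one_less_power[OF prime_gt_1_nat[OF assms(1)] e(1)] .
  then have q: "p ^ e = Suc q" "q > 0"
    by (auto simp: q_def)
  have "coprime q (Suc q)"
    by simp
  then have "coprime q p"
    unfolding q(1)[symmetric] using e(1) by simp
  moreover have "ieval f a ^ Suc q - ieval f a = of_nat p * ieval h a"
    using arg_cong[OF h, of "\<lambda>f. ieval f a"] by (simp add: e(2) of_nat_poly flip: q(1))
  ultimately show thesis
    using that[of q h] q(2) by (simp add: algebra_simps)
qed

lemma ieval_diff_power:
  obtains g where "ieval f z - ieval f (z ^ i) = (z - z ^ i) * ieval g z"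
proof -
  obtain g where "f - pcompose f (monom 1 i) = (monom 1 1 - monom 1 i) * g"
    using dvd_poly_minus_pcompose[of "monom 1 i" f] ..
  from arg_cong[OF this, of "\<lambda>f. ieval f z"] show thesis
    using that by simp
qed

lemma int_p_decomposition:
  fixes m :: int
  assumes "prime p" "m \<noteq> 0"
  obtains c m' where "m = int p ^ c * m'" "\<not> int p dvd m'" "c = multiplicity (int p) m"
proof -
  have "\<not> is_unit (int p)"
    using assms(1) by auto
  then show thesis
    using multiplicity_decompose'[OF assms(2)] that by metis
qed

text \<open>A prime ideal of \<open>Zcyc\<close> above \<open>p\<close>. It will occur both as the
  centre of a valuation and as the kernel of a map to \<open>Sigma_ring\<close>; the axioms are
  stated elementwise so that both cases can be checked directly.\<close>

locale place =
  fixes p :: nat and P :: "complex set"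
  assumes prime: "prime p"
    and subset: "P \<subseteq> Zcyc"
    and add: "x \<in> P \<Longrightarrow> y \<in> P \<Longrightarrow> x + y \<in> P"
    and absorb: "x \<in> P \<Longrightarrow> y \<in> Zcyc \<Longrightarrow> x * y \<in> P"
    and p_in: "of_nat p \<in> P"
    and one_notin: "1 \<notin> P"
    and prime_ideal: "x \<in> Zcyc \<Longrightarrow> y \<in> Zcyc \<Longrightarrow> x * y \<in> P \<Longrightarrow> x \<in> P \<or> y \<in> P"
begin

lemma p_pos: "p > 0"
  using prime by (rule prime_gt_0_nat)

lemma absorb_left: "x \<in> P \<Longrightarrow> y \<in> Zcyc \<Longrightarrow> y * x \<in> P"
  using absorb by (simp add: mult.commute)

lemma zero_in: "0 \<in> P"
  using absorb[OF p_in roots.int_span_0] by simp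

lemma minus: "x \<in> P \<Longrightarrow> - x \<in> P"
  using absorb[of x "of_int (- 1)"] roots.int_span_of_int by fastforce

lemma diff: "x \<in> P \<Longrightarrow> y \<in> P \<Longrightarrow> x - y \<in> P"
  using add[of x "- y"] minus by simp

lemma cong_trans: "x - y \<in> P \<Longrightarrow> y - z \<in> P \<Longrightarrow> x - z \<in> P"
  using add[of "x - y" "y - z"] by simp

lemma cong_sym: "x - y \<in> P \<Longrightarrow> y - x \<in> P"
  using minus[of "x - y"] by simp

lemma cong_iff: "x - y \<in> P \<Longrightarrow> x \<in> P \<longleftrightarrow> y \<in> P"
  using add[of "x - y" y] diff[of x "x - y"] by auto

lemma power_in_imp_in: "x \<in> Zcyc \<Longrightarrow> x ^ n \<in> P \<Longrightarrow> x \<in> P"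
  by (induction n) (use one_notin prime_ideal roots.int_span_power in auto)

lemma power_in: "x \<in> P \<Longrightarrow> n > 0 \<Longrightarrow> x ^ n \<in> P"
  using absorb[of x "x ^ (n - 1)"] subset roots.int_span_power by (cases n) auto

lemma notin_mult: "x \<in> Zcyc - P \<Longrightarrow> y \<in> Zcyc - P \<Longrightarrow> x * y \<in> Zcyc - P"
  using prime_ideal roots.int_span_mult by blast

lemma notin_power: "x \<in> Zcyc - P \<Longrightarrow> x ^ n \<in> Zcyc - P"
  using power_in_imp_in roots.int_span_power by blast

lemma of_int_in_iff: "of_int c \<in> P \<longleftrightarrow> int p dvd c"
proof
  assume "int p dvd c"
  then show "of_int c \<in> P"
    using absorb[OF p_in roots.int_span_of_int] by (elim dvdE) simp
next
  assume c: "of_int c \<in> P"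
  show "int p dvd c"
  proof (rule ccontr)
    assume "\<not> ?thesis"
    then have "coprime c (int p)"
      using prime by (metis coprime_commute prime_imp_coprime prime_nat_int_transfer)
    then obtain a b where "a * c + b * int p = 1"
      by (metis bezout_int coprime_imp_gcd_eq_1)
    then have "of_int c * of_int a + of_nat p * of_int b = (1 :: complex)"
      by (metis of_int_1 of_int_add of_int_mult of_int_of_nat_eq mult.commute)
    then show False
      using add[OF absorb[OF c] absorb[OF p_in]] roots.int_span_of_int one_notin by metis
  qed
qed

text \<open>Modulo \<open>p\<close> the power \<open>(w - 1) ^ p\<close> equals
  \<open>w ^ p - 1\<close>, which lies in \<open>P\<close> by induction on the exponent of the
  order; primality then extracts \<open>w - 1\<close>. In other words, a field of characteristic
  \<open>p\<close> has no nontrivial root of unity of p-power order.\<close>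

lemma mu_ppower_cong: "w \<in> mu_ppower p \<Longrightarrow> w - 1 \<in> P"
proof -
  have "w - 1 \<in> P" if "w ^ (p ^ k) = 1" for k and w :: complex
    using that
  proof (induction k arbitrary: w)
    case 0
    then show ?case
      using zero_in by simp
  next
    case (Suc k)
    have w: "w \<in> Zcyc"
      using Suc.prems p_pos by (intro roots.int_span_incl) (auto simp: roots_of_unity_def intro!: exI[of _ "p ^ Suc k"])
    have "(w ^ p) ^ (p ^ k) = 1"
      using Suc.prems by (simp flip: power_mult)
    then have wp: "w ^ p - 1 \<in> P"
      by (rule Suc.IH)
    obtain h where h: "(monom 1 1 - 1) ^ p - pcompose (monom 1 1 - 1) (monom 1 p) = of_nat p * (h :: int poly)"
      using poly_frobenius[OF prime] by (rule dvdE)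
    have "(w - 1) ^ p - (w ^ p - 1) = of_nat p * ieval h w"
      using arg_cong[OF h, of "\<lambda>f. ieval f w"] by (simp add: of_nat_poly)
    moreover have "ieval h w \<in> Zcyc"
      using w by (induction h) (auto intro: roots.int_span_closed)
    ultimately have "(w - 1) ^ p - (w ^ p - 1) \<in> P"
      using absorb[OF p_in] by simp
    then have "(w - 1) ^ p \<in> P"
      using cong_iff wp by blast
    then show ?case
      using power_in_imp_in w by (blast intro: roots.int_span_closed)
  qed
  then show "w \<in> mu_ppower p \<Longrightarrow> w - 1 \<in> P"
    by (auto simp: mu_ppower_def)
qed

end

section \<open>The discrete valuation ring at a finite level\<close>

lemma int_span_powers: "int_span (range ((^) z)) = range (\<lambda>f. ieval f z)"
proof
  show "int_span (range ((^) z)) \<subseteq> range (\<lambda>f. ieval f z)"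
    by (auto simp: int_span_def intro!: image_eqI[of _ _ "pcompose f (monom 1 n)" for f n])
  show "range (\<lambda>f. ieval f z) \<subseteq> int_span (range ((^) z))"
    by (auto simp: int_span_def intro!: exI[of _ z] image_eqI[of _ _ 1])
qed

text \<open>A finite level \<open>L = Z[z]\<close> with \<open>z = a * w\<close>, where \<open>a\<close> has order prime to \<open>p\<close> and \<open>w\<close> has order
  \<open>p ^ k\<close>; localizing \<open>L\<close> at \<open>P\<close> gives a discrete valuation ring with uniformizer \<open>\<pi>\<close> and
  ramification index \<open>\<phi>\<close>.\<close>

locale place_level = place +
  fixes z a w :: complex and k :: nat
  assumes z: "z \<in> roots_of_unity" and z_eq: "z = a * w"
    and a_pow: "a \<in> range ((^) z)" and w_pow: "w \<in> range ((^) z)"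
    and a: "a \<in> mu p" and w_order: "\<And>j. w ^ j = 1 \<longleftrightarrow> p ^ k dvd j" and k: "k > 0"
begin

definition L where "L = int_span (range ((^) z))"
definition \<pi> where "\<pi> = w - 1"
definition \<phi> where "\<phi> = p ^ k - p ^ (k - 1)"

sublocale level: torsion_monoid "range ((^) z)"
  rewrites "int_span (range ((^) z)) \<equiv> L"
proof -
  show "torsion_monoid (range ((^) z))"
    by unfold_locales (use z roots.power_in power_add[of z, symmetric] power_0[of z, symmetric] in blast)+
qed (simp add: L_def)

lemma ieval_in_L: "ieval f z \<in> L" "ieval f a \<in> L" "ieval f w \<in> L"
  using level.int_spanI a_pow w_pow power_one_right[of z, symmetric] by blast+

lemma L_subset: "L \<subseteq> Zcyc"
  using z roots.int_spanI roots.power_in by (auto simp: L_def int_span_def)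

lemma \<pi>_in: "\<pi> \<in> L" "\<pi> \<in> P"
proof -
  show "\<pi> \<in> L"
    using ieval_in_L(3)[of "monom 1 1 - 1"] by (simp add: \<pi>_def)
  have "w ^ (p ^ k) = 1"
    using w_order by simp
  then have "w \<in> mu_ppower p"
    by (auto simp: mu_ppower_def)
  then show "\<pi> \<in> P"
    unfolding \<pi>_def by (rule mu_ppower_cong)
qed

lemma \<phi>_pos: "\<phi> > 0"
  using k prime prime_gt_1_nat[of p] by (simp add: \<phi>_def power_strict_increasing)

text \<open>Here \<open>\<Psi>\<close> is the cyclotomic polynomial of order \<open>p ^ k\<close>.
  Comparing the Frobenius congruences for \<open>p ^ k\<close> and \<open>p ^ (k - 1)\<close> gives
  \<open>(X - 1) ^ \<phi> = \<Psi> + p * h\<close>. At \<open>w\<close>, where \<open>\<Psi>\<close>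
  vanishes, this reads \<open>\<pi> ^ \<phi> = p * h\<close>; at 1, where \<open>\<Psi>\<close> has
  value \<open>p\<close>, it gives the value \<open>- 1\<close> for \<open>h\<close>, so
  \<open>h\<close> at \<open>w\<close> is congruent to \<open>- 1\<close> modulo
  \<open>\<pi>\<close> and lies outside \<open>P\<close>.\<close>

lemma p_\<pi>: obtains h where "h \<in> L" "h \<notin> P" "of_nat p * h = \<pi> ^ \<phi>"
proof -
  define r where "r = p ^ (k - 1)"
  have pr: "p ^ k = r * p"
    using k by (cases k) (auto simp: r_def)
  define X1 :: "int poly" where "X1 = monom 1 1 - 1"
  define \<Psi> :: "int poly" where "\<Psi> = (\<Sum>i<p. monom 1 r ^ i)"
  have \<Psi>: "unity_poly (p ^ k) = unity_poly r * \<Psi>"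
    unfolding \<Psi>_def using power_diff_1_eq[of "monom (1::int) r" p] by (simp add: monom_power pr)
  have frob: "of_nat p dvd X1 ^ (p ^ e) - unity_poly (p ^ e)" for e
    using poly_frobenius_iterated[OF prime, of X1 e]
    by (simp add: X1_def pcompose_diff pcompose_X_power pcompose_1)
  have "of_nat p dvd (X1 ^ (p ^ k) - unity_poly (p ^ k)) - (X1 ^ r - unity_poly r) * \<Psi>"
    unfolding r_def by (intro dvd_diff dvd_mult2 frob)
  also have "(X1 ^ (p ^ k) - unity_poly (p ^ k)) - (X1 ^ r - unity_poly r) * \<Psi> = X1 ^ (p ^ k) - X1 ^ r * \<Psi>"
    unfolding \<Psi> by (simp only: algebra_simps)
  also have "p ^ k = r + \<phi>"
    by (simp add: \<phi>_def r_def power_increasing p_pos Suc_leI)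
  then have "X1 ^ (p ^ k) - X1 ^ r * \<Psi> = X1 ^ r * (X1 ^ \<phi> - \<Psi>)"
    by (simp add: power_add algebra_simps)
  finally have dvd: "of_nat p dvd X1 ^ r * (X1 ^ \<phi> - \<Psi>)" .
  have "prime_elem (of_nat p :: int poly)"
    using prime lift_prime_elem_poly[of "int p"] by (simp add: of_nat_poly)
  \<comment> \<open>Evaluation at 2 sends \<open>X1\<close> to 1, so divisibility would make
    \<open>p\<close> a divisor of 1.\<close>
  moreover have "\<not> of_nat p dvd X1 ^ r"
  proof
    assume "of_nat p dvd X1 ^ r"
    then obtain h where "X1 ^ r = of_nat p * h" ..
    then have "ieval (X1 ^ r) (2 :: int) = ieval (of_nat p * h) 2"
      by simp
    then have "1 = int p * ieval h 2"
      by (simp add: X1_def of_nat_poly)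
    then have "int p dvd 1"
      by (metis dvd_triv_left)
    then show False
      using prime by simp
  qed
  ultimately obtain h where h: "X1 ^ \<phi> - \<Psi> = of_nat p * h"
    using dvd prime_elem_dvd_mult_iff by blast
  have "ieval (X1 ^ \<phi> - \<Psi>) (1 :: int) = ieval (of_nat p * h) 1"
    by (simp only: h)
  then have "- int p = int p * ieval h 1"
    using \<phi>_pos by (simp add: X1_def \<Psi>_def of_nat_poly zero_power)
  then have h1: "ieval h (1 :: int) = - 1"
    using p_pos by (metis mult_cancel_left mult_minus1_right of_nat_0_eq_iff less_numeral_extra(3))
  have "ieval h (1 :: complex) = of_int (ieval h 1)"
    by (induction h) auto
  then have h1': "ieval h (1 :: complex) = - 1"
    using h1 by simp
  have "\<not> p ^ k dvd r"
    using k prime prime_gt_1_nat[of p] p_pos by (auto simp: r_def dvd_power_iff_le)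
  then have "ieval (unity_poly r) w \<noteq> 0"
    using w_order by simp
  moreover have "ieval (unity_poly r) w * ieval \<Psi> w = ieval (unity_poly (p ^ k)) w"
    unfolding \<Psi> by simp
  moreover have "ieval (unity_poly (p ^ k)) w = 0"
    using w_order[of "p ^ k"] by simp
  ultimately have "ieval \<Psi> w = 0"
    by (metis mult_eq_0_iff)
  moreover have "ieval (X1 ^ \<phi> - \<Psi>) w = ieval (of_nat p * h) w"
    by (simp only: h)
  ultimately have eq: "of_nat p * ieval h w = \<pi> ^ \<phi>"
    by (simp add: X1_def of_nat_poly \<pi>_def)
  obtain g where "h - pcompose h 1 = (monom 1 1 - 1) * g"
    using dvd_poly_minus_pcompose[of 1 h] ..
  then have "ieval (h - pcompose h 1) w = ieval ((monom 1 1 - 1) * g) w"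
    by simp
  then have "ieval h w - (- 1) = \<pi> * ieval g w"
    using h1' by (simp add: \<pi>_def)
  moreover have "\<pi> * ieval g w \<in> P"
    using \<pi>_in ieval_in_L(3) L_subset by (intro absorb) auto
  ultimately have "ieval h w \<in> P \<longleftrightarrow> - 1 \<in> P"
    using cong_iff by metis
  then have "ieval h w \<notin> P"
    using one_notin minus[of "- 1"] by auto
  then show thesis
    using that eq ieval_in_L(3) by blast
qed

text \<open>As \<open>z\<close> and \<open>a\<close> differ by \<open>a * \<pi>\<close>, the element
  \<open>x\<close> agrees modulo \<open>\<pi>\<close> with \<open>b\<close>, the value of its
  polynomial at \<open>a\<close>. Frobenius makes \<open>b * (b ^ q - 1)\<close> a multiple of
  \<open>p\<close>, hence of \<open>\<pi>\<close> up to a unit at \<open>P\<close>; and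
  \<open>b ^ q - 1\<close> is itself outside \<open>P\<close> because \<open>b\<close> lies in
  \<open>P\<close>.\<close>

lemma \<pi>_dvd:
  assumes "x \<in> L" "x \<in> P"
  obtains u y where "u \<in> L" "u \<notin> P" "y \<in> L" "x * u = \<pi> * y"
proof -
  obtain f where f: "x = ieval f z"
    using assms(1) by (auto simp: L_def int_span_powers)
  obtain i where i: "a = z ^ i"
    using a_pow by auto
  obtain g where "x - ieval f a = (z - a) * ieval g z"
    using ieval_diff_power[of f z i] f i by metis
  also have "z - a = a * \<pi>"
    using z_eq by (simp add: \<pi>_def algebra_simps)
  finally have x_eq: "x - ieval f a = \<pi> * (a * ieval g z)"
    by simp
  define b where "b = ieval f a"
  have a_L: "a \<in> L"
    using ieval_in_L(2)[of "monom 1 1"] by simp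
  have b_L: "b \<in> L"
    by (simp add: b_def ieval_in_L)
  have "\<pi> * (a * ieval g z) \<in> P"
    using \<pi>_in(2) a_L ieval_in_L L_subset level.int_span_mult by (intro absorb) auto
  then have b_P: "b \<in> P"
    using assms(2) cong_iff x_eq b_def by metis
  obtain q h where q: "q > 0" "b * (b ^ q - 1) = of_nat p * ieval h a"
    using ieval_mu_frobenius[OF prime a] unfolding b_def by metis
  define v where "v = b ^ q - 1"
  have v: "v \<in> L" "v \<notin> P"
  proof -
    show "v \<in> L"
      unfolding v_def by (intro level.int_span_closed b_L)
    show "v \<notin> P"
    proof
      assume "v \<in> P"
      then have "b ^ q - v \<in> P"
        using b_P q(1) power_in diff by blast
      then show False
        using one_notin by (simp add: v_def)
    qed
  qed
  obtain t where t: "t \<in> L" "t \<notin> P" "of_nat p * t = \<pi> ^ \<phi>"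
    using p_\<pi> .
  have "b * v = of_nat p * ieval h a"
    using q(2) by (simp add: v_def)
  then have "b * v * t = \<pi> ^ \<phi> * ieval h a"
    using t(3) by (metis mult.assoc mult.commute)
  also have "\<pi> ^ \<phi> = \<pi> * \<pi> ^ (\<phi> - 1)"
    using \<phi>_pos by (cases \<phi>) auto
  finally have bvt: "b * v * t = \<pi> * (\<pi> ^ (\<phi> - 1) * ieval h a)"
    by simp
  have "x = b + \<pi> * (a * ieval g z)"
    using x_eq by (simp add: b_def algebra_simps)
  then have "x * (v * t) = b * v * t + \<pi> * (a * ieval g z * (v * t))"
    by (simp add: algebra_simps)
  then have "x * (v * t) = \<pi> * (\<pi> ^ (\<phi> - 1) * ieval h a + a * ieval g z * (v * t))"
    by (simp only: bvt distrib_left)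
  moreover have "v * t \<in> L" "v * t \<notin> P"
    using v t L_subset prime_ideal level.int_span_mult by blast+
  moreover have "\<pi> ^ (\<phi> - 1) * ieval h a + a * ieval g z * (v * t) \<in> L"
    by (intro level.int_span_closed(1,2,10) \<pi>_in ieval_in_L a_L v t)
  ultimately show thesis
    using that by blast
qed

text \<open>If division by \<open>\<pi>\<close> never ended outside \<open>P\<close>, then
  \<open>x\<close> would be divisible, up to units at \<open>P\<close>, by every power of
  \<open>\<pi>\<close>. But \<open>x\<close> divides a nonzero integer, whose divisibility by
  \<open>\<pi>\<close> is bounded by its divisibility by \<open>p\<close>.\<close>

lemma \<pi>_expansion:
  assumes "x \<in> L" "x \<noteq> 0"
  obtains j u y where "u \<in> L" "u \<notin> P" "y \<in> L" "y \<notin> P" "x * u = \<pi> ^ j * y"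
proof (rule ccontr)
  note result = that
  assume not_thesis: "\<not> thesis"
  have none: "y \<in> P" if "u \<in> L" "u \<notin> P" "y \<in> L" "x * u = \<pi> ^ j * y" for j u y
    using that not_thesis result by blast
  have div: "\<exists>u\<in>L - P. \<exists>y\<in>L. x * u = \<pi> ^ j * y" for j
  proof (induction j)
    case 0
    show ?case
      using assms one_notin level.int_span_1 by (intro bexI[of _ 1] bexI[of _ x]) auto
  next
    case (Suc j)
    then obtain u y where uy: "u \<in> L - P" "y \<in> L" "x * u = \<pi> ^ j * y"
      by blast
    then have "y \<in> P"
      using none by blast
    then obtain v t where v: "v \<in> L" "v \<notin> P" "t \<in> L" "y * v = \<pi> * t"
      using \<pi>_dvd uy(2) by metis
    then have "x * (u * v) = \<pi> ^ Suc j * t"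
      using uy(3) by (metis mult.assoc mult.left_commute power_Suc)
    moreover have "u * v \<in> L - P"
      using uy(1) v L_subset prime_ideal level.int_span_mult by blast
    ultimately show ?case
      using v(3) by blast
  qed
  obtain x' m where x': "x' \<in> L" "m \<noteq> 0" "x' * x = of_int m"
    using level.int_span_divides_int assms .
  obtain c m' where m': "m = int p ^ c * m'" "\<not> int p dvd m'"
    using int_p_decomposition prime x'(2) .
  obtain t where t: "t \<in> L" "t \<notin> P" "of_nat p * t = \<pi> ^ \<phi>"
    using p_\<pi> .
  \<comment> \<open>The exponent exceeds by one the exponent \<open>\<phi> * c\<close> of
    \<open>\<pi>\<close> in the integer \<open>m\<close>; cancelling leaves a product of two
    elements outside \<open>P\<close> that lies in \<open>P\<close>.\<close>
  obtain u y where uy: "u \<in> L - P" "y \<in> L" "x * u = \<pi> ^ (\<phi> * c + 1) * y"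
    using div by blast
  have "\<pi> ^ (\<phi> * c) * (of_int m' * u) = (of_nat p * t) ^ c * of_int m' * u"
    by (simp add: t(3) power_mult)
  also have "\<dots> = t ^ c * of_int m * u"
    by (simp add: m'(1) power_mult_distrib)
  also have "\<dots> = t ^ c * x' * (x * u)"
    using x'(3) by (simp add: mult_ac)
  also have "\<dots> = \<pi> ^ (\<phi> * c) * (\<pi> * (t ^ c * x' * y))"
    unfolding uy(3) by (simp add: mult_ac)
  finally have "\<pi> ^ (\<phi> * c) * (of_int m' * u) = \<pi> ^ (\<phi> * c) * (\<pi> * (t ^ c * x' * y))" .
  moreover have "\<pi> \<noteq> 0"
    using w_order[of 1] k prime by (auto simp: \<pi>_def)
  ultimately have "of_int m' * u = \<pi> * (t ^ c * x' * y)"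
    by simp
  moreover have "\<pi> * (t ^ c * x' * y) \<in> P"
    using \<pi>_in(2) L_subset t(1) x'(1) uy(2) by (intro absorb) (auto intro!: roots.int_span_closed(2,10))
  ultimately have "of_int m' * u \<in> P"
    by simp
  then show False
    using prime_ideal[of "of_int m'" u] of_int_in_iff m'(2) uy(1) L_subset roots.int_span_of_int by blast
qed

end

text \<open>A nontrivial p-th root of unity \<open>\<zeta>\<close> is adjoined to the given root
  before splitting. This forces \<open>k > 0\<close> and so a nonzero \<open>\<pi>\<close> even when
  \<open>x\<close> involves only roots of order prime to \<open>p\<close>.\<close>

lemma (in place) in_level:
  assumes "x \<in> Zcyc"
  obtains z a w k where "place_level p P z a w k" "x \<in> int_span (range ((^) z))"
proof -
  obtain f z0 where z0: "z0 \<in> roots_of_unity" "x = ieval f z0"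
    using assms by (auto simp: int_span_def)
  define \<zeta> where "\<zeta> = cis (2 * pi / real p)"
  have \<zeta>p: "\<zeta> ^ p = 1"
    using p_pos by (simp add: \<zeta>_def DeMoivre)
  have "\<zeta> \<noteq> 1"
  proof
    have inj: "inj_on (\<lambda>k. cis (2 * pi * real k / real p)) {..<p}"
      using bij_betw_roots_unity[OF p_pos] by (simp add: bij_betw_def)
    assume "\<zeta> = 1"
    then have "(1::nat) = 0"
      using prime prime_gt_1_nat[of p] by (intro inj_onD[OF inj]) (auto simp: \<zeta>_def)
    then show False
      by simp
  qed
  have \<zeta>: "\<zeta> \<in> roots_of_unity" "\<zeta> \<in> mu_ppower p"
    using \<zeta>p p_pos by (auto simp: roots_of_unity_def mu_ppower_def intro: exI[of _ 1])
  obtain z s t where z: "z \<in> roots_of_unity" "z0 = z ^ s" "\<zeta> = z ^ t"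
    using roots.common_generator z0(1) \<zeta>(1) .
  obtain i l where il: "z = z ^ i * z ^ l" "z ^ i \<in> mu p" "z ^ l \<in> mu_ppower p"
    using prime_to_decomposition prime z(1) .
  have "z ^ l \<in> roots_of_unity"
    using z(1) roots.power_in by blast
  then obtain n where n: "n > 0" "\<And>j. (z ^ l) ^ j = 1 \<longleftrightarrow> n dvd j"
    using root_of_unity_order by metis
  obtain K where "(z ^ l) ^ (p ^ K) = 1"
    using il(3) by (auto simp: mu_ppower_def)
  then have "n dvd p ^ K"
    using n(2) by blast
  then obtain k where k: "n = p ^ k"
    using divides_primepow_nat prime by blast
  have "k > 0"
  proof (rule ccontr)
    assume "\<not> k > 0"
    then have "z ^ l = 1"
      using n(2)[of 1] k by simp
    then have "z \<in> mu p"
      using il(1,2) by simp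
    then have "\<zeta> \<in> mu p"
      using z(3) mu.power_in by blast
    then show False
      using mu_inter_mu_ppower \<zeta>(2) \<open>\<zeta> \<noteq> 1\<close> by blast
  qed
  then have "place_level p P z (z ^ i) (z ^ l) k"
    using z(1) il n(2) k by unfold_locales auto
  moreover have "x \<in> int_span (range ((^) z))"
    using z0(2) z(2) by (auto simp: int_span_def)
  ultimately show thesis
    by (rule that)
qed


section \<open>The valuation of a place\<close>

context place
begin

text \<open>\<open>val_rel x N a b\<close> expresses that \<open>x\<close> has valuation \<open>(a - b) / N\<close>: up to \<open>P\<close>-units, \<open>x ^ N\<close> is
  \<open>p ^ (a - b)\<close>.\<close>

definition val_rel :: "complex \<Rightarrow> nat \<Rightarrow> nat \<Rightarrow> nat \<Rightarrow> bool"
  where "val_rel x N a b \<longleftrightarrow> N > 0 \<and>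
    (\<exists>u\<in>Zcyc - P. \<exists>y\<in>Zcyc - P. u * of_nat p ^ b * x ^ N = y * of_nat p ^ a)"

lemma p_power_cancel:
  assumes "y \<in> Zcyc - P" "y' \<in> Zcyc - P" "y * of_nat p ^ s = y' * of_nat p ^ t"
  shows "s = t"
proof -
  have False if "s < t" "y \<in> Zcyc - P" "y' \<in> Zcyc - P" "y * of_nat p ^ s = y' * of_nat p ^ t" for s t y y'
  proof -
    have "of_nat p ^ t = (of_nat p :: complex) ^ s * of_nat p ^ (t - s)"
      using that(1) by (simp flip: power_add)
    then have "y = of_nat p ^ (t - s) * y'"
      using that(4) p_pos by simp
    moreover have "of_nat p ^ (t - s) \<in> P"
      using that(1) p_in power_in by simp
    ultimately show False
      using absorb that(2,3) by blast
  qed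
  from this[of s t y y'] this[of t s y' y] show ?thesis
    using assms by (metis linorder_neqE_nat)
qed

text \<open>Raising the two relations to the powers \<open>N'\<close> and \<open>N\<close> and
  multiplying crosswise eliminates \<open>x\<close>; a comparison of powers of \<open>p\<close>
  times units at \<open>P\<close> remains.\<close>

lemma val_rel_unique:
  assumes "val_rel x N a b" "val_rel x N' a' b'" "x \<noteq> 0"
  shows "(real a - real b) / real N = (real a' - real b') / real N'"
proof -
  obtain u y where 1: "u \<in> Zcyc - P" "y \<in> Zcyc - P" "u * of_nat p ^ b * x ^ N = y * of_nat p ^ a"
    using assms(1) by (auto simp: val_rel_def)
  obtain u' y' where 2: "u' \<in> Zcyc - P" "y' \<in> Zcyc - P" "u' * of_nat p ^ b' * x ^ N' = y' * of_nat p ^ a'"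
    using assms(2) by (auto simp: val_rel_def)
  have "N > 0" "N' > 0"
    using assms by (auto simp: val_rel_def)
  have "(u * of_nat p ^ b * x ^ N) ^ N' * (y' * of_nat p ^ a') ^ N
      = (y * of_nat p ^ a) ^ N' * (u' * of_nat p ^ b' * x ^ N') ^ N"
    using 1(3) 2(3) by simp
  then have "x ^ (N * N') * ((u ^ N' * y' ^ N) * of_nat p ^ (b * N' + a' * N))
      = x ^ (N * N') * ((y ^ N' * u' ^ N) * of_nat p ^ (a * N' + b' * N))"
    by (simp add: power_mult_distrib power_add mult_ac flip: power_mult)
  then have "(u ^ N' * y' ^ N) * of_nat p ^ (b * N' + a' * N)
      = (y ^ N' * u' ^ N) * of_nat p ^ (a * N' + b' * N)"
    using assms(3) by simp
  then have "b * N' + a' * N = a * N' + b' * N"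
    by (rule p_power_cancel[rotated 2]) (intro notin_mult notin_power 1 2)+
  then have "real b * real N' + real a' * real N = real a * real N' + real b' * real N"
    by (metis of_nat_add of_nat_mult)
  then show ?thesis
    using \<open>N > 0\<close> \<open>N' > 0\<close> by (simp add: field_simps)
qed

lemma val_rel_mult:
  assumes "val_rel x N a b" "val_rel x' N' a' b'"
  shows "val_rel (x * x') (N * N') (a * N' + a' * N) (b * N' + b' * N)"
proof -
  obtain u y where 1: "u \<in> Zcyc - P" "y \<in> Zcyc - P" "u * of_nat p ^ b * x ^ N = y * of_nat p ^ a"
    using assms(1) by (auto simp: val_rel_def)
  obtain u' y' where 2: "u' \<in> Zcyc - P" "y' \<in> Zcyc - P" "u' * of_nat p ^ b' * x' ^ N' = y' * of_nat p ^ a'"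
    using assms(2) by (auto simp: val_rel_def)
  have "(u ^ N' * u' ^ N) * of_nat p ^ (b * N' + b' * N) * (x * x') ^ (N * N')
      = (u * of_nat p ^ b * x ^ N) ^ N' * (u' * of_nat p ^ b' * x' ^ N') ^ N"
    by (simp add: power_mult_distrib power_add mult_ac flip: power_mult)
  also have "\<dots> = (y * of_nat p ^ a) ^ N' * (y' * of_nat p ^ a') ^ N"
    using 1(3) 2(3) by simp
  also have "\<dots> = (y ^ N' * y' ^ N) * of_nat p ^ (a * N' + a' * N)"
    by (simp add: power_mult_distrib power_add mult_ac flip: power_mult)
  finally have "(u ^ N' * u' ^ N) * of_nat p ^ (b * N' + b' * N) * (x * x') ^ (N * N')
      = (y ^ N' * y' ^ N) * of_nat p ^ (a * N' + a' * N)" .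
  moreover have "u ^ N' * u' ^ N \<in> Zcyc - P" "y ^ N' * y' ^ N \<in> Zcyc - P"
    by (intro notin_mult notin_power 1 2)+
  moreover have "N * N' > 0"
    using assms by (auto simp: val_rel_def)
  ultimately show ?thesis
    unfolding val_rel_def by blast
qed

lemma of_int_notin: "\<not> int p dvd c \<Longrightarrow> of_int c \<in> Zcyc - P"
  using of_int_in_iff roots.int_span_of_int by blast

lemma val_rel_expansion:
  assumes "x \<in> Qcyc" "x \<noteq> 0"
  obtains z a w k u y j c
  where "place_level p P z a w k" "u \<in> Zcyc - P" "y \<in> Zcyc - P"
    "u * of_nat p ^ c * x = place_level.\<pi> w ^ j * y"
    "val_rel x (place_level.\<phi> p k) j (place_level.\<phi> p k * c)" "x \<in> Zcyc \<Longrightarrow> c = 0"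
proof -
  \<comment> \<open>Choosing denominator 1 for elements of \<open>Zcyc\<close> ensures
    \<open>c = 0\<close>, which later gives them nonnegative valuation.\<close>
  obtain m :: int where m: "m \<noteq> 0" "of_int m * x \<in> Zcyc" "x \<in> Zcyc \<Longrightarrow> m = 1"
  proof (cases "x \<in> Zcyc")
    case True
    then show thesis
      using that[of 1] by simp
  next
    case False
    then show thesis
      using assms(1) that unfolding Qcyc_iff by blast
  qed
  obtain c m' where m': "m = int p ^ c * m'" "\<not> int p dvd m'" "c = multiplicity (int p) m"
    using int_p_decomposition[OF prime m(1)] by blast
  obtain z a w k where level: "place_level p P z a w k" and L: "of_int m * x \<in> int_span (range ((^) z))"
    using in_level[OF m(2)] .
  interpret place_level p P z a w k
    by (rule level)
  obtain u y j where uy: "u \<in> L" "u \<notin> P" "y \<in> L" "y \<notin> P" "of_int m * x * u = \<pi> ^ j * y"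
  proof (rule \<pi>_expansion)
    show "of_int m * x \<in> L"
      using L by (simp add: L_def)
    show "of_int m * x \<noteq> 0"
      using m(1) assms(2) by simp
  qed (rule that)
  obtain t where t: "t \<in> L" "t \<notin> P" "of_nat p * t = \<pi> ^ \<phi>"
    using p_\<pi> .
  define v where "v = of_int m' * u"
  have v: "v \<in> Zcyc - P"
    unfolding v_def using uy(1,2) L_subset by (intro notin_mult of_int_notin m'(2)) auto
  have y: "y \<in> Zcyc - P" and t': "t \<in> Zcyc - P"
    using uy t L_subset by auto
  have eq: "v * of_nat p ^ c * x = \<pi> ^ j * y"
    using uy(5) by (simp add: v_def m'(1) mult_ac)
  have "v ^ \<phi> * of_nat p ^ (\<phi> * c) * x ^ \<phi> = (v * of_nat p ^ c * x) ^ \<phi>"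
    by (simp add: power_mult_distrib mult.commute[of \<phi>] power_mult)
  also have "\<dots> = (\<pi> ^ \<phi>) ^ j * y ^ \<phi>"
    unfolding eq by (simp add: power_mult_distrib mult.commute flip: power_mult)
  also have "\<dots> = (t ^ j * y ^ \<phi>) * of_nat p ^ j"
    by (simp add: power_mult_distrib flip: t(3))
  finally have "val_rel x \<phi> j (\<phi> * c)"
    unfolding val_rel_def using \<phi>_pos notin_power[OF v] notin_mult[OF notin_power[OF t'] notin_power[OF y]] by blast
  moreover have "c = 0" if "x \<in> Zcyc"
    using m(3)[OF that] m'(3) by simp
  ultimately show thesis
    using that[OF level v y eq] by blast
qed

section \<open>The extension of the p-adic valuation attached to a place\<close>

definition pval :: "complex \<Rightarrow> ereal"
  where "pval = (\<lambda>x\<in>Qcyc. if x = 0 then \<infinity> else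
    ereal (THE r. \<exists>N a b. val_rel x N a b \<and> r = (real a - real b) / real N))"

lemma pval_0: "pval 0 = \<infinity>"
  by (simp add: pval_def Qcyc_closed)

lemma pval_eqI:
  assumes "val_rel x N a b" "x \<in> Qcyc" "x \<noteq> 0"
  shows "pval x = ereal ((real a - real b) / real N)"
proof -
  have "(THE r. \<exists>N a b. val_rel x N a b \<and> r = (real a - real b) / real N) = (real a - real b) / real N"
    using assms(1) val_rel_unique[OF _ _ assms(3)] by (intro the_equality) blast+
  then show ?thesis
    using assms by (simp add: pval_def)
qed

lemma pval_mult:
  assumes "x \<in> Qcyc" "y \<in> Qcyc"
  shows "pval (x * y) = pval x + pval y"
proof -
  consider "x = 0" | "y = 0" | "x \<noteq> 0" "y \<noteq> 0"
    by blast
  then show ?thesis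
  proof cases
    case 3
    obtain N a b where x: "val_rel x N a b"
      using val_rel_expansion assms(1) 3(1) by metis
    obtain N' a' b' where y: "val_rel y N' a' b'"
      using val_rel_expansion assms(2) 3(2) by metis
    have "N > 0" "N' > 0"
      using x y by (auto simp: val_rel_def)
    then show ?thesis
      using pval_eqI[OF x] pval_eqI[OF y] pval_eqI[OF val_rel_mult[OF x y]] assms 3
      by (simp add: Qcyc_closed field_simps)
  next
    case 1
    then show ?thesis
      using assms(2) by (auto simp: pval_def Qcyc_closed)
  next
    case 2
    then show ?thesis
      using assms(1) by (auto simp: pval_def Qcyc_closed)
  qed
qed

lemma notin_nonzero: "u \<in> Zcyc - P \<Longrightarrow> u \<noteq> 0"
  using zero_in by blast

lemma pval_notin: "u \<in> Zcyc - P \<Longrightarrow> pval u = 0"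
proof -
  assume u: "u \<in> Zcyc - P"
  moreover have "1 \<in> Zcyc - P"
    using one_notin roots.int_span_1 by blast
  ultimately have "val_rel u 1 0 0"
    unfolding val_rel_def using u by (intro conjI bexI[of _ 1] bexI[of _ u]) auto
  then show ?thesis
    using pval_eqI u notin_nonzero Zcyc_subset_Qcyc by fastforce
qed

lemma pval_Zcyc_nonneg: "x \<in> Zcyc \<Longrightarrow> pval x \<ge> 0"
proof (cases "x = 0")
  case False
  assume x: "x \<in> Zcyc"
  then obtain N a where "val_rel x N a 0"
    using val_rel_expansion[of x] False Zcyc_subset_Qcyc by (metis mult_0_right subsetD)
  then show ?thesis
    using pval_eqI[of x N a 0] x False Zcyc_subset_Qcyc by auto
qed (simp add: pval_0)

lemma pval_pos_iff:
  assumes "x \<in> Zcyc"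
  shows "pval x > 0 \<longleftrightarrow> x \<in> P"
proof
  assume "pval x > 0"
  then show "x \<in> P"
    using pval_notin[of x] assms by force
next
  assume x: "x \<in> P"
  show "pval x > 0"
  proof (cases "x = 0")
    case False
    have xQ: "x \<in> Qcyc"
      using assms Zcyc_subset_Qcyc by blast
    obtain N a where rel: "val_rel x N a 0"
      using val_rel_expansion[OF xQ False] assms by (metis mult_0_right)
    then obtain u y where uy: "N > 0" "u \<in> Zcyc - P" "y \<in> Zcyc - P" "u * x ^ N = y * of_nat p ^ a"
      by (auto simp: val_rel_def)
    have "a \<noteq> 0"
    proof
      assume "a = 0"
      then have "y = x ^ N * u"
        using uy(4) by (simp add: mult.commute)
      then have "y \<in> P"
        using x uy(1,2) power_in absorb by blast
      then show False
        using uy(3) by blast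
    qed
    then show ?thesis
      using pval_eqI[OF rel xQ False] uy(1) by simp
  qed (simp add: pval_0)
qed

text \<open>Nonnegative valuation means that the power of \<open>\<pi>\<close> in the numerator
  absorbs the denominator \<open>p ^ c\<close>, which is \<open>\<pi> ^ (\<phi> * c)\<close> up to a
  unit at \<open>P\<close>. So elements of the valuation ring are fractions with denominator outside
  \<open>P\<close>, and the ultrametric inequality reduces to nonnegativity on
  \<open>Zcyc\<close>.\<close>

lemma pval_nonneg_fraction:
  assumes "x \<in> Qcyc" "pval x \<ge> 0"
  obtains u t where "u \<in> Zcyc - P" "t \<in> Zcyc" "u * x = t"
proof (cases "x = 0")
  case True
  then show thesis
    using that[of 1 0] one_notin roots.int_span_closed by simp
next
  case False
  obtain z a w k u y j c
    where level: "place_level p P z a w k" and uy: "u \<in> Zcyc - P" "y \<in> Zcyc - P"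
      "u * of_nat p ^ c * x = place_level.\<pi> w ^ j * y"
    and rel: "val_rel x (place_level.\<phi> p k) j (place_level.\<phi> p k * c)"
    using val_rel_expansion[OF assms(1) False] by metis
  interpret place_level p P z a w k
    by (rule level)
  have "(real j - real (\<phi> * c)) / real \<phi> \<ge> 0"
    using pval_eqI[OF rel assms(1) False] assms(2) by simp
  then have "j \<ge> \<phi> * c"
    using \<phi>_pos by (simp add: zero_le_divide_iff flip: of_nat_mult)
  then have \<pi>j: "\<pi> ^ j = (\<pi> ^ \<phi>) ^ c * \<pi> ^ (j - \<phi> * c)"
    by (simp flip: power_mult power_add)
  obtain t where t: "t \<in> L" "t \<notin> P" "of_nat p * t = \<pi> ^ \<phi>"
    using p_\<pi> .
  have "of_nat p ^ c * (u * x) = of_nat p ^ c * (t ^ c * \<pi> ^ (j - \<phi> * c) * y)"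
    using uy(3) by (simp add: \<pi>j t(3)[symmetric] power_mult_distrib mult_ac)
  then have "u * x = t ^ c * \<pi> ^ (j - \<phi> * c) * y"
    using p_pos by simp
  moreover have "t ^ c * \<pi> ^ (j - \<phi> * c) * y \<in> Zcyc"
    using t(1) \<pi>_in(1) uy(2) L_subset by (intro roots.int_span_closed(2,10)) auto
  ultimately show thesis
    using that uy(1) by blast
qed

lemma pval_one_add:
  assumes "x \<in> Qcyc" "pval x \<ge> 0"
  shows "pval (1 + x) \<ge> 0"
proof -
  obtain u t where ut: "u \<in> Zcyc - P" "t \<in> Zcyc" "u * x = t"
    using pval_nonneg_fraction assms .
  have "u * (1 + x) = u + t"
    using ut(3) by (simp add: algebra_simps)
  then have "pval u + pval (1 + x) = pval (u + t)"
    using pval_mult[of u "1 + x"] ut(1) assms(1) Zcyc_subset_Qcyc by (auto simp: Qcyc_closed)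
  moreover have "pval (u + t) \<ge> 0"
    using ut by (intro pval_Zcyc_nonneg roots.int_span_add) auto
  ultimately show ?thesis
    using pval_notin[OF ut(1)] by simp
qed

lemma pval_finite: "x \<in> Qcyc \<Longrightarrow> x \<noteq> 0 \<Longrightarrow> \<exists>r. pval x = ereal r"
  by (simp add: pval_def)

lemma pval_add_le:
  assumes "x \<in> Qcyc" "y \<in> Qcyc" "x \<noteq> 0" "pval x \<le> pval y"
  shows "pval x \<le> pval (x + y)"
proof -
  \<comment> \<open>Factoring out the summand of smaller valuation reduces the claim to
    \<open>1 + q\<close> with \<open>q\<close> of nonnegative valuation.\<close>
  define q where "q = y / x"
  have q: "q \<in> Qcyc" "y = x * q"
    using assms by (simp_all add: q_def Qcyc_closed)
  obtain r where r: "pval x = ereal r"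
    using pval_finite assms by blast
  have "pval y = pval x + pval q"
    unfolding q(2) using assms(1) q(1) by (rule pval_mult)
  then have "pval q \<ge> 0"
    using assms(4) r by (cases "pval q") auto
  then have "pval (1 + q) \<ge> 0"
    using q(1) pval_one_add by blast
  moreover have "pval (x + y) = pval x + pval (1 + q)"
    using pval_mult[of x "1 + q"] assms(1) q by (simp add: Qcyc_closed algebra_simps)
  ultimately show ?thesis
    using r by (cases "pval (1 + q)") auto
qed

lemma pval_is_valuation: "is_valuation Qcyc pval"
  unfolding is_valuation_def
proof (intro conjI ballI)
  fix x assume x: "x \<in> Qcyc"
  show "pval x \<noteq> - \<infinity>" "pval x = \<infinity> \<longleftrightarrow> x = 0"
    using x by (auto simp: pval_def)
next
  fix x y assume "x \<in> Qcyc" "y \<in> Qcyc"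
  then show "pval (x * y) = pval x + pval y"
    by (rule pval_mult)
next
  fix x y assume xy: "x \<in> Qcyc" "y \<in> Qcyc"
  consider "x = 0" | "y = 0" | "x \<noteq> 0" "y \<noteq> 0" "pval x \<le> pval y" | "x \<noteq> 0" "y \<noteq> 0" "pval y \<le> pval x"
    by fastforce
  then show "min (pval x) (pval y) \<le> pval (x + y)"
  proof cases
    case 3
    then show ?thesis
      using pval_add_le[OF xy 3(1,3)] by (simp add: min_def)
  next
    case 4
    then show ?thesis
      using pval_add_le[OF xy(2,1) 4(2,3)] by (simp add: min_def add.commute)
  qed auto
qed

lemma pval_of_rat: "pval (of_rat q) = padic_valuation p q"
proof (cases "q = 0")
  case True
  then show ?thesis
    by (simp add: pval_0 padic_valuation_def)
next
  case False
  obtain a b where ab: "quotient_of q = (a, b)"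
    by force
  then have b: "b > 0" and q: "q = of_int a / of_int b"
    using quotient_of_denom_pos quotient_of_div by auto
  then have a: "a \<noteq> 0"
    using False by auto
  obtain i a' where a': "a = int p ^ i * a'" "\<not> int p dvd a'" "i = multiplicity (int p) a"
    using int_p_decomposition prime a .
  obtain j b' where b': "b = int p ^ j * b'" "\<not> int p dvd b'" "j = multiplicity (int p) b"
    using int_p_decomposition[OF prime, of b] b by auto
  have "of_int b * (of_rat q :: complex) = of_int a"
    using b by (simp add: q of_rat_divide)
  then have "of_int b' * of_nat p ^ j * of_rat q ^ 1 = (of_int a' * of_nat p ^ i :: complex)"
    by (simp add: a'(1) b'(1) mult_ac)
  then have "val_rel (of_rat q) 1 i j"
    unfolding val_rel_def using of_int_notin[OF a'(2)] of_int_notin[OF b'(2)] by blast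
  then have "pval (of_rat q) = ereal (real i - real j)"
    using pval_eqI[of "of_rat q" 1 i j] False by (simp add: Qcyc_closed)
  then show ?thesis
    using False ab by (simp add: padic_valuation_def a'(3) b'(3))
qed

theorem pval_in_Val: "pval \<in> Val p"
  using pval_is_valuation pval_of_rat by (simp add: Val_def pval_def)

end

section \<open>The place of a valuation\<close>

definition val_place :: "(complex \<Rightarrow> ereal) \<Rightarrow> complex set"
  where "val_place v = {x \<in> Zcyc. v x > 0}"

context
  fixes p v assumes p: "prime p" and v: "v \<in> Val p"
begin

lemma Val_mult: "x \<in> Qcyc \<Longrightarrow> y \<in> Qcyc \<Longrightarrow> v (x * y) = v x + v y"
  and Val_add: "x \<in> Qcyc \<Longrightarrow> y \<in> Qcyc \<Longrightarrow> min (v x) (v y) \<le> v (x + y)"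
  and Val_eq_infinity: "x \<in> Qcyc \<Longrightarrow> v x = \<infinity> \<longleftrightarrow> x = 0"
  and Val_neq_minf: "x \<in> Qcyc \<Longrightarrow> v x \<noteq> -\<infinity>"
  and Val_of_rat: "v (of_rat q) = padic_valuation p q"
  using v by (auto simp: Val_def is_valuation_def)

lemma Val_of_int_nonneg: "v (of_int c) \<ge> 0"
  using Val_of_rat[of "of_int c"] by (simp add: padic_valuation_def)

lemma Val_1: "v 1 = 0"
  using Val_of_rat[of 1] by (simp add: padic_valuation_def)

lemma Val_p: "v (of_nat p) = 1"
  using Val_of_rat[of "of_nat p"] p by (simp add: padic_valuation_def prime_gt_0_nat one_ereal_def)

lemma Val_power: "x \<in> Qcyc \<Longrightarrow> v (x ^ n) = ereal (real n) * v x"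
proof (induction n)
  case (Suc n)
  have "x ^ n \<in> Qcyc"
    using Suc.prems by (rule Qcyc_closed)
  then have "v (x ^ Suc n) = v x + ereal (real n) * v x"
    using Suc Val_mult by simp
  then show ?case
    by (cases "v x") (auto simp: algebra_simps)
qed (simp add: Val_1)

lemma Val_root_of_unity: "z \<in> roots_of_unity \<Longrightarrow> v z = 0"
proof -
  assume z: "z \<in> roots_of_unity"
  then obtain n where n: "n > 0" "z ^ n = 1"
    by (auto simp: roots_of_unity_def)
  have zQ: "z \<in> Qcyc"
    using z by (rule Qcyc_closed)
  then have "ereal (real n) * v z = 0"
    using Val_power[of z n] n Val_1 by simp
  then show ?thesis
    using n(1) by simp
qed

lemma Val_Zcyc_nonneg: "x \<in> Zcyc \<Longrightarrow> v x \<ge> 0"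
proof -
  assume "x \<in> Zcyc"
  then obtain f z where z: "z \<in> roots_of_unity" "x = ieval f z"
    by (auto simp: int_span_def)
  have "v (ieval f z) \<ge> 0"
  proof (induction f)
    case 0
    then show ?case
      using Val_of_int_nonneg[of 0] by simp
  next
    case (pCons c f)
    have mem: "of_int c \<in> Qcyc" "z \<in> Qcyc" "ieval f z \<in> Qcyc"
      using z(1) roots.int_spanI Zcyc_subset_Qcyc by (auto simp: Qcyc_closed)
    then have "v (z * ieval f z) \<ge> 0"
      using Val_mult Val_root_of_unity[OF z(1)] pCons.IH by simp
    then have "0 \<le> min (v (of_int c)) (v (z * ieval f z))"
      using Val_of_int_nonneg by simp
    also have "min (v (of_int c)) (v (z * ieval f z)) \<le> v (of_int c + z * ieval f z)"
      using mem by (intro Val_add) (auto simp: Qcyc_closed)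
    finally show ?case
      by simp
  qed
  then show ?thesis
    using z(2) by simp
qed

lemma place_val_place: "place p (val_place v)"
proof
  note [simp] = val_place_def
  show "prime p"
    by (rule p)
  show "val_place v \<subseteq> Zcyc"
    by auto
  show "of_nat p \<in> val_place v"
    using Val_p by (simp add: roots.int_span_of_nat)
  show "1 \<notin> val_place v"
    using Val_1 by simp
next
  fix x y assume xy: "x \<in> val_place v" "y \<in> val_place v"
  then have "0 < min (v x) (v y)"
    by (simp add: val_place_def)
  also have "\<dots> \<le> v (x + y)"
    using xy Zcyc_subset_Qcyc by (intro Val_add) (auto simp: val_place_def)
  finally show "x + y \<in> val_place v"
    using xy roots.int_span_add by (simp add: val_place_def)
next
  fix x y assume xy: "x \<in> val_place v" "y \<in> Zcyc"
  then have "v (x * y) = v x + v y" "v y \<ge> 0"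
    using Zcyc_subset_Qcyc Val_Zcyc_nonneg by (auto intro!: Val_mult simp: val_place_def)
  then have "v (x * y) > 0"
    using xy(1) by (simp add: val_place_def add_pos_nonneg)
  then show "x * y \<in> val_place v"
    using xy roots.int_span_mult by (simp add: val_place_def)
next
  fix x y assume xy: "x \<in> Zcyc" "y \<in> Zcyc" "x * y \<in> val_place v"
  then have "v (x * y) = v x + v y"
    using Zcyc_subset_Qcyc by (intro Val_mult) auto
  then have "v x + v y > 0" "v x \<ge> 0" "v y \<ge> 0"
    using xy Val_Zcyc_nonneg by (auto simp: val_place_def)
  then have "v x > 0 \<or> v y > 0"
    by (metis add_0 order_le_less order_less_irrefl)
  then show "x \<in> val_place v \<or> y \<in> val_place v"
    using xy by (simp add: val_place_def)
qed

text \<open>The defining equation of \<open>val_rel\<close> leaves no freedom: \<open>v\<close> is 0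
  on elements of \<open>Zcyc\<close> outside its centre and 1 at \<open>p\<close>, so applying
  \<open>v\<close> to the equation solves for the value at \<open>x\<close>.\<close>

theorem Val_eq_pval: "v = place.pval p (val_place v)"
proof
  interpret place p "val_place v"
    by (rule place_val_place)
  fix x
  show "v x = pval x"
  proof (cases "x \<in> Qcyc \<and> x \<noteq> 0")
    case False
    then show ?thesis
      using v Val_eq_infinity[of 0] by (auto simp: pval_def Qcyc_closed Val_def extensional_def)
  next
    case True
    then obtain N a b where rel: "val_rel x N a b"
      using val_rel_expansion by metis
    then obtain u y where uy: "N > 0" "u \<in> Zcyc - val_place v" "y \<in> Zcyc - val_place v"
      "u * of_nat p ^ b * x ^ N = y * of_nat p ^ a"
      by (auto simp: val_rel_def)
    have mem: "u \<in> Qcyc" "y \<in> Qcyc" "of_nat p ^ a \<in> Qcyc" "of_nat p ^ b \<in> Qcyc" "x ^ N \<in> Qcyc"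
      using uy True Zcyc_subset_Qcyc roots.int_span_of_nat Qcyc_closed(12) by blast+
    have "v u = 0" "v y = 0"
      using uy(2,3) Val_Zcyc_nonneg by (auto simp: val_place_def order.antisym)
    moreover have "v (of_nat p ^ n) = ereal (real n)" for n
      using Val_power[of "of_nat p" n] Val_p roots.int_span_of_nat Zcyc_subset_Qcyc
      by (metis mult.right_neutral subsetD)
    moreover obtain r where r: "v x = ereal r"
      using Val_eq_infinity Val_neq_minf True by (metis ereal_cases)
    moreover have "v (u * of_nat p ^ b * x ^ N) = v (y * of_nat p ^ a)"
      by (simp only: uy(4))
    ultimately have "real b + real N * r = real a"
      using Val_mult mem Val_power[of x N] True by (auto simp: Qcyc_closed)
    then have "r = (real a - real b) / real N"
      using uy(1) by (simp add: field_simps)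
    then show ?thesis
      using pval_eqI[OF rel] True r by simp
  qed
qed

end

lemma (in place) val_place_pval: "val_place pval = P"
  using pval_pos_iff subset by (auto simp: val_place_def)


section \<open>The bijections in \<open>Sigma_p\<close>\<close>

lemma BijGroup_simps:
  "carrier (BijGroup S) = Bij S" "\<one>\<^bsub>BijGroup S\<^esub> = (\<lambda>x\<in>S. x)"
  "f \<in> Bij S \<Longrightarrow> g \<in> Bij S \<Longrightarrow> f \<otimes>\<^bsub>BijGroup S\<^esub> g = compose S f g"
  by (simp_all add: BijGroup_def)

lemma Bij_iff: "f \<in> Bij S \<longleftrightarrow> f \<in> extensional S \<and> bij_betw f S S"
  by (simp add: Bij_def)

lemma Bij_in: "f \<in> Bij S \<Longrightarrow> x \<in> S \<Longrightarrow> f x \<in> S"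
  by (auto dest: Bij_imp_funcset)

lemma Bij_inj: "f \<in> Bij S \<Longrightarrow> x \<in> S \<Longrightarrow> y \<in> S \<Longrightarrow> f x = f y \<longleftrightarrow> x = y"
  by (auto simp: Bij_def bij_betw_def inj_on_def)

lemma Bij_surj: "f \<in> Bij S \<Longrightarrow> y \<in> S \<Longrightarrow> \<exists>x\<in>S. f x = y"
  unfolding Bij_def bij_betw_def by (metis (mono_tags, lifting) IntE imageE mem_Collect_eq)

lemma Bij_eqI: "f \<in> Bij S \<Longrightarrow> g \<in> Bij S \<Longrightarrow> (\<And>x. x \<in> S \<Longrightarrow> f x = g x) \<Longrightarrow> f = g"
  by (meson Bij_imp_extensional extensionalityI)

lemma Bij_restrictI:
  assumes "\<And>x. x \<in> S \<Longrightarrow> f x \<in> S" "\<And>x. x \<in> S \<Longrightarrow> g x \<in> S"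
    "\<And>x. x \<in> S \<Longrightarrow> g (f x) = x" "\<And>x. x \<in> S \<Longrightarrow> f (g x) = x"
  shows "(\<lambda>x\<in>S. f x) \<in> Bij S"
  unfolding Bij_iff by (auto intro!: bij_betw_byWitness[where f' = g] simp: assms)

lemma BijGroup_pow_apply:
  assumes "f \<in> Bij S" "x \<in> S"
  shows "(f [^]\<^bsub>BijGroup S\<^esub> (n::nat)) x = (f ^^ n) x"
proof -
  interpret group "BijGroup S"
    by (rule group_BijGroup)
  show ?thesis
    using assms(2)
  proof (induction n arbitrary: x)
    case (Suc n)
    have "f [^]\<^bsub>BijGroup S\<^esub> n \<in> Bij S"
      using nat_pow_closed[of f n] assms(1) by (simp add: BijGroup_simps)
    then show ?case
      using Suc assms(1) Bij_in[OF assms(1)] by (simp add: BijGroup_simps compose_def funpow_swap1)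
  qed (simp add: BijGroup_simps)
qed

lemma inv_BijGroup_apply:
  assumes "f \<in> Bij S" "x \<in> S"
  shows "(inv\<^bsub>BijGroup S\<^esub> f) (f x) = x" "(inv\<^bsub>BijGroup S\<^esub> f) x \<in> S" "f ((inv\<^bsub>BijGroup S\<^esub> f) x) = x"
    "inv\<^bsub>BijGroup S\<^esub> f \<in> Bij S"
  using assms Bij_in[OF assms]
  by (auto simp: inv_BijGroup Bij_def bij_betw_def inv_into_into f_inv_into_f inv_into_f_f restrict_inv_into_Bij[unfolded Bij_def bij_betw_def])
    (use restrict_inv_into_Bij[OF assms(1)] in \<open>auto simp: Bij_def bij_betw_def\<close>)

lemma conj_by_Bij:
  assumes "r \<in> Bij (M p)" "s \<in> Bij (M p)"
  shows "conj_by p r s \<in> Bij (M p)"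
    and "x \<in> M p \<Longrightarrow> conj_by p r s x = r (s ((inv\<^bsub>BijGroup (M p)\<^esub> r) x))"
proof -
  interpret group "BijGroup (M p)"
    by (rule group_BijGroup)
  have r': "inv\<^bsub>BijGroup (M p)\<^esub> r \<in> Bij (M p)"
    using inv_closed[of r] assms(1) by (simp add: BijGroup_simps)
  show "conj_by p r s \<in> Bij (M p)"
    using r' assms m_closed unfolding conj_by_def by (metis BijGroup_simps(1))
  show "conj_by p r s x = r (s ((inv\<^bsub>BijGroup (M p)\<^esub> r) x))" if "x \<in> M p"
    unfolding conj_by_def using that r' assms compose_Bij[OF assms]
    by (simp add: BijGroup_simps) (simp add: compose_def Bij_in)
qed

lemma M_zero: "0 \<in> M p"
  and M_mult: "x \<in> M p \<Longrightarrow> y \<in> M p \<Longrightarrow> x * y \<in> M p"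
  and M_mu: "x \<in> mu p \<Longrightarrow> x \<in> M p"
  and M_divide: "x \<in> M p \<Longrightarrow> y \<in> M p \<Longrightarrow> x / y \<in> M p"
  and M_nonzero: "x \<in> M p \<Longrightarrow> x \<noteq> 0 \<Longrightarrow> x \<in> mu p"
  and M_one: "1 \<in> M p"
  by (auto simp: M_def mu.mult_in divide_inverse mu_inverse mu.one_in)

lemma rotation_Bij: "\<zeta> \<in> mu p \<Longrightarrow> rotation p \<zeta> \<in> Bij (M p)"
  unfolding rotation_def
  by (rule Bij_restrictI[where g = "\<lambda>x. x / \<zeta>"]) (auto simp: mu_nonzero M_mult M_divide M_mu)

lemma conj_by_rotation:
  assumes "\<zeta> \<in> mu p" "s \<in> Bij (M p)" "x \<in> M p"
  shows "conj_by p (rotation p \<zeta>) s x = \<zeta> * s (x / \<zeta>)"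
proof -
  have "x / \<zeta> \<in> M p" "rotation p \<zeta> (x / \<zeta>) = x"
    using assms mu_nonzero[OF assms(1)] M_divide M_mu by (auto simp: rotation_def)
  then have "(inv\<^bsub>BijGroup (M p)\<^esub> rotation p \<zeta>) x = x / \<zeta>"
    using inv_BijGroup_apply(1)[OF rotation_Bij[OF assms(1)], of "x / \<zeta>"] by simp
  then show ?thesis
    using conj_by_Bij(2)[OF rotation_Bij[OF assms(1)] assms(2,3)] \<open>x / \<zeta> \<in> M p\<close> assms(2)
    by (simp add: rotation_def Bij_in)
qed

lemma Sigma_p_iff:
  "s \<in> Sigma_p p \<longleftrightarrow> s \<in> Bij (M p) \<and>
    (\<forall>\<zeta>\<in>mu p. \<forall>x\<in>M p. s (\<zeta> * s (x / \<zeta>)) = \<zeta> * s (s x / \<zeta>)) \<and>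
    s 0 = 1 \<and> (\<forall>x\<in>M p. (s ^^ p) x = x)"
proof (cases "s \<in> Bij (M p)")
  case s: True
  interpret group "BijGroup (M p)"
    by (rule group_BijGroup)
  have "s \<otimes>\<^bsub>BijGroup (M p)\<^esub> conj_by p (rotation p \<zeta>) s = conj_by p (rotation p \<zeta>) s \<otimes>\<^bsub>BijGroup (M p)\<^esub> s
      \<longleftrightarrow> (\<forall>x\<in>M p. s (\<zeta> * s (x / \<zeta>)) = \<zeta> * s (s x / \<zeta>))" (is "?l \<longleftrightarrow> ?r") if \<zeta>: "\<zeta> \<in> mu p" for \<zeta>
  proof -
    define c where "c = conj_by p (rotation p \<zeta>) s"
    have c: "c \<in> Bij (M p)" "\<And>x. x \<in> M p \<Longrightarrow> c x = \<zeta> * s (x / \<zeta>)"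
      using conj_by_Bij(1)[OF rotation_Bij[OF \<zeta>] s] conj_by_rotation[OF \<zeta> s] by (auto simp: c_def)
    have "?l \<longleftrightarrow> compose (M p) s c = compose (M p) c s"
      using s c(1) by (simp add: BijGroup_simps flip: c_def)
    also have "\<dots> \<longleftrightarrow> (\<forall>x\<in>M p. s (c x) = c (s x))"
      by (auto simp: compose_def fun_eq_iff restrict_def)
    also have "\<dots> \<longleftrightarrow> ?r"
      using c(2) s by (simp add: Bij_in)
    finally show ?thesis .
  qed
  moreover have "s [^]\<^bsub>BijGroup (M p)\<^esub> p = \<one>\<^bsub>BijGroup (M p)\<^esub> \<longleftrightarrow> (\<forall>x\<in>M p. (s ^^ p) x = x)"
  proof
    assume "s [^]\<^bsub>BijGroup (M p)\<^esub> p = \<one>\<^bsub>BijGroup (M p)\<^esub>"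
    then show "\<forall>x\<in>M p. (s ^^ p) x = x"
      using BijGroup_pow_apply[OF s] by (metis BijGroup_simps(2) restrict_apply')
  next
    assume *: "\<forall>x\<in>M p. (s ^^ p) x = x"
    have "s [^]\<^bsub>BijGroup (M p)\<^esub> p \<in> Bij (M p)"
      using nat_pow_closed[of s p] s by (simp add: BijGroup_simps)
    then show "s [^]\<^bsub>BijGroup (M p)\<^esub> p = \<one>\<^bsub>BijGroup (M p)\<^esub>"
      using * by (intro Bij_eqI[of _ "M p"]) (auto simp: BijGroup_pow_apply[OF s] BijGroup_simps id_Bij)
  qed
  ultimately show ?thesis
    using s by (simp add: Sigma_p_def BijGroup_simps)
qed (simp add: Sigma_p_def BijGroup_simps)

text \<open>The factorization lets the primality of \<open>P\<close> pick out, from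
  \<open>b ^ q - 1\<close> in \<open>P\<close>, one root of unity congruent to
  \<open>b\<close>.\<close>

lemma prod_minus_roots_unity:
  fixes x :: complex
  assumes "n > 0"
  shows "(\<Prod>\<eta>\<in>{\<eta>. \<eta> ^ n = 1}. x - \<eta>) = x ^ n - 1"
proof -
  define f :: "complex poly" where "f = monom 1 n - 1"
  have f: "poly f y = y ^ n - 1" for y
    by (simp add: f_def poly_monom)
  have "rsquarefree f"
    unfolding rsquarefree_roots f using assms
    by (auto simp: f_def pderiv_diff pderiv_monom poly_monom power_0_left)
  moreover have "lead_coeff f = 1"
  proof -
    have "degree f = n"
      using assms degree_add_eq_left[of "- 1 :: complex poly" "monom 1 n"]
      by (simp add: f_def degree_monom_eq)
    then show ?thesis
      using assms by (simp add: f_def coeff_1)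
  qed
  ultimately have "(\<Prod>\<eta>\<in>{\<eta>. \<eta> ^ n = 1}. [:- \<eta>, 1:]) = f"
    using complex_poly_decompose_rsquarefree[of f] by (simp add: f)
  then have "poly (\<Prod>\<eta>\<in>{\<eta>. \<eta> ^ n = 1}. [:- \<eta>, 1:]) x = poly f x"
    by simp
  then show ?thesis
    by (simp add: f poly_prod)
qed

section \<open>Residues modulo a place and their addition, represented on M(p)\<close>

lemma M_subset_Zcyc: "M p \<subseteq> Zcyc"
  unfolding M_def using mu.finite_order roots.int_span_incl roots.int_span_0 by blast

context place
begin

lemma prod_in_imp:
  assumes "finite A" "\<And>i. i \<in> A \<Longrightarrow> h i \<in> Zcyc" "(\<Prod>i\<in>A. h i) \<in> P"
  shows "\<exists>i\<in>A. h i \<in> P"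
  using assms
proof (induction A rule: finite_induct)
  case (insert i A)
  have "(\<Prod>i\<in>B. h i) \<in> Zcyc" if "B \<subseteq> A" for B
    using that insert.prems(1)
    by (induction B rule: infinite_finite_induct) (auto intro!: roots.int_span_1 roots.int_span_mult)
  then show ?case
    using insert prime_ideal[of "h i" "\<Prod>i\<in>A. h i"] by auto
qed (use one_notin in simp)

text \<open>Frobenius shows that the residue of \<open>x\<close> is fixed by some power \<open>p ^ e\<close>, so it is zero or a
  \<open>(p ^ e - 1)\<close>-th root of unity, and all of these are residues of elements of \<open>mu p\<close>.\<close>

lemma residue_exists:
  assumes "x \<in> Zcyc"
  obtains y where "y \<in> M p" "x - y \<in> P"
proof -
  obtain f z where z: "z \<in> roots_of_unity" "x = ieval f z"
    using assms by (auto simp: int_span_def)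
  obtain i j where ij: "z = z ^ i * z ^ j" "z ^ i \<in> mu p" "z ^ j \<in> mu_ppower p"
    using prime_to_decomposition prime z(1) .
  define a where "a = z ^ i"
  have a: "a \<in> roots_of_unity"
    using z(1) roots.power_in by (simp add: a_def)
  define b where "b = ieval f a"
  have bZ: "b \<in> Zcyc"
    by (simp add: b_def roots.int_spanI a)
  obtain g where "x - b = (z - a) * ieval g z"
    using ieval_diff_power[of f z i] z(2) unfolding a_def b_def by metis
  also have "z - a = (z ^ j - 1) * a"
    using ij(1) by (simp add: a_def algebra_simps)
  also have "(z ^ j - 1) * a * ieval g z \<in> P"
    using mu_ppower_cong[OF ij(3)] a z(1) roots.int_spanI roots.int_span_incl by (intro absorb) auto
  finally have xb: "x - b \<in> P" .
  obtain q h where q: "q > 0" "coprime q p" "b * (b ^ q - 1) = of_nat p * ieval h a"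
    using ieval_mu_frobenius[OF prime ij(2)] unfolding a_def b_def by metis
  have "b * (b ^ q - 1) \<in> P"
    unfolding q(3) using p_in roots.int_spanI[OF a] by (rule absorb)
  moreover have "b ^ q - 1 \<in> Zcyc"
    using bZ by (intro roots.int_span_closed(3,7,10))
  ultimately consider "b \<in> P" | "b ^ q - 1 \<in> P"
    using prime_ideal bZ by blast
  then show thesis
  proof cases
    case 1
    then have "x - 0 \<in> P"
      using add[OF xb 1] by simp
    then show thesis
      by (rule that[rotated]) (simp add: M_def)
  next
    case 2
    then have "(\<Prod>\<eta>\<in>{\<eta>. \<eta> ^ q = 1}. b - \<eta>) \<in> P"
      using prod_minus_roots_unity[OF q(1)] by simp
    moreover have "{\<eta>. \<eta> ^ q = 1} \<subseteq> roots_of_unity"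
      using q(1) by (auto simp: roots_of_unity_def)
    ultimately obtain \<eta> where \<eta>: "\<eta> ^ q = 1" "b - \<eta> \<in> P"
      using prod_in_imp[of "{\<eta>. \<eta> ^ q = 1}" "\<lambda>\<eta>. b - \<eta>"] q(1) bZ
      by (auto simp: finite_roots_unity intro: roots.int_span_closed)
    have "\<eta> \<in> M p"
      using \<eta>(1) q(1,2) by (auto simp: M_def mu_def)
    then show thesis
      using that cong_trans[OF xb \<eta>(2)] by blast
  qed
qed

text \<open>Elements of \<open>mu p\<close> are invertible in \<open>Zcyc\<close>, so zero is
  separate. For two congruent elements of \<open>mu p\<close>, let \<open>c\<close> be their
  quotient, with \<open>c ^ n = 1\<close> and \<open>n\<close> coprime to \<open>p\<close>. If
  \<open>c\<close> were not 1, the sum of the powers of \<open>c\<close> below \<open>n\<close>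
  would be 0; but it is congruent to \<open>n\<close>, so \<open>p\<close> would divide
  \<open>n\<close>.\<close>

lemma residue_unique:
  assumes "x \<in> M p" "y \<in> M p" "x - y \<in> P"
  shows "x = y"
proof -
  have unit: "x \<notin> P" if "x \<in> mu p" for x
  proof
    assume "x \<in> P"
    moreover have "inverse x \<in> Zcyc"
      using mu_inverse[OF that] M_mu M_subset_Zcyc by blast
    ultimately have "x * inverse x \<in> P"
      by (rule absorb)
    then show False
      using mu_nonzero[OF that] one_notin by simp
  qed
  show ?thesis
  proof (cases "x = 0 \<or> y = 0")
    case True
    then show ?thesis
      using assms unit[of x] unit[of y] minus[of "x - y"] M_nonzero by fastforce
  next
    case False
    then have xy: "x \<in> mu p" "y \<in> mu p"
      using assms M_nonzero by blast+
    define c where "c = x / y"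
    have c: "c \<in> mu p"
      unfolding c_def divide_inverse using xy mu.mult_in mu_inverse by blast
    then obtain n where n: "n > 0" "coprime n p" "c ^ n = 1"
      by (auto simp: mu_def)
    have y': "inverse y \<in> Zcyc"
      using mu_inverse[OF xy(2)] M_mu M_subset_Zcyc by blast
    have "c - 1 = (x - y) * inverse y"
      using False by (simp add: c_def field_simps)
    then have c1: "c - 1 \<in> P"
      using absorb[OF assms(3) y'] by simp
    show "x = y"
    proof (rule ccontr)
      assume "x \<noteq> y"
      then have "c \<noteq> 1"
        using False by (simp add: c_def)
      moreover have "(c - 1) * (\<Sum>i<n. c ^ i) = 0"
        using power_diff_1_eq[of c n] n(3) by simp
      ultimately have sum: "(\<Sum>i<n. c ^ i) = 0"
        by simp
      have "(\<Sum>i<m. c ^ i) - of_nat m \<in> P" for m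
      proof (induction m)
        case (Suc m)
        have "c ^ m - 1 = (c - 1) * (\<Sum>i<m. c ^ i)"
          by (rule power_diff_1_eq)
        moreover have "(\<Sum>i<m. c ^ i) \<in> Zcyc"
          using c M_mu M_subset_Zcyc by (induction m) (auto intro!: roots.int_span_closed(1,6,10))
        ultimately have "c ^ m - 1 \<in> P"
          using absorb[OF c1] by simp
        from add[OF Suc this] show ?case
          by (simp add: algebra_simps)
      qed (simp add: zero_in)
      from this[of n] have "of_int (int n) \<in> P"
        using sum minus by fastforce
      then have "p dvd n"
        unfolding of_int_in_iff by simp
      then show False
        using n(2) prime by (metis coprime_absorb_right not_prime_unit)
    qed
  qed
qed

text \<open>Addition of the class of \<open>c\<close> in the residue field \<open>Zcyc / P\<close>,
  carried back to the representatives in \<open>M p\<close>. The description is meaningful by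
  \<open>residue_exists\<close> and \<open>residue_unique\<close>.\<close>

definition translation :: "complex \<Rightarrow> complex \<Rightarrow> complex"
  where "translation c = (\<lambda>x\<in>M p. THE y. y \<in> M p \<and> x + c - y \<in> P)"

lemma translation_eqI:
  assumes "x \<in> M p" "y \<in> M p" "x + c - y \<in> P"
  shows "translation c x = y"
proof -
  have "(THE y. y \<in> M p \<and> x + c - y \<in> P) = y"
  proof (rule the_equality)
    fix y' assume "y' \<in> M p \<and> x + c - y' \<in> P"
    then show "y' = y"
      using residue_unique[of y' y] assms cong_trans[OF cong_sym, of "x + c" y' y] by blast
  qed (use assms in blast)
  then show ?thesis
    using assms(1) by (simp add: translation_def)
qed

lemma translation:
  assumes "c \<in> Zcyc" "x \<in> M p"
  shows "translation c x \<in> M p" "x + c - translation c x \<in> P"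
proof -
  have "x + c \<in> Zcyc"
    using assms M_subset_Zcyc roots.int_span_add by blast
  then obtain y where "y \<in> M p" "x + c - y \<in> P"
    using residue_exists by blast
  then show "translation c x \<in> M p" "x + c - translation c x \<in> P"
    using translation_eqI[OF assms(2)] by auto
qed

lemma translation_translation:
  assumes "c \<in> Zcyc" "d \<in> Zcyc" "x \<in> M p"
  shows "translation c (translation d x) = translation (d + c) x"
proof -
  note d = translation[OF assms(2,3)] and dc = translation[OF _ assms(3), of "d + c"]
  have "x + (d + c) - translation (d + c) x - (x + d - translation d x) \<in> P"
    using assms by (intro diff dc(2) d(2) roots.int_span_add)
  then have "translation d x + c - translation (d + c) x \<in> P"
    by (simp add: algebra_simps)
  then show ?thesis
    using assms by (intro translation_eqI d dc(1) roots.int_span_add)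
qed

lemma translation_in_P: "c \<in> P \<Longrightarrow> x \<in> M p \<Longrightarrow> translation c x = x"
  by (rule translation_eqI) auto

lemma translation_Bij: "c \<in> Zcyc \<Longrightarrow> translation c \<in> Bij (M p)"
proof -
  assume c: "c \<in> Zcyc"
  then have c': "- c \<in> Zcyc"
    by (rule roots.int_span_minus)
  have "(\<lambda>x\<in>M p. translation c x) \<in> Bij (M p)"
    by (rule Bij_restrictI[where g = "translation (- c)"])
      (use c c' in \<open>simp_all add: translation translation_translation translation_in_P zero_in\<close>)
  moreover have "(\<lambda>x\<in>M p. translation c x) = translation c"
    by (simp add: translation_def fun_eq_iff)
  ultimately show ?thesis
    by simp
qed

lemma translation_scale:
  assumes "\<zeta> \<in> mu p" "c \<in> Zcyc" "x \<in> M p"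
  shows "\<zeta> * translation c (x / \<zeta>) = translation (\<zeta> * c) x"
proof -
  have x': "x / \<zeta> \<in> M p"
    using assms M_divide M_mu by blast
  have \<zeta>: "\<zeta> \<noteq> 0" "\<zeta> \<in> Zcyc"
    using assms(1) mu_nonzero M_mu M_subset_Zcyc by blast+
  have "(x / \<zeta> + c - translation c (x / \<zeta>)) * \<zeta> \<in> P"
    using translation(2)[OF assms(2) x'] \<zeta>(2) by (rule absorb)
  then have "x + \<zeta> * c - \<zeta> * translation c (x / \<zeta>) \<in> P"
    using \<zeta>(1) by (simp add: algebra_simps)
  then show ?thesis
    using translation_eqI[OF assms(3)] M_mult M_mu assms(1) translation(1)[OF assms(2) x'] by metis
qed

text \<open>Conjugating by the rotation by \<open>\<zeta>\<close> turns the translation by 1 into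
  the translation by \<open>\<zeta>\<close>, and translations commute. The p-th iterate is the
  translation by \<open>p\<close>, an element of \<open>P\<close>.\<close>

theorem translation_in_Sigma_p: "translation 1 \<in> Sigma_p p"
  unfolding Sigma_p_iff
proof (intro conjI ballI)
  note 1 = roots.int_span_1
  show "translation 1 \<in> Bij (M p)"
    using 1 by (rule translation_Bij)
  show "translation 1 0 = 1"
    by (rule translation_eqI) (auto simp: M_zero M_one zero_in)
  fix \<zeta> x assume \<zeta>: "\<zeta> \<in> mu p" and x: "x \<in> M p"
  have \<zeta>Z: "\<zeta> \<in> Zcyc"
    using \<zeta> M_mu M_subset_Zcyc by blast
  then show "translation 1 (\<zeta> * translation 1 (x / \<zeta>)) = \<zeta> * translation 1 (translation 1 x / \<zeta>)"
    using \<zeta> x 1 by (simp add: translation_scale translation translation_translation add.commute)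
next
  fix x assume x: "x \<in> M p"
  have "(translation 1 ^^ n) x = translation (of_nat n) x" for n
  proof (induction n)
    case (Suc n)
    then show ?case
      using x roots.int_span_1 roots.int_span_of_nat by (simp add: translation_translation add.commute)
  qed (use x in \<open>simp add: translation_in_P zero_in\<close>)
  then show "(translation 1 ^^ p) x = x"
    using x p_in translation_in_P by simp
qed

end

text \<open>A representative valid for both places is carried along Horner's scheme for
  \<open>x = ieval f z\<close>. Adding or subtracting 1 moves it by the common translation or its
  inverse. Multiplying by \<open>z\<close> multiplies it by \<open>z ^ i\<close>, the part of order
  prime to \<open>p\<close>, because the remaining factor \<open>z ^ j\<close> is congruent to 1 at
  every place.\<close>

lemma place_common_residue:
  assumes "place p P" "place p P'" and eq: "place.translation p P 1 = place.translation p P' 1"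
    and x: "x \<in> Zcyc"
  shows "\<exists>y\<in>M p. x - y \<in> P \<and> x - y \<in> P'"
proof -
  interpret A: place p P by fact
  interpret B: place p P' by fact
  note one = roots.int_span_1
  have up: "\<exists>y\<in>M p. x + 1 - y \<in> P \<and> x + 1 - y \<in> P'" if xy: "\<exists>y\<in>M p. x - y \<in> P \<and> x - y \<in> P'" for x
  proof -
    obtain y where y: "y \<in> M p" "x - y \<in> P" "x - y \<in> P'"
      using xy by blast
    have "x + 1 - A.translation 1 y \<in> P"
      using A.add[OF y(2) A.translation(2)[OF one y(1)]] by (simp add: algebra_simps)
    moreover have "x + 1 - A.translation 1 y \<in> P'"
      using B.add[OF y(3) B.translation(2)[OF one y(1)]] by (simp add: eq algebra_simps)
    ultimately show ?thesis
      using A.translation(1)[OF one y(1)] by blast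
  qed
  have down: "\<exists>y\<in>M p. x - 1 - y \<in> P \<and> x - 1 - y \<in> P'" if xy: "\<exists>y\<in>M p. x - y \<in> P \<and> x - y \<in> P'" for x
  proof -
    obtain y where y: "y \<in> M p" "x - y \<in> P" "x - y \<in> P'"
      using xy by blast
    \<comment> \<open>Subtracting 1 from the residue amounts to taking the preimage under the
      translation.\<close>
    obtain t where t: "t \<in> M p" "A.translation 1 t = y"
      using Bij_surj[OF A.translation_Bij[OF one] y(1)] by blast
    have "x - 1 - t \<in> P"
      using A.diff[OF y(2) A.translation(2)[OF one t(1)]] t(2) by (simp add: algebra_simps)
    moreover have "x - 1 - t \<in> P'"
      using B.diff[OF y(3) B.translation(2)[OF one t(1)]] t(2) eq
      by (simp add: algebra_simps)
    ultimately show ?thesis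
      using t(1) by blast
  qed
  obtain f z where z: "z \<in> roots_of_unity" "x = ieval f z"
    using x by (auto simp: int_span_def)
  obtain i j where ij: "z = z ^ i * z ^ j" "z ^ i \<in> mu p" "z ^ j \<in> mu_ppower p"
    using prime_to_decomposition A.prime z(1) .
  have zi: "z ^ i \<in> Zcyc" "z \<in> Zcyc"
    using z(1) roots.power_in roots.int_span_incl by blast+
  have "\<exists>y\<in>M p. ieval f z - y \<in> P \<and> ieval f z - y \<in> P'"
  proof (induction f)
    case 0
    then show ?case
      using A.zero_in B.zero_in by (auto intro!: bexI[of _ 0] simp: M_zero)
  next
    case (pCons c f)
    obtain y where y: "y \<in> M p" "ieval f z - y \<in> P" "ieval f z - y \<in> P'"
      using pCons.IH by blast
    define y' where "y' = z ^ i * y"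
    have y': "y' \<in> M p"
      using y(1) ij(2) M_mult M_mu by (simp add: y'_def)
    have z_eq: "z * ieval f z - y' = z * (ieval f z - y) + (z ^ j - 1) * (z ^ i * y)"
    proof -
      have "z * (ieval f z - y) + (z ^ j - 1) * (z ^ i * y)
          = z * ieval f z - y' + (z ^ i * z ^ j * y - z * y)"
        by (simp add: y'_def algebra_simps)
      also have "z ^ i * z ^ j * y - z * y = 0"
        by (simp only: ij(1)[symmetric] diff_self)
      finally show ?thesis
        by simp
    qed
    have ziy: "z ^ i * y \<in> Zcyc"
      using zi(1) y(1) M_subset_Zcyc roots.int_span_mult by blast
    have "z * ieval f z - y' \<in> P"
      unfolding z_eq by (rule A.add[OF A.absorb_left[OF y(2) zi(2)] A.absorb[OF A.mu_ppower_cong[OF ij(3)] ziy]])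
    moreover have "z * ieval f z - y' \<in> P'"
      unfolding z_eq by (rule B.add[OF B.absorb_left[OF y(3) zi(2)] B.absorb[OF B.mu_ppower_cong[OF ij(3)] ziy]])
    ultimately have base: "\<exists>y\<in>M p. z * ieval f z - y \<in> P \<and> z * ieval f z - y \<in> P'"
      using y' by blast
    have "\<exists>y\<in>M p. z * ieval f z + of_int c - y \<in> P \<and> z * ieval f z + of_int c - y \<in> P'"
    proof (induction c rule: int_induct[of _ 0])
      case base
      show ?case
        using \<open>\<exists>y\<in>M p. z * ieval f z - y \<in> P \<and> z * ieval f z - y \<in> P'\<close> by simp
    next
      case (step1 c)
      then show ?case
        using up[of "z * ieval f z + of_int c"] by (simp add: add.assoc)
    next
      case (step2 c)
      then show ?case
        using down[of "z * ieval f z + of_int c"] by (simp add: algebra_simps)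
    qed
    then show ?case
      by (simp add: add.commute)
  qed
  then show ?thesis
    using z(2) by simp
qed

text \<open>An element of \<open>P\<close> has representative 0 at \<open>P\<close>, and the common
  representative makes it 0 at \<open>P'\<close> as well.\<close>

lemma place_subset:
  assumes "place p P" "place p P'" "place.translation p P 1 = place.translation p P' 1"
  shows "P \<subseteq> P'"
proof
  interpret A: place p P by fact
  fix x assume x: "x \<in> P"
  then obtain y where y: "y \<in> M p" "x - y \<in> P" "x - y \<in> P'"
    using place_common_residue[OF assms] A.subset by blast
  then have "0 - y \<in> P"
    using A.diff[OF y(2) x] by simp
  then have "0 = y"
    using A.residue_unique y(1) M_zero by blast
  then show "x \<in> P'"
    using y(3) by simp
qed

section \<open>The field structure defined by an element of \<open>Sigma_p\<close>\<close>

text \<open>Conjugating \<open>s\<close> by the rotation by \<open>x\<close> gives the addition of \<open>x\<close>; that these conjugates commute yields both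
  commutativity and associativity.\<close>

definition Sigma_ring :: "nat \<Rightarrow> (complex \<Rightarrow> complex) \<Rightarrow> complex ring"
  where "Sigma_ring p s = \<lparr>carrier = M p, monoid.mult = (*), one = 1, ring.zero = 0,
    add = (\<lambda>x y. if x = 0 then y else x * s (y / x))\<rparr>"

lemma Sigma_ring_simps:
  "carrier (Sigma_ring p s) = M p" "x \<otimes>\<^bsub>Sigma_ring p s\<^esub> y = x * y" "\<one>\<^bsub>Sigma_ring p s\<^esub> = 1"
  "\<zero>\<^bsub>Sigma_ring p s\<^esub> = 0" "x \<oplus>\<^bsub>Sigma_ring p s\<^esub> y = (if x = 0 then y else x * s (y / x))"
  by (simp_all add: Sigma_ring_def)

context
  fixes p s assumes p: "prime p" and s: "s \<in> Sigma_p p"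
begin

lemma Sigma_ring_domain: "domain (Sigma_ring p s)"
proof -
  have bij: "s \<in> Bij (M p)" and s0: "s 0 = 1"
    and comm: "\<And>\<zeta> x. \<zeta> \<in> mu p \<Longrightarrow> x \<in> M p \<Longrightarrow> s (\<zeta> * s (x / \<zeta>)) = \<zeta> * s (s x / \<zeta>)"
    using s by (auto simp: Sigma_p_iff)
  define T where "T = (\<lambda>x y. if x = 0 then y else x * s (y / x))"
  have T_closed: "T x y \<in> M p" if "x \<in> M p" "y \<in> M p" for x y
    using that bij by (simp add: T_def M_mult M_divide Bij_in)
  have T_0: "T x 0 = x" for x
    by (simp add: T_def s0)
  \<comment> \<open>The operation \<open>T a\<close> is the conjugate of \<open>s\<close> by the
    rotation by \<open>a\<close>. The commutation rule is used for the rotation by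
    \<open>b / a\<close> at the point \<open>x / a\<close>, and the result is scaled by
    \<open>a\<close>.\<close>
  have T_T: "T a (T b x) = T b (T a x)" if "a \<in> M p" "b \<in> M p" "x \<in> M p" for a b x
  proof (cases "a = 0 \<or> b = 0")
    case False
    then have "b / a \<in> mu p" "x / a \<in> M p"
      using that M_divide M_nonzero by (metis divide_eq_0_iff)+
    then have "s (b / a * s (x / a / (b / a))) = b / a * s (s (x / a) / (b / a))"
      by (rule comm)
    then show ?thesis
      using False by (simp add: T_def field_simps)
  qed (auto simp: T_def)
  \<comment> \<open>The case of \<open>T_T\<close> at 0, as \<open>T x 0 = x\<close>; associativity
    then follows from \<open>T_T\<close> by moving \<open>z\<close> to the left.\<close>
  have T_comm: "T x y = T y x" if "x \<in> M p" "y \<in> M p" for x y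
    using T_T[OF that M_zero] by (simp add: T_0)
  have T_assoc: "T (T x y) z = T x (T y z)" if "x \<in> M p" "y \<in> M p" "z \<in> M p" for x y z
    using T_T[OF that(3,1,2)] T_comm[OF T_closed[OF that(1,2)] that(3)] T_comm[OF that(2,3)] by simp
  have T_distr: "T x y * z = T (x * z) (y * z)" for x y z
    by (cases "z = 0") (auto simp: T_def)
  have add: "x \<oplus>\<^bsub>Sigma_ring p s\<^esub> y = T x y" for x y
    by (simp add: Sigma_ring_simps T_def)
  show ?thesis
  proof (rule domainI)
    show "cring (Sigma_ring p s)"
    proof (rule cringI)
      show "abelian_group (Sigma_ring p s)"
      proof (rule abelian_groupI, unfold add, unfold Sigma_ring_simps)
        fix x assume x: "x \<in> M p"
        show "T 0 x = x"
          by (simp add: T_def)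
        show "\<exists>y\<in>M p. T y x = 0"
        proof (cases "x = 0")
          case True
          then show ?thesis
            using T_0[of 0] M_zero by auto
        next
          case False
          \<comment> \<open>This \<open>y\<close> is the negative of 1 for the new addition, and the
            negative of \<open>x\<close> is \<open>x * y\<close>.\<close>
          obtain y where "y \<in> M p" "s y = 0"
            using Bij_surj[OF bij M_zero] by blast
          then have "T x (x * y) = 0" "x * y \<in> M p"
            using False x by (auto simp: T_def M_mult)
          then show ?thesis
            using T_comm x by metis
        qed
      qed (auto simp: T_closed T_assoc M_zero intro: T_comm)
      show "comm_monoid (Sigma_ring p s)"
        by (rule comm_monoidI) (auto simp: Sigma_ring_simps M_mult M_one)
    qed (unfold add, unfold Sigma_ring_simps, rule T_distr)
  qed (auto simp: Sigma_ring_simps)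
qed

interpretation R: domain "Sigma_ring p s"
  by (rule Sigma_ring_domain)

lemma Sigma_ring_one_add: "1 \<oplus>\<^bsub>Sigma_ring p s\<^esub> x = s x"
  by (simp add: Sigma_ring_simps)

text \<open>Adding 1 is \<open>s\<close>, so the multiple \<open>n\<close> of 1 is the
  \<open>n\<close>-th iterate of \<open>s\<close> at 0, and the \<open>p\<close>-th iterate is the
  identity on \<open>M p\<close>.\<close>

lemma Sigma_ring_char: "R.int_const (int p) = 0"
proof -
  have "R.int_const (int n) = (s ^^ n) 0" for n
  proof (induction n)
    case (Suc n)
    have "R.int_const (1 + int n) = s (R.int_const (int n))"
      unfolding R.int_const_add using Sigma_ring_one_add by (simp add: Sigma_ring_simps)
    then show ?case
      using Suc by simp
  qed (use R.int_const_0 in \<open>simp add: Sigma_ring_simps\<close>)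
  then show ?thesis
    using s M_zero by (simp add: Sigma_p_iff)
qed

lemma Sigma_ring_pow: "x [^]\<^bsub>Sigma_ring p s\<^esub> (n::nat) = x ^ n"
  by (induction n) (auto simp: Sigma_ring_simps)

text \<open>The kernel \<open>P\<close> of \<open>\<psi>\<close> is prime because \<open>M p\<close>
  with complex multiplication has no zero divisors, and it contains \<open>p\<close> by the
  characteristic. Since \<open>\<psi>\<close> is the identity on \<open>M p\<close>, it sends both
  \<open>x + 1\<close> and \<open>s x\<close> to \<open>s x\<close>, which makes \<open>s\<close>
  the translation by 1 at \<open>P\<close>.\<close>

theorem Sigma_p_place:
  obtains P where "place p P" "place.translation p P 1 = s"
proof -
  have cring: "cring (Sigma_ring p s)"
    by (rule R.cring_axioms)
  have \<chi>: "prime_to_part p z \<in> M p" if "z \<in> roots_of_unity" for z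
    using prime_to_part_in[OF p that] M_mu by blast
  have rel: "R.eval_int_poly (prime_to_part p z) f = 0" if "z \<in> roots_of_unity" "ieval f z = 0" for z f
    using R.eval_int_poly_prime_to_part[OF p _ that, of "prime_to_part p z"] \<chi>[OF that(1)] Sigma_ring_char
    by (simp add: Sigma_ring_simps Sigma_ring_pow)
  obtain \<psi> where \<psi>: "\<And>x. x \<in> Zcyc \<Longrightarrow> \<psi> x \<in> M p"
    "\<And>x y. x \<in> Zcyc \<Longrightarrow> y \<in> Zcyc \<Longrightarrow> \<psi> (x + y) = \<psi> x \<oplus>\<^bsub>Sigma_ring p s\<^esub> \<psi> y"
    "\<And>x y. x \<in> Zcyc \<Longrightarrow> y \<in> Zcyc \<Longrightarrow> \<psi> (x * y) = \<psi> x * \<psi> y"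
    "\<And>z. z \<in> roots_of_unity \<Longrightarrow> \<psi> z = prime_to_part p z" "\<And>m. \<psi> (of_int m) = R.int_const m"
  proof (rule roots.int_span_extension[OF cring, of "prime_to_part p"])
    show "prime_to_part p 1 = \<one>\<^bsub>Sigma_ring p s\<^esub>"
      using prime_to_part_mu[OF p mu.one_in] by (simp add: Sigma_ring_simps)
  qed (use \<chi> rel prime_to_part_mult[OF p] in \<open>auto simp: Sigma_ring_simps\<close>)
  have \<psi>0: "\<psi> 0 = 0"
    using \<psi>(5)[of 0] by (simp add: Sigma_ring_simps)
  have \<psi>M: "\<psi> x = x" if "x \<in> M p" for x
    using that \<psi>0 \<psi>(4)[of x] prime_to_part_mu[OF p, of x] subsetD[OF mu.finite_order, of x p]
    by (auto simp: M_def)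
  define P where "P = {x \<in> Zcyc. \<psi> x = 0}"
  have place: "place p P"
  proof
    show "1 \<notin> P"
      using \<psi>M[OF M_one[of p]] by (simp add: P_def)
    show "of_nat p \<in> P"
      using \<psi>(5)[of "int p"] Sigma_ring_char roots.int_span_of_nat by (simp add: P_def)
    fix x y assume "x \<in> P" "y \<in> P"
    then show "x + y \<in> P"
      using \<psi>(2)[of x y] roots.int_span_add by (auto simp: P_def Sigma_ring_simps)
  qed (auto simp: P_def p \<psi>(3) roots.int_span_mult)
  interpret place p P
    by (rule place)
  have "translation 1 = s"
  proof (rule Bij_eqI[of _ "M p"])
    show "translation 1 \<in> Bij (M p)" "s \<in> Bij (M p)"
      using translation_Bij roots.int_span_1 s by (auto simp: Sigma_p_iff)
    fix x assume x: "x \<in> M p"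
    have sx: "s x \<in> M p"
      using s x by (auto simp: Sigma_p_iff Bij_in)
    have mem: "x \<in> Zcyc" "s x \<in> Zcyc" "x + 1 - s x \<in> Zcyc"
      using x sx M_subset_Zcyc by (auto intro!: roots.int_span_closed(1,3,7))
    have "\<psi> (1 + x) = s x"
      using \<psi>(2)[OF roots.int_span_1 mem(1)] \<psi>M x M_one Sigma_ring_one_add by simp
    moreover have "\<psi> (1 + x) = \<psi> (x + 1 - s x) \<oplus>\<^bsub>Sigma_ring p s\<^esub> \<psi> (s x)"
      using \<psi>(2)[OF mem(3,2)] by (simp add: add.commute)
    ultimately have "\<psi> (x + 1 - s x) \<oplus>\<^bsub>Sigma_ring p s\<^esub> s x = s x"
      using \<psi>M[OF sx] by simp
    then have "\<psi> (x + 1 - s x) = 0"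
      using R.add.r_cancel_one[of "s x" "\<psi> (x + 1 - s x)"] \<psi>(1)[OF mem(3)] sx
      by (simp add: Sigma_ring_simps(1,4))
    then have "x + 1 - s x \<in> P"
      using mem(3) by (simp add: P_def)
    then show "translation 1 x = s x"
      using x sx by (intro translation_eqI)
  qed
  then show thesis
    using that place by blast
qed

end

section \<open>Transported addition of 1\<close>

lemma Qcyc_prime_to_subset: "Qcyc_prime_to p \<subseteq> Qcyc"
  unfolding Qcyc_prime_to_def Qcyc_def
  by (intro field.mono_generate_field field_complex_ring mu.finite_order) (simp add: complex_ring_simps)

lemmas Qcyc_prime_to_closed = generated_field_closed[where S = "mu p" for p, folded Qcyc_prime_to_def]

lemma M_subset_Qcyc_prime_to: "M p \<subseteq> Qcyc_prime_to p"
  by (auto simp: M_def Qcyc_prime_to_closed)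

text \<open>The residue field is formed inside \<open>Qcyc_prime_to p\<close>, whereas
  \<open>translation\<close> uses congruences in \<open>Zcyc\<close>. The elements compared, such as
  \<open>x + 1 - y\<close> with \<open>x\<close> and \<open>y\<close> in \<open>M p\<close>, lie in
  both rings, and there both ideals are cut out by positivity of \<open>v\<close>.\<close>

theorem s_val_eq_translation:
  assumes p: "prime p" and v: "v \<in> Val p"
  shows "s_val p v = place.translation p (val_place v) 1"
proof -
  interpret place p "val_place v"
    using p v by (rule place_val_place)
  define I where "I = val_ideal p v"
  have I_iff: "x \<in> I \<longleftrightarrow> x \<in> Qcyc_prime_to p \<and> 0 < v x" for x
    by (simp add: I_def val_ideal_def)
  have I_eq: "x \<in> I \<longleftrightarrow> x \<in> val_place v" if "x \<in> Qcyc_prime_to p" "x \<in> Zcyc" for x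
    using that by (simp add: I_iff val_place_def)
  have I_add: "x + y \<in> I" if "x \<in> I" "y \<in> I" for x y
  proof -
    have "0 < min (v x) (v y)"
      using that by (simp add: I_iff)
    also have "\<dots> \<le> v (x + y)"
      using that Qcyc_prime_to_subset by (intro Val_add[OF p v]) (auto simp: I_iff)
    finally show ?thesis
      using that by (simp add: I_iff Qcyc_prime_to_closed)
  qed
  have I_0: "0 \<in> I"
    using Val_eq_infinity[OF p v, of 0] by (simp add: I_iff Qcyc_prime_to_closed Qcyc_closed)
  have I_minus: "- x \<in> I" if "x \<in> I" for x
  proof -
    have "x \<in> Qcyc" "- 1 \<in> roots_of_unity"
      using that Qcyc_prime_to_subset by (auto simp: I_iff roots_of_unity_def intro!: exI[of _ 2])
    then have "v (- 1 * x) = v x"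
      using Val_mult[OF p v, of "- 1" x] Val_root_of_unity[OF p v] by (simp add: Qcyc_closed)
    then show ?thesis
      using that by (simp add: I_iff Qcyc_prime_to_closed)
  qed
  have res: "residue_map p v x = (\<lambda>h. h + x) ` I" for x
    by (auto simp: residue_map_def a_r_coset_def r_coset_def val_ring_def complex_ring_simps I_def
        ring_of_type_algebra_def)
  have res_eq: "residue_map p v x = residue_map p v y \<longleftrightarrow> x - y \<in> I" for x y
  proof
    assume "residue_map p v x = residue_map p v y"
    moreover have "x \<in> residue_map p v x"
      using I_0 by (auto simp: res intro!: image_eqI[of _ _ 0])
    ultimately show "x - y \<in> I"
      by (auto simp: res)
  next
    have sub: "residue_map p v x \<subseteq> residue_map p v y" if "x - y \<in> I" for x y
    proof
      fix t assume "t \<in> residue_map p v x"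
      then obtain h where "h \<in> I" "t = h + x"
        by (auto simp: res)
      then show "t \<in> residue_map p v y"
        using I_add[OF _ that] by (auto simp: res intro!: image_eqI[of _ _ "h + (x - y)"])
    qed
    assume "x - y \<in> I"
    then show "residue_map p v x = residue_map p v y"
      using sub[of x y] sub[of y x] I_minus[of "x - y"] by auto
  qed
  have inj: "inj_on (residue_map p v) (M p)"
  proof (rule inj_onI)
    fix x y assume xy: "x \<in> M p" "y \<in> M p" "residue_map p v x = residue_map p v y"
    then have "x - y \<in> Qcyc_prime_to p" "x - y \<in> Zcyc"
      using M_subset_Qcyc_prime_to[of p] M_subset_Zcyc[of p]
      by (auto intro!: Qcyc_prime_to_closed(6) roots.int_span_diff)
    then show "x = y"
      using xy res_eq I_eq residue_unique by blast
  qed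
  have add1: "residue_map p v x \<oplus>\<^bsub>residue_field p v\<^esub> \<one>\<^bsub>residue_field p v\<^esub> = residue_map p v (x + 1)" for x
  proof -
    have one: "\<one>\<^bsub>residue_field p v\<^esub> = residue_map p v 1"
      by (simp add: residue_field_def FactRing_def residue_map_def val_ring_def complex_ring_simps
          ring_of_type_algebra_def)
    have add: "A \<oplus>\<^bsub>residue_field p v\<^esub> B = {a + b | a b. a \<in> A \<and> b \<in> B}" for A B
      by (auto simp: residue_field_def FactRing_def set_add_def set_mult_def val_ring_def
          ring_of_type_algebra_def)
    show ?thesis
      unfolding one add
    proof (intro subset_antisym subsetI)
      fix t assume "t \<in> {a + b | a b. a \<in> residue_map p v x \<and> b \<in> residue_map p v 1}"
      then obtain h k where "h \<in> I" "k \<in> I" "t = h + x + (k + 1)"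
        by (auto simp: res)
      then show "t \<in> residue_map p v (x + 1)"
        using I_add by (auto simp: res intro!: image_eqI[of _ _ "h + k"])
    next
      fix t assume "t \<in> residue_map p v (x + 1)"
      then obtain h where "h \<in> I" "t = (h + x) + (0 + 1)"
        by (auto simp: res)
      then show "t \<in> {a + b | a b. a \<in> residue_map p v x \<and> b \<in> residue_map p v 1}"
        using I_0 unfolding res by blast
    qed
  qed
  show ?thesis
  proof (rule extensionalityI[of _ "M p"])
    show "s_val p v \<in> extensional (M p)" "translation 1 \<in> extensional (M p)"
      by (auto simp: s_val_def translation_def)
    fix x assume x: "x \<in> M p"
    note t = translation[OF roots.int_span_1 x]
    have "x + 1 - translation 1 x \<in> Qcyc_prime_to p" "x + 1 - translation 1 x \<in> Zcyc"
      using x t(1) M_subset_Qcyc_prime_to M_subset_Zcyc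
      by (auto intro!: Qcyc_prime_to_closed(2,5,6) roots.int_span_closed(1,3,7))
    then have "x + 1 - translation 1 x \<in> I"
      using t(2) I_eq by blast
    then have "residue_map p v (translation 1 x) = residue_map p v (x + 1)"
      using res_eq by metis
    then show "s_val p v x = translation 1 x"
      using the_inv_into_f_eq[OF inj _ t(1)] x by (simp add: s_val_def add1)
  qed
qed

text \<open>Injectivity: \<open>s_val p v\<close> determines the centre of \<open>v\<close> by
  \<open>place_subset\<close> in both directions, and the centre determines \<open>v\<close> by
  \<open>Val_eq_pval\<close>. Surjectivity: the place built from \<open>s\<close> is the centre of
  its own \<open>pval\<close>.\<close>

theorem bij_betw_s_val:
  assumes p: "prime p"
  shows "bij_betw (s_val p) (Val p) (Sigma_p p)"
  unfolding bij_betw_def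
proof
  show "inj_on (s_val p) (Val p)"
  proof (rule inj_onI)
    fix v w assume vw: "v \<in> Val p" "w \<in> Val p" "s_val p v = s_val p w"
    then have "val_place v = val_place w"
      using place_subset[OF place_val_place[OF p vw(1)] place_val_place[OF p vw(2)]]
        place_subset[OF place_val_place[OF p vw(2)] place_val_place[OF p vw(1)]] s_val_eq_translation[OF p]
      by simp
    then show "v = w"
      using Val_eq_pval[OF p vw(1)] Val_eq_pval[OF p vw(2)] by simp
  qed
  show "s_val p ` Val p = Sigma_p p"
  proof (intro equalityI subsetI)
    fix s assume "s \<in> s_val p ` Val p"
    then show "s \<in> Sigma_p p"
      using place.translation_in_Sigma_p[OF place_val_place[OF p]] s_val_eq_translation[OF p] by auto
  next
    fix s assume "s \<in> Sigma_p p"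
    then obtain P where P: "place p P" "place.translation p P 1 = s"
      using Sigma_p_place p by blast
    interpret place p P
      by (rule P(1))
    have "s_val p pval = s"
      using s_val_eq_translation[OF p pval_in_Val] P(2) by (simp add: val_place_pval)
    then show "s \<in> s_val p ` Val p"
      using pval_in_Val by blast
  qed
qed


section \<open>Galois groups\<close>

text \<open>Values outside \<open>K\<close> are left open, so that maps can be built by formulas and
  composed without restriction; they are restricted to \<open>K\<close> only when they enter
  \<open>Gal\<close>.\<close>

definition field_hom :: "complex set \<Rightarrow> (complex \<Rightarrow> complex) \<Rightarrow> bool"
  where "field_hom K \<sigma> \<longleftrightarrow> \<sigma> 1 = 1 \<and>
    (\<forall>x\<in>K. \<forall>y\<in>K. \<sigma> (x + y) = \<sigma> x + \<sigma> y \<and> \<sigma> (x * y) = \<sigma> x * \<sigma> y)"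

context
  fixes S K \<sigma> assumes K: "K = generate_field complex_ring S" and hom: "field_hom K \<sigma>"
begin

lemma field_hom_simps:
  shows field_hom_one: "\<sigma> 1 = 1" and field_hom_add: "x \<in> K \<Longrightarrow> y \<in> K \<Longrightarrow> \<sigma> (x + y) = \<sigma> x + \<sigma> y"
    and field_hom_mult: "x \<in> K \<Longrightarrow> y \<in> K \<Longrightarrow> \<sigma> (x * y) = \<sigma> x * \<sigma> y"
  using hom by (auto simp: field_hom_def)

lemma field_hom_zero: "\<sigma> 0 = 0"
  using field_hom_add[of 0 0] generated_field_closed(3)[where S = S] K by simp

lemma field_hom_minus: "x \<in> K \<Longrightarrow> \<sigma> (- x) = - \<sigma> x"
  using field_hom_add[of "- x" x] generated_field_closed(4)[where S = S] K field_hom_zero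
  by (simp add: eq_neg_iff_add_eq_0)

lemma field_hom_diff: "x \<in> K \<Longrightarrow> y \<in> K \<Longrightarrow> \<sigma> (x - y) = \<sigma> x - \<sigma> y"
  using field_hom_add[of x "- y"] field_hom_minus[of y] generated_field_closed(4)[where S = S] K by simp

lemma field_hom_inverse:
  assumes "x \<in> K" "x \<noteq> 0"
  shows "\<sigma> (inverse x) = inverse (\<sigma> x)" "\<sigma> x \<noteq> 0"
proof -
  have "\<sigma> x * \<sigma> (inverse x) = 1"
    using field_hom_mult[of x "inverse x"] assms generated_field_closed(8)[where S = S] K field_hom_one by simp
  then show "\<sigma> (inverse x) = inverse (\<sigma> x)" "\<sigma> x \<noteq> 0"
    by (auto simp: inverse_unique)
qed

lemma field_hom_of_int: "\<sigma> (of_int m) = of_int m"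
proof (induction m rule: int_induct[of _ 0])
  case (step1 i)
  then show ?case
    using field_hom_add[of "of_int i" 1] generated_field_closed(2,10)[where S = S] K field_hom_one by simp
next
  case (step2 i)
  then show ?case
    using field_hom_diff[of "of_int i" 1] generated_field_closed(2,10)[where S = S] K field_hom_one by simp
qed (simp add: field_hom_zero)

lemma field_hom_of_rat: "\<sigma> (of_rat q) = of_rat q"
proof (cases q)
  case (Fract a b)
  then have q: "of_rat q = (of_int a * inverse (of_int b) :: complex)"
    by (simp add: of_rat_rat divide_inverse)
  show ?thesis
    unfolding q using Fract(2) field_hom_mult[of "of_int a" "inverse (of_int b)"] K
      generated_field_closed(8,10)[where S = S] by (simp add: field_hom_of_int field_hom_inverse)
qed

lemma field_hom_image:
  assumes "\<And>x. x \<in> S \<Longrightarrow> \<sigma> x \<in> K" "x \<in> K"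
  shows "\<sigma> x \<in> K"
  using assms(2) unfolding K
  by (induction rule: generated_field_induct)
    (use assms(1) generated_field_closed[where S = S] in
      \<open>simp_all add: field_hom_simps field_hom_minus field_hom_inverse flip: K\<close>)

end

lemma field_hom_unique:
  assumes K: "K = generate_field complex_ring S" and \<sigma>: "field_hom K \<sigma>" and \<tau>: "field_hom K \<tau>"
    and "\<And>x. x \<in> S \<Longrightarrow> \<tau> x = \<sigma> x" "x \<in> K"
  shows "\<tau> x = \<sigma> x"
  using assms(5) unfolding K
  by (induction rule: generated_field_induct)
    (use assms(4) in \<open>simp_all add: field_hom_simps[OF K \<sigma>] field_hom_minus[OF K \<sigma>] field_hom_inverse[OF K \<sigma>]
      field_hom_simps[OF K \<tau>] field_hom_minus[OF K \<tau>] field_hom_inverse[OF K \<tau>] flip: K\<close>)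

lemma field_hom_compose:
  "field_hom K \<sigma> \<Longrightarrow> field_hom K \<tau> \<Longrightarrow> (\<And>x. x \<in> K \<Longrightarrow> \<tau> x \<in> K) \<Longrightarrow> field_hom K (\<lambda>x. \<sigma> (\<tau> x))"
  by (simp add: field_hom_def)

lemma Gal_carrier:
  assumes K: "K = generate_field complex_ring S"
  shows "\<sigma> \<in> carrier (Gal K) \<longleftrightarrow> \<sigma> \<in> Bij K \<and> field_hom K \<sigma>"
  using field_hom_of_rat[OF K] Bij_in[of \<sigma> K]
  by (auto simp: Gal_def ring_hom_def field_hom_def ring_of_type_algebra_def)

lemma Gal_mult: "\<sigma> \<otimes>\<^bsub>Gal K\<^esub> \<tau> = \<sigma> \<otimes>\<^bsub>BijGroup K\<^esub> \<tau>"
  by (simp add: Gal_def)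

lemma Gal_subgroup:
  assumes K: "K = generate_field complex_ring S"
  shows "subgroup (carrier (Gal K)) (BijGroup K)"
proof -
  interpret group "BijGroup K"
    by (rule group_BijGroup)
  note closed = generated_field_closed[where S = S, folded K]
  show ?thesis
  proof (rule subgroupI)
    show "carrier (Gal K) \<subseteq> carrier (BijGroup K)"
      by (auto simp: Gal_carrier[OF K] BijGroup_simps)
    have "(\<lambda>x\<in>K. x) \<in> carrier (Gal K)"
      using closed by (auto simp: Gal_carrier[OF K] id_Bij field_hom_def)
    then show "carrier (Gal K) \<noteq> {}"
      by blast
  next
    fix \<sigma> assume "\<sigma> \<in> carrier (Gal K)"
    then have \<sigma>: "\<sigma> \<in> Bij K" "field_hom K \<sigma>"
      by (auto simp: Gal_carrier[OF K])
    define \<tau> where "\<tau> = inv\<^bsub>BijGroup K\<^esub> \<sigma>"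
    have \<tau>: "\<tau> (\<sigma> x) = x" "\<tau> x \<in> K" "\<sigma> (\<tau> x) = x" if "x \<in> K" for x
      using inv_BijGroup_apply[OF \<sigma>(1) that] by (auto simp: \<tau>_def)
    have "field_hom K \<tau>"
      unfolding field_hom_def
    proof (intro conjI ballI)
      show "\<tau> 1 = 1"
        using \<tau>(1)[OF closed(2)] field_hom_one[OF K \<sigma>(2)] by simp
      fix x y assume xy: "x \<in> K" "y \<in> K"
      then have "\<sigma> (\<tau> x + \<tau> y) = x + y" "\<sigma> (\<tau> x * \<tau> y) = x * y"
        by (simp_all add: field_hom_add[OF K \<sigma>(2)] field_hom_mult[OF K \<sigma>(2)] \<tau>)
      then show "\<tau> (x + y) = \<tau> x + \<tau> y" "\<tau> (x * y) = \<tau> x * \<tau> y"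
        using \<tau>(1)[of "\<tau> x + \<tau> y"] \<tau>(1)[of "\<tau> x * \<tau> y"] xy closed(5,7) \<tau>(2) by auto
    qed
    then show "inv\<^bsub>BijGroup K\<^esub> \<sigma> \<in> carrier (Gal K)"
      using inv_closed[of \<sigma>] \<sigma>(1) by (simp add: Gal_carrier[OF K] BijGroup_simps \<tau>_def)
  next
    fix \<sigma> \<tau> assume "\<sigma> \<in> carrier (Gal K)" "\<tau> \<in> carrier (Gal K)"
    then have \<sigma>: "\<sigma> \<in> Bij K" "field_hom K \<sigma>" and \<tau>: "\<tau> \<in> Bij K" "field_hom K \<tau>"
      by (auto simp: Gal_carrier[OF K])
    have "field_hom K (compose K \<sigma> \<tau>)"
      using \<sigma>(2) \<tau>(2) closed(2,5,7) Bij_in[OF \<tau>(1)] by (auto simp: field_hom_def compose_def)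
    then show "\<sigma> \<otimes>\<^bsub>BijGroup K\<^esub> \<tau> \<in> carrier (Gal K)"
      using \<sigma>(1) \<tau>(1) by (simp add: Gal_carrier[OF K] BijGroup_simps compose_Bij)
  qed
qed

lemma Gal_eq: "Gal K = BijGroup K\<lparr>carrier := carrier (Gal K)\<rparr>"
  by (simp add: Gal_def)

lemma Gal_group:
  assumes "K = generate_field complex_ring S"
  shows "group (Gal K)"
  using subgroup.subgroup_is_group[OF Gal_subgroup[OF assms] group_BijGroup] by (simp flip: Gal_eq)

lemma Gal_inv:
  assumes "K = generate_field complex_ring S" "\<sigma> \<in> carrier (Gal K)"
  shows "inv\<^bsub>Gal K\<^esub> \<sigma> = inv\<^bsub>BijGroup K\<^esub> \<sigma>"
  using group.m_inv_consistent[OF group_BijGroup Gal_subgroup[OF assms(1)] assms(2)] by (simp flip: Gal_eq)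

section \<open>Extending automorphisms of groups of roots of unity to fields\<close>

lemma eval_int_poly_complex_ring:
  "cring.int_const complex_ring m = of_int m" "cring.eval_int_poly complex_ring x f = ieval f x"
proof -
  interpret cring complex_ring
    by (rule cring_from_type_algebra)
  show int: "int_const m = of_int m" for m
  proof (induction m rule: int_induct[of _ 0])
    case (step1 i)
    then show ?case
      by (simp add: int_const_add, simp add: complex_ring_simps)
  next
    case (step2 i)
    then show ?case
      using int_const_add[of "i - 1" 1] by (simp add: complex_ring_simps eq_diff_eq)
  qed (simp, simp add: complex_ring_simps)
  show "eval_int_poly x f = ieval f x"
    by (induction f) (simp_all add: complex_ring_simps int)
qed

context torsion_monoid
begin

text \<open>An injective multiplicative map preserves orders, so \<open>\<chi> z\<close> is a power
  \<open>z ^ k\<close> with \<open>k\<close> coprime to the order of \<open>z\<close>, that is, a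
  conjugate of \<open>z\<close>, and \<open>ieval_power_coprime_eq_0\<close> applies.\<close>

lemma bij_preserves_relations:
  assumes bij: "bij_betw \<chi> U U" and mult: "\<And>x y. x \<in> U \<Longrightarrow> y \<in> U \<Longrightarrow> \<chi> (x * y) = \<chi> x * \<chi> y"
    and z: "z \<in> U" "ieval f z = 0"
  shows "\<chi> 1 = 1" "ieval f (\<chi> z) = 0"
proof -
  have \<chi>: "\<chi> x \<in> U" if "x \<in> U" for x
    using bij that by (auto simp: bij_betw_def)
  have inj: "\<chi> x = \<chi> y \<longleftrightarrow> x = y" if "x \<in> U" "y \<in> U" for x y
    using bij that by (auto simp: bij_betw_def inj_on_def)
  have "\<chi> 1 * \<chi> 1 = \<chi> 1"
    using mult[OF one_in one_in] by simp
  moreover have "\<chi> 1 \<noteq> 0"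
    using \<chi>[OF one_in] finite_order roots_of_unity_nonzero by blast
  ultimately show one: "\<chi> 1 = 1"
    by simp
  have pow: "\<chi> (z ^ j) = \<chi> z ^ j" for j
    using z(1) by (induction j) (auto simp: one mult power_in)
  obtain n where n: "n > 0" "\<And>j. z ^ j = 1 \<longleftrightarrow> n dvd j"
    using root_of_unity_order z(1) finite_order by (metis subsetD)
  have \<chi>n: "\<chi> z ^ j = 1 \<longleftrightarrow> n dvd j" for j
    using n(2) inj[OF power_in[OF z(1), of j] one_in] by (simp add: one pow)
  obtain k where k: "\<chi> z = z ^ k"
    using primitive_root_powers[OF n] \<chi>n by (metis dvd_refl)
  \<comment> \<open>This power of \<open>z ^ k\<close> is 1, although \<open>\<chi> z\<close> still
    has order \<open>n\<close>; therefore the gcd is 1.\<close>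
  have "\<chi> z ^ (n div gcd k n) = z ^ (n * (k div gcd k n))"
    unfolding k power_mult[symmetric] by (metis div_mult_swap gcd_dvd1 gcd_dvd2 mult.commute)
  also have "\<dots> = 1"
    using n(2) by simp
  finally have "n dvd n div gcd k n"
    using \<chi>n by blast
  moreover have gcd: "n div gcd k n * gcd k n = n"
    by simp
  then have "n div gcd k n > 0"
    using n(1) by (metis mult_0 neq0_conv)
  ultimately have le: "n \<le> n div gcd k n"
    by (simp add: dvd_imp_le)
  have "gcd k n = 1"
  proof (rule ccontr)
    assume "gcd k n \<noteq> 1"
    then have "2 \<le> gcd k n"
      using n(1) gcd_pos_nat[of k n] by linarith
    then have "n * 2 \<le> n div gcd k n * gcd k n"
      using le by (intro mult_le_mono)
    then show False
      using gcd n(1) by simp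
  qed
  then have "coprime k n"
    by (simp add: coprime_iff_gcd_eq_1)
  then show "ieval f (\<chi> z) = 0"
    using ieval_power_coprime_eq_0[of z n k f] n z(2) by (simp add: k)
qed

lemma field_hom_extension:
  assumes bij: "bij_betw \<chi> U U" and mult: "\<And>x y. x \<in> U \<Longrightarrow> y \<in> U \<Longrightarrow> \<chi> (x * y) = \<chi> x * \<chi> y"
  obtains \<sigma> where "field_hom (generate_field complex_ring U) \<sigma>" "\<And>z. z \<in> U \<Longrightarrow> \<sigma> z = \<chi> z"
proof -
  define K where "K = generate_field complex_ring U"
  obtain \<psi> where \<psi>:
    "\<And>x y. x \<in> int_span U \<Longrightarrow> y \<in> int_span U \<Longrightarrow> \<psi> (x + y) = \<psi> x + \<psi> y"
    "\<And>x y. x \<in> int_span U \<Longrightarrow> y \<in> int_span U \<Longrightarrow> \<psi> (x * y) = \<psi> x * \<psi> y"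
    "\<And>z. z \<in> U \<Longrightarrow> \<psi> z = \<chi> z" "\<And>m. \<psi> (of_int m) = of_int m"
  proof (rule int_span_extension[OF cring_from_type_algebra, of \<chi>])
    show "\<chi> 1 = \<one>\<^bsub>complex_ring\<^esub>"
      using bij_preserves_relations(1)[OF bij mult one_in, of 0] by (simp add: complex_ring_simps)
    show "cring.eval_int_poly complex_ring (\<chi> z) f = \<zero>\<^bsub>complex_ring\<^esub>" if "z \<in> U" "ieval f z = 0" for z f
      using bij_preserves_relations(2)[OF bij mult that]
      by (simp add: complex_ring_simps eval_int_poly_complex_ring)
  qed (auto simp: complex_ring_simps mult eval_int_poly_complex_ring)
  \<comment> \<open>Some integer denominator of \<open>x\<close>. Because \<open>\<psi>\<close>
    commutes with integer factors, the quotient defining \<open>\<sigma>\<close> is the same for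
    every denominator.\<close>
  define den where "den = (\<lambda>x. SOME m::int. m \<noteq> 0 \<and> of_int m * x \<in> int_span U)"
  define \<sigma> where "\<sigma> = (\<lambda>x. \<psi> (of_int (den x) * x) / of_int (den x))"
  have den: "den x \<noteq> 0" "of_int (den x) * x \<in> int_span U" if "x \<in> K" for x
    using someI_ex[of "\<lambda>m::int. m \<noteq> 0 \<and> of_int m * x \<in> int_span U"] that
    by (auto simp: K_def generated_field_iff den_def)
  have scale: "\<psi> (of_int m * x) = of_int m * \<psi> x" if "x \<in> int_span U" for m x
    using \<psi>(2)[OF int_span_of_int that] \<psi>(4) by simp
  have \<sigma>: "\<sigma> x = \<psi> (of_int m * x) / of_int m" if "x \<in> K" "m \<noteq> 0" "of_int m * x \<in> int_span U" for x m
  proof -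
    have "of_int m * \<psi> (of_int (den x) * x) = of_int (den x) * \<psi> (of_int m * x)"
      using scale[OF den(2)[OF that(1)], of m] scale[OF that(3), of "den x"]
      by (simp add: mult.left_commute)
    then show ?thesis
      using that(2) den(1)[OF that(1)] by (simp add: \<sigma>_def field_simps)
  qed
  have \<sigma>_int: "\<sigma> x = \<psi> x" if "x \<in> int_span U" for x
    using \<sigma>[of x 1] that int_span_subset_generated_field by (auto simp: K_def)
  have "field_hom K \<sigma>"
    unfolding field_hom_def
  proof (intro conjI ballI)
    show "\<sigma> 1 = 1"
      using \<sigma>_int[OF int_span_1] \<psi>(4)[of 1] by simp
    fix x y assume xy: "x \<in> K" "y \<in> K"
    define a where "a = of_int (den x) * x"
    define b where "b = of_int (den y) * y"
    have ab: "a \<in> int_span U" "b \<in> int_span U" "den x \<noteq> 0" "den y \<noteq> 0"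
      using den xy by (auto simp: a_def b_def)
    have \<sigma>xy: "\<sigma> x = \<psi> a / of_int (den x)" "\<sigma> y = \<psi> b / of_int (den y)"
      by (simp_all add: \<sigma>_def a_def b_def)
    have sum: "of_int (den x * den y) * (x + y) = of_int (den y) * a + of_int (den x) * b"
      by (simp add: a_def b_def algebra_simps)
    have prod: "of_int (den x * den y) * (x * y) = a * b"
      by (simp add: a_def b_def)
    have K: "x + y \<in> K" "x * y \<in> K"
      using xy generated_field_closed(5,7)[where S = U] by (auto simp: K_def)
    have nz: "den x * den y \<noteq> 0"
      using ab(3,4) by simp
    have mem: "of_int (den x * den y) * (x + y) \<in> int_span U" "of_int (den x * den y) * (x * y) \<in> int_span U"
      unfolding sum prod by (intro int_span_add int_span_mult int_span_of_int ab)+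
    have \<psi>_sum: "\<psi> (of_int (den y) * a + of_int (den x) * b) = of_int (den y) * \<psi> a + of_int (den x) * \<psi> b"
      using ab(1,2) by (simp add: \<psi>(1) scale int_span_mult int_span_of_int)
    have "\<sigma> (x + y) = \<psi> (of_int (den y) * a + of_int (den x) * b) / of_int (den x * den y)"
      using \<sigma>[OF K(1) nz mem(1)] by (simp only: sum)
    also have "\<dots> = \<sigma> x + \<sigma> y"
      unfolding \<psi>_sum \<sigma>xy using ab(3,4) by (simp add: add_divide_distrib)
    finally show "\<sigma> (x + y) = \<sigma> x + \<sigma> y" .
    have "\<sigma> (x * y) = \<psi> (a * b) / of_int (den x * den y)"
      using \<sigma>[OF K(2) nz mem(2)] by (simp only: prod)
    then show "\<sigma> (x * y) = \<sigma> x * \<sigma> y"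
      using ab by (simp add: \<psi>(2) \<sigma>xy)
  qed
  moreover have "\<sigma> z = \<chi> z" if "z \<in> U" for z
    using \<sigma>_int[OF int_span_incl[OF that]] \<psi>(3)[OF that] by simp
  ultimately show thesis
    using that K_def by blast
qed

text \<open>Both \<open>\<chi>\<close> and its inverse extend to homomorphisms of \<open>K\<close>.
  Their composites fix the generators and so are the identity, which gives bijectivity of the
  extension.\<close>

theorem Gal_extension:
  assumes K: "K = generate_field complex_ring U"
    and \<chi>: "bij_betw \<chi> U U" "\<And>x y. x \<in> U \<Longrightarrow> y \<in> U \<Longrightarrow> \<chi> (x * y) = \<chi> x * \<chi> y"
  obtains \<sigma> where "\<sigma> \<in> carrier (Gal K)" "\<And>z. z \<in> U \<Longrightarrow> \<sigma> z = \<chi> z"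
proof -
  note closed = generated_field_closed[where S = U, folded K]
  define \<chi>' where "\<chi>' = the_inv_into U \<chi>"
  have \<chi>_in: "\<chi> z \<in> U" if "z \<in> U" for z
    using \<chi>(1) that by (auto simp: bij_betw_def)
  have \<chi>': "bij_betw \<chi>' U U"
    using \<chi>(1) unfolding \<chi>'_def by (rule bij_betw_the_inv_into)
  have \<chi>'_in: "\<chi>' z \<in> U" if "z \<in> U" for z
    using \<chi>' that by (auto simp: bij_betw_def)
  have inv: "\<chi>' (\<chi> z) = z" "\<chi> (\<chi>' z) = z" if "z \<in> U" for z
    using that \<chi>(1) by (auto simp: \<chi>'_def bij_betw_def the_inv_into_f_f f_the_inv_into_f)
  have \<chi>'_mult: "\<chi>' (x * y) = \<chi>' x * \<chi>' y" if "x \<in> U" "y \<in> U" for x y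
    using \<chi>(2)[OF \<chi>'_in[OF that(1)] \<chi>'_in[OF that(2)]] inv that inv(1)[of "\<chi>' x * \<chi>' y"]
    by (simp add: mult_in \<chi>'_in)
  obtain \<sigma> where \<sigma>: "field_hom K \<sigma>" "\<And>z. z \<in> U \<Longrightarrow> \<sigma> z = \<chi> z"
    using field_hom_extension \<chi> K by metis
  obtain \<tau> where \<tau>: "field_hom K \<tau>" "\<And>z. z \<in> U \<Longrightarrow> \<tau> z = \<chi>' z"
    using field_hom_extension \<chi>' \<chi>'_mult K by metis
  have \<sigma>_in: "\<sigma> x \<in> K" and \<tau>_in: "\<tau> x \<in> K" if "x \<in> K" for x
    using field_hom_image[OF K \<sigma>(1) _ that] field_hom_image[OF K \<tau>(1) _ that]
    by (auto simp: \<sigma> \<tau> \<chi>_in \<chi>'_in closed)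
  have id: "field_hom K (\<lambda>x. x)"
    by (simp add: field_hom_def)
  have \<tau>\<sigma>: "\<tau> (\<sigma> x) = x" and \<sigma>\<tau>: "\<sigma> (\<tau> x) = x" if "x \<in> K" for x
    using field_hom_unique[OF K id field_hom_compose[OF \<tau>(1) \<sigma>(1)] _ that]
      field_hom_unique[OF K id field_hom_compose[OF \<sigma>(1) \<tau>(1)] _ that]
    by (auto simp: \<sigma> \<tau> inv \<chi>_in \<chi>'_in \<sigma>_in \<tau>_in)
  have "(\<lambda>x\<in>K. \<sigma> x) \<in> Bij K"
    by (rule Bij_restrictI[where g = \<tau>]) (auto simp: \<sigma>_in \<tau>_in \<tau>\<sigma> \<sigma>\<tau>)
  moreover have "field_hom K (\<lambda>x\<in>K. \<sigma> x)"
    using \<sigma>(1) closed(2,5,7) by (auto simp: field_hom_def)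
  ultimately have "(\<lambda>x\<in>K. \<sigma> x) \<in> carrier (Gal K)"
    by (simp add: Gal_carrier[OF K])
  then show thesis
    using that \<sigma>(2) closed(1) by (metis restrict_apply')
qed

end

lemma Gal_eqI:
  assumes K: "K = generate_field complex_ring S"
    and "\<sigma> \<in> carrier (Gal K)" "\<tau> \<in> carrier (Gal K)" "\<And>x. x \<in> S \<Longrightarrow> \<sigma> x = \<tau> x"
  shows "\<sigma> = \<tau>"
proof (rule Bij_eqI)
  show "\<sigma> \<in> Bij K" "\<tau> \<in> Bij K"
    using assms(2,3) Gal_carrier[OF K] by blast+
  fix x assume "x \<in> K"
  moreover have "field_hom K \<sigma>" "field_hom K \<tau>"
    using assms(2,3) Gal_carrier[OF K] by blast+
  ultimately show "\<sigma> x = \<tau> x"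
    using field_hom_unique[OF K, of \<tau> \<sigma> x] assms(4) by simp
qed

lemma Gal_apply:
  assumes K: "K = generate_field complex_ring S" and \<sigma>: "\<sigma> \<in> carrier (Gal K)"
  shows "x \<in> K \<Longrightarrow> \<sigma> x \<in> K" "x \<in> K \<Longrightarrow> (inv\<^bsub>Gal K\<^esub> \<sigma>) (\<sigma> x) = x" "x \<in> K \<Longrightarrow> \<sigma> ((inv\<^bsub>Gal K\<^esub> \<sigma>) x) = x"
    "inv\<^bsub>Gal K\<^esub> \<sigma> \<in> carrier (Gal K)"
    "\<tau> \<in> carrier (Gal K) \<Longrightarrow> \<sigma> \<otimes>\<^bsub>Gal K\<^esub> \<tau> \<in> carrier (Gal K)"
    "\<tau> \<in> carrier (Gal K) \<Longrightarrow> x \<in> K \<Longrightarrow> (\<sigma> \<otimes>\<^bsub>Gal K\<^esub> \<tau>) x = \<sigma> (\<tau> x)"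
proof -
  interpret group "Gal K"
    by (rule Gal_group[OF K])
  have bij: "\<sigma> \<in> Bij K"
    using \<sigma> by (simp add: Gal_carrier[OF K])
  show "x \<in> K \<Longrightarrow> \<sigma> x \<in> K"
    using Bij_in[OF bij] .
  show "x \<in> K \<Longrightarrow> (inv\<^bsub>Gal K\<^esub> \<sigma>) (\<sigma> x) = x" "x \<in> K \<Longrightarrow> \<sigma> ((inv\<^bsub>Gal K\<^esub> \<sigma>) x) = x"
    unfolding Gal_inv[OF K \<sigma>] using inv_BijGroup_apply[OF bij] by auto
  show "inv\<^bsub>Gal K\<^esub> \<sigma> \<in> carrier (Gal K)" "\<tau> \<in> carrier (Gal K) \<Longrightarrow> \<sigma> \<otimes>\<^bsub>Gal K\<^esub> \<tau> \<in> carrier (Gal K)"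
    using \<sigma> by simp_all
  show "\<tau> \<in> carrier (Gal K) \<Longrightarrow> x \<in> K \<Longrightarrow> (\<sigma> \<otimes>\<^bsub>Gal K\<^esub> \<tau>) x = \<sigma> (\<tau> x)"
    using bij by (simp add: Gal_mult Gal_carrier[OF K] BijGroup_simps compose_def)
qed

lemma field_hom_power:
  assumes "K = generate_field complex_ring S" "field_hom K \<sigma>" "x \<in> K"
  shows "\<sigma> (x ^ n) = \<sigma> x ^ n"
proof (induction n)
  case (Suc n)
  have "x ^ n \<in> K"
    using assms(1,3) generated_field_closed(12) by simp
  then show ?case
    using Suc field_hom_mult[OF assms(1,2)] assms(3) by simp
qed (simp add: field_hom_one[OF assms(1,2)])

lemma G_carrier: "g \<in> carrier (G p) \<longleftrightarrow> g \<in> Bij (mu p) \<and> (\<forall>x\<in>mu p. \<forall>y\<in>mu p. g (x * y) = g x * g y)"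
  using Bij_in[of g "mu p"] by (auto simp: G_def AutoGroup_def auto_def hom_def)

lemma G_mult: "g \<otimes>\<^bsub>G p\<^esub> h = g \<otimes>\<^bsub>BijGroup (mu p)\<^esub> h" "\<one>\<^bsub>G p\<^esub> = (\<lambda>x\<in>mu p. x)"
  by (simp_all add: G_def AutoGroup_def BijGroup_def)

lemma mu_group: "group \<lparr>carrier = mu p, monoid.mult = (*), one = 1\<rparr>"
  by (rule groupI) (auto simp: mu.mult_in mu.one_in mult.assoc intro!: bexI[of _ "inverse _"] mu_inverse dest: mu_nonzero)

lemma G_group: "group (G p)"
  unfolding G_def by (rule group.AutoGroup[OF mu_group])

text \<open>Identifies the Galois group of \<open>Qcyc_prime_to p\<close> with \<open>G p\<close>.
  Field automorphisms preserve \<open>mu p\<close> because they preserve the equation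
  \<open>z ^ n = 1\<close>; they are determined on these generators, and
  \<open>Gal_extension\<close> gives surjectivity.\<close>

theorem restrict_iso: "(\<lambda>\<sigma>. restrict \<sigma> (mu p)) \<in> iso (Gal (Qcyc_prime_to p)) (G p)"
proof -
  define K where "K = Qcyc_prime_to p"
  have K: "K = generate_field complex_ring (mu p)"
    by (simp add: K_def Qcyc_prime_to_def)
  have mu_K: "mu p \<subseteq> K"
    unfolding K by (auto simp: generated_field_closed)
  have \<sigma>_mu: "\<sigma> z \<in> mu p" if \<sigma>: "\<sigma> \<in> carrier (Gal K)" and z: "z \<in> mu p" for \<sigma> z
  proof -
    have hom: "field_hom K \<sigma>"
      using \<sigma> by (simp add: Gal_carrier[OF K])
    obtain n where n: "n > 0" "coprime n p" "z ^ n = 1"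
      using z by (auto simp: mu_def)
    have "\<sigma> z ^ n = 1"
      using field_hom_power[OF K hom, of z n] z mu_K n(3) field_hom_one[OF K hom] by auto
    then show ?thesis
      using n by (auto simp: mu_def)
  qed
  have restr: "restrict \<sigma> (mu p) \<in> carrier (G p)" if "\<sigma> \<in> carrier (Gal K)" for \<sigma>
  proof -
    have "restrict \<sigma> (mu p) \<in> Bij (mu p)"
      by (rule Bij_restrictI[where g = "inv\<^bsub>Gal K\<^esub> \<sigma>"])
        (use that \<sigma>_mu Gal_apply[OF K that] mu_K in blast)+
    moreover have "field_hom K \<sigma>"
      using that by (simp add: Gal_carrier[OF K])
    ultimately show ?thesis
      using mu_K by (auto simp: G_carrier mu.mult_in field_hom_def)
  qed
  have "(\<lambda>\<sigma>. restrict \<sigma> (mu p)) \<in> hom (Gal K) (G p)"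
  proof (rule homI)
    fix \<sigma> \<tau> assume \<sigma>\<tau>: "\<sigma> \<in> carrier (Gal K)" "\<tau> \<in> carrier (Gal K)"
    then have "restrict \<sigma> (mu p) \<in> Bij (mu p)" "restrict \<tau> (mu p) \<in> Bij (mu p)"
      using restr by (auto simp: G_carrier)
    then show "restrict (\<sigma> \<otimes>\<^bsub>Gal K\<^esub> \<tau>) (mu p) = restrict \<sigma> (mu p) \<otimes>\<^bsub>G p\<^esub> restrict \<tau> (mu p)"
      using \<sigma>\<tau> \<sigma>_mu mu_K
      by (auto simp: G_mult BijGroup_simps compose_def Gal_apply[OF K] subset_iff intro!: restrict_ext)
  qed (rule restr)
  moreover have "bij_betw (\<lambda>\<sigma>. restrict \<sigma> (mu p)) (carrier (Gal K)) (carrier (G p))"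
    unfolding bij_betw_def
  proof
    show "inj_on (\<lambda>\<sigma>. restrict \<sigma> (mu p)) (carrier (Gal K))"
      by (intro inj_onI Gal_eqI[OF K]) (auto simp: fun_eq_iff restrict_def split: if_splits)
    show "(\<lambda>\<sigma>. restrict \<sigma> (mu p)) ` carrier (Gal K) = carrier (G p)"
    proof (intro equalityI subsetI)
      fix g assume g: "g \<in> carrier (G p)"
      then have "bij_betw g (mu p) (mu p)" "\<And>x y. x \<in> mu p \<Longrightarrow> y \<in> mu p \<Longrightarrow> g (x * y) = g x * g y"
        by (auto simp: G_carrier Bij_iff)
      then obtain \<sigma> where \<sigma>: "\<sigma> \<in> carrier (Gal K)" "\<And>z. z \<in> mu p \<Longrightarrow> \<sigma> z = g z"
        using mu.Gal_extension[OF K] by blast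
      have "g \<in> extensional (mu p)"
        using g by (auto simp: G_carrier Bij_iff)
      then have "restrict \<sigma> (mu p) = g"
        using \<sigma>(2) by (auto simp: fun_eq_iff restrict_def extensional_def)
      then show "g \<in> (\<lambda>\<sigma>. restrict \<sigma> (mu p)) ` carrier (Gal K)"
        using \<sigma>(1) by blast
    qed (use restr in blast)
  qed
  ultimately show ?thesis
    by (simp add: iso_def K_def)
qed

lemma group_actionI:
  fixes A (structure)
  assumes "group A" and closed: "\<And>g x. g \<in> carrier A \<Longrightarrow> x \<in> E \<Longrightarrow> F g x \<in> E"
    and mult: "\<And>g h x. g \<in> carrier A \<Longrightarrow> h \<in> carrier A \<Longrightarrow> x \<in> E \<Longrightarrow> F (g \<otimes> h) x = F g (F h x)"
    and one: "\<And>x. x \<in> E \<Longrightarrow> F \<one> x = x"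
  shows "group_action A E (\<lambda>g. \<lambda>x\<in>E. F g x)"
proof -
  interpret group A
    by (rule assms(1))
  have bij: "(\<lambda>x\<in>E. F g x) \<in> Bij E" if g: "g \<in> carrier A" for g
  proof (rule Bij_restrictI[where g = "F (inv g)"])
    fix x assume x: "x \<in> E"
    show "F g x \<in> E" "F (inv g) x \<in> E"
      using g x by (auto intro: closed)
    show "F (inv g) (F g x) = x" "F g (F (inv g) x) = x"
      using g x mult[of "inv g" g x] mult[of g "inv g" x] one by auto
  qed
  have "(\<lambda>g. \<lambda>x\<in>E. F g x) \<in> hom A (BijGroup E)"
  proof (rule homI)
    fix g h assume "g \<in> carrier A" "h \<in> carrier A"
    then show "(\<lambda>x\<in>E. F (g \<otimes> h) x) = (\<lambda>x\<in>E. F g x) \<otimes>\<^bsub>BijGroup E\<^esub> (\<lambda>x\<in>E. F h x)"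
      by (simp add: BijGroup_simps bij) (auto simp: compose_def mult closed intro!: restrict_ext)
  qed (simp add: BijGroup_simps bij)
  then show ?thesis
    by (simp add: group_action_def group_hom_def group_hom_axioms_def assms(1) group_BijGroup)
qed

section \<open>The actions of G(p) and equivariance\<close>

context
  fixes p :: nat assumes p: "prime p"
begin

lemma gal_lift_unique:
  assumes "\<sigma> \<in> carrier (Gal Qcyc)" "\<tau> \<in> carrier (Gal Qcyc)"
    "\<And>z. z \<in> mu p \<Longrightarrow> \<sigma> z = \<tau> z" "\<And>z. z \<in> mu_ppower p \<Longrightarrow> \<sigma> z = \<tau> z"
  shows "\<sigma> = \<tau>"
proof (rule Gal_eqI[OF Qcyc_def assms(1,2)])
  fix z assume z: "z \<in> roots_of_unity"
  obtain i j where ij: "z = z ^ i * z ^ j" "z ^ i \<in> mu p" "z ^ j \<in> mu_ppower p"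
    using prime_to_decomposition p z .
  have mem: "z ^ i \<in> Qcyc" "z ^ j \<in> Qcyc"
    using z roots.power_in Qcyc_closed(1) by blast+
  have "field_hom Qcyc \<sigma>" "field_hom Qcyc \<tau>"
    using assms(1,2) by (auto simp: Gal_carrier[OF Qcyc_def])
  then have "\<sigma> (z ^ i * z ^ j) = \<tau> (z ^ i * z ^ j)"
    using mem assms(3)[OF ij(2)] assms(4)[OF ij(3)] by (simp add: field_hom_def)
  then show "\<sigma> z = \<tau> z"
    by (simp flip: ij(1))
qed

text \<open>The map \<open>lift g\<close> applies \<open>g\<close> to the part of order prime to
  \<open>p\<close> and keeps the p-power part. It is an automorphism of the group of all roots of
  unity, with inverse \<open>lift h\<close> for \<open>h\<close> the inverse of \<open>g\<close>, so
  it extends to \<open>Qcyc\<close>.\<close>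

lemma gal_lift_exists:
  assumes g: "g \<in> carrier (G p)"
  obtains \<sigma> where "\<sigma> \<in> carrier (Gal Qcyc)" "\<And>z. z \<in> mu p \<Longrightarrow> \<sigma> z = g z"
    "\<And>z. z \<in> mu_ppower p \<Longrightarrow> \<sigma> z = z"
proof -
  define lift where "lift = (\<lambda>g z. g (prime_to_part p z) * (z / prime_to_part p z))"
  have part: "z / prime_to_part p z \<in> mu_ppower p" "prime_to_part p z \<in> mu p" "prime_to_part p z \<noteq> 0"
    if z: "z \<in> roots_of_unity" for z
  proof -
    obtain i j where ij: "prime_to_part p z = z ^ i" "z = prime_to_part p z * z ^ j"
      "prime_to_part p z \<in> mu p" "z ^ j \<in> mu_ppower p"
      using prime_to_part_powers[OF p z] .
    show "prime_to_part p z \<in> mu p" "prime_to_part p z \<noteq> 0"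
      using ij(3) mu_nonzero by auto
    then have "z / prime_to_part p z = z ^ j"
      using ij(2) by (metis nonzero_mult_div_cancel_left)
    then show "z / prime_to_part p z \<in> mu_ppower p"
      using ij(4) by simp
  qed
  have lift_in: "lift g z \<in> roots_of_unity" and part_lift: "prime_to_part p (lift g z) = g (prime_to_part p z)"
    if g: "g \<in> carrier (G p)" and z: "z \<in> roots_of_unity" for g z
  proof -
    have *: "g (prime_to_part p z) \<in> mu p"
      using g Bij_in part(2)[OF z] by (auto simp: G_carrier)
    show "lift g z \<in> roots_of_unity"
      unfolding lift_def using * part(1)[OF z] mu.finite_order mu_ppower_subset[OF prime_gt_0_nat[OF p]]
      by (intro roots.mult_in) auto
    show "prime_to_part p (lift g z) = g (prime_to_part p z)"
      unfolding lift_def using prime_to_part_unique[OF p * part(1)[OF z]] .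
  qed
  have lift_inverse: "lift h (lift g z) = z"
    if g: "g \<in> carrier (G p)" and h: "\<And>x. x \<in> mu p \<Longrightarrow> h (g x) = x" and z: "z \<in> roots_of_unity" for g h z
  proof -
    have "g (prime_to_part p z) \<in> mu p"
      using g Bij_in part(2)[OF z] by (auto simp: G_carrier)
    then have "g (prime_to_part p z) \<noteq> 0"
      by (rule mu_nonzero)
    moreover have "lift h (lift g z) = h (prime_to_part p (lift g z)) * (lift g z / prime_to_part p (lift g z))"
      by (simp only: lift_def)
    ultimately show ?thesis
      unfolding part_lift[OF g z] h[OF part(2)[OF z]] using part(3)[OF z] by (simp add: lift_def)
  qed
  interpret A: group "G p"
    by (rule G_group)
  define h where "h = inv\<^bsub>G p\<^esub> g"
  have h: "h \<in> carrier (G p)"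
    using g by (simp add: h_def)
  have "h \<otimes>\<^bsub>G p\<^esub> g = \<one>\<^bsub>G p\<^esub>" "g \<otimes>\<^bsub>G p\<^esub> h = \<one>\<^bsub>G p\<^esub>"
    using g by (simp_all add: h_def)
  then have "compose (mu p) h g = (\<lambda>x\<in>mu p. x)" "compose (mu p) g h = (\<lambda>x\<in>mu p. x)"
    using g h by (auto simp: G_mult BijGroup_simps G_carrier)
  then have hg: "h (g x) = x" "g (h x) = x" if "x \<in> mu p" for x
    using that by (metis compose_eq restrict_apply')+
  have "bij_betw (lift g) roots_of_unity roots_of_unity"
    by (rule bij_betw_byWitness[where f' = "lift h"])
      (use g h lift_in lift_inverse hg in auto)
  moreover have "lift g (x * y) = lift g x * lift g y" if "x \<in> roots_of_unity" "y \<in> roots_of_unity" for x y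
    using that g part(2) by (simp add: lift_def prime_to_part_mult[OF p] G_carrier)
  ultimately obtain \<sigma> where \<sigma>: "\<sigma> \<in> carrier (Gal Qcyc)" "\<And>z. z \<in> roots_of_unity \<Longrightarrow> \<sigma> z = lift g z"
    using roots.Gal_extension[OF Qcyc_def] by blast
  have "g 1 = 1"
  proof -
    have "g \<in> Bij (mu p)" "g (1 * 1) = g 1 * g 1"
      using g mu.one_in unfolding G_carrier by blast+
    moreover from this(1) mu.one_in have "g 1 \<in> mu p"
      by (rule Bij_in)
    then have "g 1 \<noteq> 0"
      by (rule mu_nonzero)
    ultimately show ?thesis
      by simp
  qed
  show thesis
  proof
    show "\<sigma> \<in> carrier (Gal Qcyc)"
      by (rule \<sigma>(1))
    show "\<sigma> z = g z" if "z \<in> mu p" for z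
      using that \<sigma>(2)[of z] mu.finite_order prime_to_part_mu[OF p that] mu_nonzero[OF that]
      by (auto simp: lift_def)
    show "\<sigma> z = z" if "z \<in> mu_ppower p" for z
      using that \<sigma>(2)[of z] mu_ppower_subset[OF prime_gt_0_nat[OF p]] prime_to_part_mu_ppower[OF p that] \<open>g 1 = 1\<close>
      by (auto simp: lift_def)
  qed
qed

lemma gal_lift:
  assumes g: "g \<in> carrier (G p)"
  shows "gal_lift p g \<in> carrier (Gal Qcyc)" "z \<in> mu p \<Longrightarrow> gal_lift p g z = g z"
    "z \<in> mu_ppower p \<Longrightarrow> gal_lift p g z = z"
proof -
  have "\<exists>!\<sigma>. \<sigma> \<in> carrier (Gal Qcyc) \<and> (\<forall>z\<in>mu p. \<sigma> z = g z) \<and> (\<forall>z\<in>mu_ppower p. \<sigma> z = z)"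
  proof (rule ex_ex1I)
    show "\<exists>\<sigma>. \<sigma> \<in> carrier (Gal Qcyc) \<and> (\<forall>z\<in>mu p. \<sigma> z = g z) \<and> (\<forall>z\<in>mu_ppower p. \<sigma> z = z)"
      using gal_lift_exists[OF g] by metis
  qed (rule gal_lift_unique, auto)
  from theI'[OF this] show "gal_lift p g \<in> carrier (Gal Qcyc)" "z \<in> mu p \<Longrightarrow> gal_lift p g z = g z"
    "z \<in> mu_ppower p \<Longrightarrow> gal_lift p g z = z"
    by (auto simp: gal_lift_def)
qed

lemma G_mult_apply:
  assumes "g \<in> carrier (G p)" "h \<in> carrier (G p)" "z \<in> mu p"
  shows "(g \<otimes>\<^bsub>G p\<^esub> h) z = g (h z)" "h z \<in> mu p"
  using assms by (auto simp: G_mult BijGroup_simps G_carrier compose_def Bij_in)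

lemma gal_lift_mult:
  assumes g: "g \<in> carrier (G p)" and h: "h \<in> carrier (G p)"
  shows "gal_lift p (g \<otimes>\<^bsub>G p\<^esub> h) = gal_lift p g \<otimes>\<^bsub>Gal Qcyc\<^esub> gal_lift p h"
proof -
  interpret A: group "G p"
    by (rule G_group)
  have gh: "g \<otimes>\<^bsub>G p\<^esub> h \<in> carrier (G p)"
    using g h by simp
  have mem: "z \<in> Qcyc" if "z \<in> mu p \<or> z \<in> mu_ppower p" for z
    using that mu.finite_order mu_ppower_subset[OF prime_gt_0_nat[OF p]] Qcyc_closed(1) by blast
  show ?thesis
  proof (rule gal_lift_unique)
    show "gal_lift p (g \<otimes>\<^bsub>G p\<^esub> h) \<in> carrier (Gal Qcyc)"
      using gh by (rule gal_lift)
    show "gal_lift p g \<otimes>\<^bsub>Gal Qcyc\<^esub> gal_lift p h \<in> carrier (Gal Qcyc)"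
      using gal_lift(1)[OF g] gal_lift(1)[OF h] by (rule Gal_apply[OF Qcyc_def])
    fix z
    show "gal_lift p (g \<otimes>\<^bsub>G p\<^esub> h) z = (gal_lift p g \<otimes>\<^bsub>Gal Qcyc\<^esub> gal_lift p h) z" if z: "z \<in> mu p"
      using Gal_apply(6)[OF Qcyc_def gal_lift(1)[OF g] gal_lift(1)[OF h], of z] mem[of z] z
        G_mult_apply[OF g h z] by (simp add: gal_lift g h gh)
    show "gal_lift p (g \<otimes>\<^bsub>G p\<^esub> h) z = (gal_lift p g \<otimes>\<^bsub>Gal Qcyc\<^esub> gal_lift p h) z" if z: "z \<in> mu_ppower p"
      using Gal_apply(6)[OF Qcyc_def gal_lift(1)[OF g] gal_lift(1)[OF h], of z] mem[of z] z
      by (simp add: gal_lift g h gh)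
  qed
qed

lemma compose_in_Val:
  assumes v: "v \<in> Val p" and \<tau>: "\<tau> \<in> carrier (Gal Qcyc)"
  shows "compose Qcyc v \<tau> \<in> Val p"
proof -
  have \<tau>_in: "\<tau> x \<in> Qcyc" if "x \<in> Qcyc" for x
    using Gal_apply(1)[OF Qcyc_def \<tau> that] .
  have hom: "field_hom Qcyc \<tau>"
    using \<tau> by (simp add: Gal_carrier[OF Qcyc_def])
  note hom_simps = field_hom_simps[OF Qcyc_def hom]
  have zero: "\<tau> x = 0 \<longleftrightarrow> x = 0" if "x \<in> Qcyc" for x
    using field_hom_inverse(2)[OF Qcyc_def hom that] field_hom_zero[OF Qcyc_def hom] by auto
  show ?thesis
    unfolding Val_def is_valuation_def
    using \<tau>_in zero Val_mult[OF p v] Val_add[OF p v] Val_eq_infinity[OF p v] Val_neq_minf[OF p v]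
      Val_of_rat[OF p v] field_hom_of_rat[OF Qcyc_def hom]
    by (auto simp: compose_def hom_simps Qcyc_closed)
qed

lemma act_Val_group_action: "group_action (G p) (Val p) (act_Val p)"
  unfolding act_Val_def
proof (rule group_actionI[OF G_group])
  interpret A: group "G p"
    by (rule G_group)
  interpret Q: group "Gal Qcyc"
    by (rule Gal_group[OF Qcyc_def])
  fix v assume v: "v \<in> Val p"
  \<comment> \<open>An idempotent of a group is its identity, so the lift of the identity is the
    identity.\<close>
  have "gal_lift p \<one>\<^bsub>G p\<^esub> \<otimes>\<^bsub>Gal Qcyc\<^esub> gal_lift p \<one>\<^bsub>G p\<^esub> = gal_lift p \<one>\<^bsub>G p\<^esub>"
    using gal_lift_mult[OF A.one_closed A.one_closed] by simp
  then have "gal_lift p \<one>\<^bsub>G p\<^esub> = \<one>\<^bsub>Gal Qcyc\<^esub>"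
    using gal_lift(1)[OF A.one_closed] by simp
  then have "inv\<^bsub>Gal Qcyc\<^esub> gal_lift p \<one>\<^bsub>G p\<^esub> = \<one>\<^bsub>Gal Qcyc\<^esub>"
    by simp
  then have "inv\<^bsub>Gal Qcyc\<^esub> gal_lift p \<one>\<^bsub>G p\<^esub> = (\<lambda>x\<in>Qcyc. x)"
    by (simp add: Gal_def BijGroup_simps)
  moreover have "v \<in> extensional Qcyc"
    using v by (simp add: Val_def)
  ultimately show "compose Qcyc v (inv\<^bsub>Gal Qcyc\<^esub> gal_lift p \<one>\<^bsub>G p\<^esub>) = v"
    by (auto simp: compose_def extensional_def fun_eq_iff)
  fix g assume g: "g \<in> carrier (G p)"
  then show "compose Qcyc v (inv\<^bsub>Gal Qcyc\<^esub> gal_lift p g) \<in> Val p"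
    using v gal_lift(1) by (intro compose_in_Val) auto
  fix h assume h: "h \<in> carrier (G p)"
  note gh = gal_lift(1)[OF g] gal_lift(1)[OF h]
  show "compose Qcyc v (inv\<^bsub>Gal Qcyc\<^esub> gal_lift p (g \<otimes>\<^bsub>G p\<^esub> h)) =
      compose Qcyc (compose Qcyc v (inv\<^bsub>Gal Qcyc\<^esub> gal_lift p h)) (inv\<^bsub>Gal Qcyc\<^esub> gal_lift p g)"
  proof (rule extensionalityI[of _ Qcyc])
    fix x assume x: "x \<in> Qcyc"
    then show "compose Qcyc v (inv\<^bsub>Gal Qcyc\<^esub> gal_lift p (g \<otimes>\<^bsub>G p\<^esub> h)) x =
        compose Qcyc (compose Qcyc v (inv\<^bsub>Gal Qcyc\<^esub> gal_lift p h)) (inv\<^bsub>Gal Qcyc\<^esub> gal_lift p g) x"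
      using gh Gal_apply(1,6)[OF Qcyc_def Q.inv_closed]
      by (simp add: gal_lift_mult[OF g h] Q.inv_mult_group compose_def)
  qed auto
qed

lemma extend_zero:
  assumes g: "g \<in> carrier (G p)"
  shows "extend_zero p g \<in> Bij (M p)" "x \<in> M p \<Longrightarrow> y \<in> M p \<Longrightarrow> extend_zero p g (x * y) = extend_zero p g x * extend_zero p g y"
    "extend_zero p g 0 = 0" "x \<in> mu p \<Longrightarrow> extend_zero p g x = g x"
    "x \<in> M p \<Longrightarrow> extend_zero p g x = gal_lift p g x"
proof -
  have bij: "g \<in> Bij (mu p)" and mult: "\<And>x y. x \<in> mu p \<Longrightarrow> y \<in> mu p \<Longrightarrow> g (x * y) = g x * g y"
    using g by (auto simp: G_carrier)
  have eq: "extend_zero p g x = (if x = 0 then 0 else g x)" if "x \<in> M p" for x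
    using that by (simp add: extend_zero_def)
  have inv: "inv_into (mu p) g x \<in> mu p" "g (inv_into (mu p) g x) = x" "inv_into (mu p) g (g x) = x"
    "g x \<in> mu p" if "x \<in> mu p" for x
    using bij that by (auto simp: Bij_def bij_betw_def inv_into_into f_inv_into_f)
  show "extend_zero p g \<in> Bij (M p)"
    unfolding extend_zero_def
    by (rule Bij_restrictI[where g = "\<lambda>x. if x = 0 then 0 else inv_into (mu p) g x"])
      (auto simp: M_def inv mu_nonzero dest: inv(1)[THEN mu_nonzero] inv(4)[THEN mu_nonzero])
  show "extend_zero p g 0 = 0"
    by (simp add: eq M_zero)
  show 1: "extend_zero p g x = g x" if "x \<in> mu p" for x
    using that by (simp add: eq M_mu mu_nonzero)
  show "x \<in> M p \<Longrightarrow> y \<in> M p \<Longrightarrow> extend_zero p g (x * y) = extend_zero p g x * extend_zero p g y"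
    using mult M_nonzero by (auto simp: eq M_mult)
  show "x \<in> M p \<Longrightarrow> extend_zero p g x = gal_lift p g x"
    using gal_lift[OF g] field_hom_zero[OF Qcyc_def] M_nonzero[of x p]
    by (auto simp: eq Gal_carrier[OF Qcyc_def])
qed

text \<open>A multiplicative bijection \<open>e\<close> with inverse \<open>d\<close> conjugates the
  rotation by \<open>d \<zeta>\<close> into the rotation by \<open>\<zeta>\<close>. Hence the
  commutation rule of \<open>s\<close> at \<open>d \<zeta>\<close> becomes that of the conjugate at
  \<open>\<zeta>\<close>.\<close>

lemma conj_by_in_Sigma_p:
  assumes e: "e \<in> Bij (M p)" "\<And>x y. x \<in> M p \<Longrightarrow> y \<in> M p \<Longrightarrow> e (x * y) = e x * e y" "e 0 = 0"
    and s: "s \<in> Sigma_p p"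
  shows "conj_by p e s \<in> Sigma_p p"
proof -
  have s: "s \<in> Bij (M p)" "s 0 = 1" "\<And>x. x \<in> M p \<Longrightarrow> (s ^^ p) x = x"
    "\<And>\<zeta> x. \<zeta> \<in> mu p \<Longrightarrow> x \<in> M p \<Longrightarrow> s (\<zeta> * s (x / \<zeta>)) = \<zeta> * s (s x / \<zeta>)"
    using s by (auto simp: Sigma_p_iff)
  define d where "d = inv\<^bsub>BijGroup (M p)\<^esub> e"
  have d: "d (e x) = x" "d x \<in> M p" "e (d x) = x" if "x \<in> M p" for x
    using inv_BijGroup_apply[OF e(1) that] by (auto simp: d_def)
  have e_in: "e x \<in> M p" if "x \<in> M p" for x
    using Bij_in e(1) that .
  have s_in: "s x \<in> M p" if "x \<in> M p" for x
    using Bij_in s(1) that .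
  define t where "t = conj_by p e s"
  have t: "t \<in> Bij (M p)" "\<And>x. x \<in> M p \<Longrightarrow> t x = e (s (d x))"
    using conj_by_Bij[OF e(1) s(1)] by (auto simp: t_def d_def)
  have e_1: "e 1 = 1"
  proof -
    have "e 1 * e 1 = e 1"
      using e(2)[OF M_one M_one] by simp
    moreover have "e 1 \<noteq> 0"
      using e(3) Bij_inj[OF e(1) M_one M_zero] by simp
    ultimately show ?thesis
      by simp
  qed
  have d_0: "d 0 = 0"
    using d(1)[OF M_zero] e(3) by simp
  have d_mult: "d (x * y) = d x * d y" if "x \<in> M p" "y \<in> M p" for x y
    using d(1)[OF M_mult[OF d(2)[OF that(1)] d(2)[OF that(2)]]] e(2)[OF d(2) d(2)] d(3) that by simp
  have d_divide: "d (x / y) = d x / d y" "d y \<noteq> 0" if "x \<in> M p" "y \<in> mu p" for x y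
  proof -
    have "d (x / y) * d y = d x"
      using d_mult[of "x / y" y] that mu_nonzero[OF that(2)] by (simp add: M_divide M_mu)
    moreover show "d y \<noteq> 0"
      using d(3)[OF M_mu[OF that(2)]] e(3) mu_nonzero[OF that(2)] by auto
    ultimately show "d (x / y) = d x / d y"
      by (simp add: field_simps)
  qed
  show ?thesis
    unfolding t_def[symmetric] Sigma_p_iff
  proof (intro conjI ballI)
    show "t \<in> Bij (M p)"
      by (rule t(1))
    show "t 0 = 1"
      using t(2)[OF M_zero] by (simp add: d_0 s(2) e_1)
    fix \<zeta> x assume \<zeta>: "\<zeta> \<in> mu p" and x: "x \<in> M p"
    have d\<zeta>: "d \<zeta> \<in> mu p"
      using d_divide(2)[OF x \<zeta>] d(2)[OF M_mu[OF \<zeta>]] M_nonzero by blast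
    have x\<zeta>: "x / \<zeta> \<in> M p"
      using x \<zeta> M_divide M_mu by blast
    note mem = M_mu[OF \<zeta>] M_mu[OF d\<zeta>] d(2)[OF x] s_in[OF d(2)[OF x]] e_in[OF s_in[OF d(2)[OF x]]]
      M_divide[OF d(2)[OF x] M_mu[OF d\<zeta>]] M_divide[OF s_in[OF d(2)[OF x]] M_mu[OF d\<zeta>]]
      e_in[OF s_in[OF d(2)[OF x\<zeta>]]] s_in[OF d(2)[OF x\<zeta>]] d(2)[OF x\<zeta>]
    have "t (\<zeta> * t (x / \<zeta>)) = e (s (d \<zeta> * s (d x / d \<zeta>)))"
      using mem x x\<zeta> \<zeta> by (simp add: t M_mult d_mult d(1) d_divide(1))
    also have "\<dots> = e (d \<zeta> * s (s (d x) / d \<zeta>))"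
      using s(4)[OF d\<zeta> d(2)[OF x]] by simp
    also have "\<dots> = \<zeta> * t (t x / \<zeta>)"
      using mem x \<zeta> by (simp add: t M_divide e(2) s_in d(1,3) d_divide(1))
    finally show "t (\<zeta> * t (x / \<zeta>)) = \<zeta> * t (t x / \<zeta>)" .
  next
    fix x assume x: "x \<in> M p"
    have "(t ^^ n) x = e ((s ^^ n) (d x)) \<and> (s ^^ n) (d x) \<in> M p" for n
    proof (induction n)
      case (Suc n)
      then show ?case
        by (auto simp: t(2) e_in d(1) s_in)
    qed (use x d in simp)
    then show "(t ^^ p) x = x"
      using s(3) d x by simp
  qed
qed

lemma act_Sigma_group_action: "group_action (G p) (Sigma_p p) (act_Sigma p)"
  unfolding act_Sigma_def
proof (rule group_actionI[OF G_group])
  interpret A: group "G p"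
    by (rule G_group)
  interpret B: group "BijGroup (M p)"
    by (rule group_BijGroup)
  fix s assume s: "s \<in> Sigma_p p"
  then have s': "s \<in> carrier (BijGroup (M p))"
    by (simp add: Sigma_p_def)
  have ext: "extend_zero p g \<in> carrier (BijGroup (M p))" if "g \<in> carrier (G p)" for g
    using extend_zero(1)[OF that] by (simp add: BijGroup_simps)
  have "extend_zero p \<one>\<^bsub>G p\<^esub> = \<one>\<^bsub>BijGroup (M p)\<^esub>"
    by (auto simp: extend_zero_def G_mult BijGroup_simps M_def intro!: restrict_ext)
  then show "conj_by p (extend_zero p \<one>\<^bsub>G p\<^esub>) s = s"
    using s' by (simp add: conj_by_def)
  fix g assume g: "g \<in> carrier (G p)"
  show "conj_by p (extend_zero p g) s \<in> Sigma_p p"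
    using extend_zero[OF g] s by (intro conj_by_in_Sigma_p)
  fix h assume h: "h \<in> carrier (G p)"
  have "extend_zero p (g \<otimes>\<^bsub>G p\<^esub> h) = extend_zero p g \<otimes>\<^bsub>BijGroup (M p)\<^esub> extend_zero p h"
  proof (rule Bij_eqI)
    show "extend_zero p (g \<otimes>\<^bsub>G p\<^esub> h) \<in> Bij (M p)"
      using g h by (intro extend_zero) simp
    show "extend_zero p g \<otimes>\<^bsub>BijGroup (M p)\<^esub> extend_zero p h \<in> Bij (M p)"
      using ext[OF g] ext[OF h] B.m_closed by (metis BijGroup_simps(1))
    fix x assume x: "x \<in> M p"
    show "extend_zero p (g \<otimes>\<^bsub>G p\<^esub> h) x = (extend_zero p g \<otimes>\<^bsub>BijGroup (M p)\<^esub> extend_zero p h) x"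
    proof (cases "x = 0")
      case True
      then show ?thesis
        using g h extend_zero by (simp add: BijGroup_simps compose_def M_zero)
    next
      case False
      then have "x \<in> mu p"
        using x M_nonzero by blast
      then show ?thesis
        using g h x G_mult_apply[OF g h] extend_zero(1,4) by (simp add: BijGroup_simps compose_def)
    qed
  qed
  then show "conj_by p (extend_zero p (g \<otimes>\<^bsub>G p\<^esub> h)) s = conj_by p (extend_zero p g) (conj_by p (extend_zero p h) s)"
    using s' ext[OF g] ext[OF h] by (simp add: conj_by_def B.m_assoc B.inv_mult_group)
qed

text \<open>The lift \<open>\<sigma>\<close> preserves addition and 1, acts on \<open>M p\<close> as
  \<open>e\<close>, and takes the positive part of \<open>v\<close> to that of \<open>w\<close>. So
  the congruence of \<open>t + 1\<close> and \<open>s t\<close> at \<open>v\<close> is carried to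
  one of \<open>e t + 1\<close> and \<open>e (s t)\<close> at \<open>w\<close>, which identifies the
  translation at \<open>w\<close> as the conjugate of \<open>s\<close>.\<close>

lemma s_val_equivariant:
  assumes g: "g \<in> carrier (G p)" and v: "v \<in> Val p"
  shows "s_val p (act_Val p g v) = act_Sigma p g (s_val p v)"
proof -
  define \<sigma> where "\<sigma> = gal_lift p g"
  have \<sigma>: "\<sigma> \<in> carrier (Gal Qcyc)"
    unfolding \<sigma>_def using g by (rule gal_lift)
  define \<tau> where "\<tau> = inv\<^bsub>Gal Qcyc\<^esub> \<sigma>"
  have \<tau>: "\<tau> \<in> carrier (Gal Qcyc)"
    unfolding \<tau>_def using \<sigma> by (rule Gal_apply(4)[OF Qcyc_def])
  define w where "w = compose Qcyc v \<tau>"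
  have w: "w \<in> Val p"
    unfolding w_def using v \<tau> by (rule compose_in_Val)
  have act_w: "act_Val p g v = w"
    using v by (simp add: act_Val_def w_def \<tau>_def \<sigma>_def)
  interpret V: place p "val_place v"
    using p v by (rule place_val_place)
  interpret W: place p "val_place w"
    using p w by (rule place_val_place)
  define s where "s = s_val p v"
  have s: "s = V.translation 1" "s \<in> Sigma_p p"
    using s_val_eq_translation[OF p v] V.translation_in_Sigma_p by (auto simp: s_def)
  have sB: "s \<in> Bij (M p)"
    using s(2) by (simp add: Sigma_p_iff)
  define e where "e = extend_zero p g"
  have e: "e \<in> Bij (M p)" "\<And>x. x \<in> M p \<Longrightarrow> e x = \<sigma> x"
    using extend_zero(1,5)[OF g] by (auto simp: e_def \<sigma>_def)
  have M_Qcyc: "x \<in> Qcyc" if "x \<in> M p" for x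
    using that M_subset_Zcyc Zcyc_subset_Qcyc by blast
  have "W.translation 1 = conj_by p e s"
  proof (rule Bij_eqI)
    show "W.translation 1 \<in> Bij (M p)"
      using roots.int_span_1 by (rule W.translation_Bij)
    show "conj_by p e s \<in> Bij (M p)"
      using e(1) sB by (rule conj_by_Bij)
    fix x assume x: "x \<in> M p"
    define t where "t = (inv\<^bsub>BijGroup (M p)\<^esub> e) x"
    have t: "t \<in> M p" "e t = x"
      using inv_BijGroup_apply[OF e(1) x] by (auto simp: t_def)
    have st: "s t \<in> M p" and est: "e (s t) \<in> M p"
      using Bij_in[OF sB t(1)] Bij_in[OF e(1)] by auto
    have mem: "t + 1 - s t \<in> Qcyc"
      using M_Qcyc[OF t(1)] M_Qcyc[OF st] by (intro Qcyc_closed(2,5,6))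
    have "field_hom Qcyc \<sigma>"
      using \<sigma> by (simp add: Gal_carrier[OF Qcyc_def])
    then have "\<sigma> (t + 1 - s t) = \<sigma> t + 1 - \<sigma> (s t)"
      using M_Qcyc[OF t(1)] M_Qcyc[OF st]
      by (simp add: field_hom_diff[OF Qcyc_def] field_hom_simps[OF Qcyc_def] Qcyc_closed)
    then have \<sigma>_eq: "x + 1 - e (s t) = \<sigma> (t + 1 - s t)"
      using t e(2) st by metis
    then have "w (x + 1 - e (s t)) = v (t + 1 - s t)"
      using Gal_apply(1,2)[OF Qcyc_def \<sigma> mem] by (simp add: w_def compose_def \<tau>_def)
    also have "\<dots> > 0"
      using V.translation(2)[OF roots.int_span_1 t(1)] by (simp add: s(1) val_place_def)
    finally have "x + 1 - e (s t) \<in> val_place w"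
      using x est M_subset_Zcyc by (auto simp: val_place_def intro!: roots.int_span_closed(1,3,7))
    then show "W.translation 1 x = conj_by p e s x"
      using x est conj_by_Bij(2)[OF e(1) sB x] by (simp add: t_def W.translation_eqI)
  qed
  then have "s_val p w = conj_by p e s"
    using s_val_eq_translation[OF p w] by simp
  then show ?thesis
    using s(2) by (simp add: act_w act_Sigma_def e_def s_def)
qed

end

text \<open>The isomorphism in the second conjunct justifies reading \<open>G p\<close> as the
  Galois group, and the two group actions give meaning to the equivariance in the last
  conjunct.\<close>

theorem proposition8p8:
  fixes p :: nat
  assumes "prime p"
  shows "bij_betw (s_val p) (Val p) (Sigma_p p) \<and>
    (\<lambda>\<sigma>. restrict \<sigma> (mu p)) \<in> iso (Gal (Qcyc_prime_to p)) (G p) \<and>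
    group_action (G p) (Val p) (act_Val p) \<and>
    group_action (G p) (Sigma_p p) (act_Sigma p) \<and>
    (\<forall>g\<in>carrier (G p). \<forall>v\<in>Val p. s_val p (act_Val p g v) = act_Sigma p g (s_val p v))"
  using bij_betw_s_val[OF assms] restrict_iso act_Val_group_action[OF assms]
    act_Sigma_group_action[OF assms] s_val_equivariant[OF assms] by blast

end
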